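(* Let $k>0$, $\alpha>0$ and $1<p<\frac{2k+1}{\alpha}$, and define $q$ by $\frac1q=\frac1p-\frac{\alpha}{2k+1}$. There is a constant $C=C(\alpha,p)$ such that for every $f\in L^2([-\pi,\pi],dm_k)\cap L^p([-\pi,\pi],dm_k)$, $$\|I_k^\alpha(f)\|_{q,k}\le C\,\|f\|_{p,k}.$$
   Context: Fix $k>0$. The Cherednik operator of type $A_1$ is $T^k f(x)=f'(x)+2k\,\frac{f(x)-f(-x)}{1-e^{-2x}}-k f(x)$. On $\mathbb{Z}$ define the partial order $j\triangleleft n$ iff either ($|j|<|n|$ and $|n|-|j|$ is a positive even integer) or ($|j|=|n|$ and $n<j$). Let $dm_k(x)=|\sin x|^{2k}dx$ on $[-\pi,\pi]$, $(f,g)_k=\int_{-\pi}^{\pi}f\bar g\,dm_k$, and $\|\cdot\|_{p,k}$ the norm of $L^p([-\pi,\pi],dm_k)$. For $n\in\mathbb{Z}$, $E_n^k$ is the unique function $E_n^k(z)=e^{nz}+\sum_{j\triangleleft n}c_{n,j}e^{jz}$ ($z\in\mathbb{C}$) with $(E_n^k(i\cdot),e^{ij\cdot})_k=0$ for all $j\triangleleft n$; the $c_{n,j}$ are real and nonnegative, $T^kE_n^k=n_kE_n^k$ ($n_k=n+k$ for $n>0$, $n_k=n-k$ for $n\le0$), $E_n^k(0)>0$, and $\{E_n^k(i\cdot)\}_{n\in\mathbb{Z}}$ is an orthogonal basis of $L^2([-\pi,\pi],dm_k)$. Set $\mathcal{E}_n^k(ix)=E_n^k(ix)/E_n^k(0)$.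 For $f=\sum_{n\in\mathbb{Z}}a_n\mathcal{E}_n^k(i\cdot)\in L^2([-\pi,\pi],dm_k)$ and $\alpha>0$, the fractional integral is $I_k^\alpha(f)=\sum_{n\in\mathbb{Z},\,n\ne0}|n|^{-\alpha}a_n\mathcal{E}_n^k(i\cdot)$. *)

theory Defs
  imports "HOL-Analysis.Analysis"
begin

definition mk :: "real \<Rightarrow> real measure" where
  "mk k = density lborel (\<lambda>x. ennreal (indicator {-pi..pi} x * \<bar>sin x\<bar> powr (2 * k)))"

definition inner_k :: "real \<Rightarrow> (real \<Rightarrow> complex) \<Rightarrow> (real \<Rightarrow> complex) \<Rightarrow> complex" where
  "inner_k k f g = (\<integral>x. f x * cnj (g x) \<partial>mk k)"

definition Lp_mem :: "real \<Rightarrow> real \<Rightarrow> (real \<Rightarrow> complex) \<Rightarrow> bool" where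
  "Lp_mem k p f \<longleftrightarrow> f \<in> borel_measurable (mk k) \<and> integrable (mk k) (\<lambda>x. norm (f x) powr p)"

definition Lp_norm :: "real \<Rightarrow> real \<Rightarrow> (real \<Rightarrow> complex) \<Rightarrow> real" where
  "Lp_norm k p f = (\<integral>x. norm (f x) powr p \<partial>mk k) powr (1 / p)"

definition tri :: "int \<Rightarrow> int \<Rightarrow> bool" where
  "tri j n \<longleftrightarrow> (\<bar>j\<bar> < \<bar>n\<bar> \<and> even (\<bar>n\<bar> - \<bar>j\<bar>)) \<or> (\<bar>j\<bar> = \<bar>n\<bar> \<and> n < j)"

text \<open>Non-symmetric Jacobi (Opdam-Cherednik) polynomials E_n^k, defined as the unique
  function of the triangular form orthogonal to all lower exponentials.\<close>
definition Ek :: "real \<Rightarrow> int \<Rightarrow> complex \<Rightarrow> complex" where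
  "Ek k n = (THE E. \<exists>c :: int \<Rightarrow> complex.
      E = (\<lambda>z. exp (of_int n * z) + (\<Sum>j\<in>{j. tri j n}. c j * exp (of_int j * z))) \<and>
      (\<forall>j. tri j n \<longrightarrow> inner_k k (\<lambda>x. E (\<i> * of_real x)) (\<lambda>x. exp (\<i> * of_int j * of_real x)) = 0))"

definition calE :: "real \<Rightarrow> int \<Rightarrow> real \<Rightarrow> complex" where
  "calE k n x = Ek k n (\<i> * of_real x) / Ek k n 0"

definition coef :: "real \<Rightarrow> (real \<Rightarrow> complex) \<Rightarrow> int \<Rightarrow> complex" where
  "coef k f n = inner_k k f (calE k n) / inner_k k (calE k n) (calE k n)"

definition fracI_partial :: "real \<Rightarrow> real \<Rightarrow> (real \<Rightarrow> complex) \<Rightarrow> nat \<Rightarrow> real \<Rightarrow> complex" where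
  "fracI_partial k \<alpha> f N x =
     (\<Sum>n\<in>{- int N..int N} - {0}. of_real (real_of_int \<bar>n\<bar> powr (- \<alpha>)) * coef k f n * calE k n x)"

end

theory Submission
  imports Defs
begin

text \<open>
  The functions \<open>E\<^sub>n\<close> and \<open>E\<^bsub>-n\<^esub>\<close> span the restrictions to the circle of the Dunkl harmonics of degree \<open>\<bar>n\<bar>\<close>
  for the weight \<open>\<bar>x\<^sub>2\<bar>\<^bsup>2k\<^esup>\<close>, and the multiplier \<open>\<bar>n\<bar>\<^bsup>-\<alpha>\<^esup>\<close> only sees this degree. Summing the reproducing
  kernels \<open>Z\<^sub>n\<close> of these two-dimensional spaces with weights \<open>r\<^sup>n\<close> gives a Poisson kernel \<open>P\<^sub>r\<close>. The maximum
  principle for the Dunkl Laplacian bounds the \<open>L\<^sup>1\<close> norms of \<open>P\<^sub>r(x, \<cdot>)\<close> by one, and the explicit norms of the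
  \<open>E\<^sub>n\<close> together with the binomial series give \<open>\<bar>P\<^sub>r\<bar> \<le> C (1 - r)\<^bsup>-(2k+1)\<^esup>\<close>. Since
  \<open>n\<^bsup>-\<alpha>\<^esup> \<Gamma>(\<alpha>) = \<integral> t\<^bsup>\<alpha>-1\<^esup> e\<^bsup>-nt\<^esup> dt\<close>, the fractional integral is an average of Poisson operators with \<open>r = e\<^bsup>-t\<^esup>\<close>,
  and the two bounds yield the bilinear form of the Hardy--Littlewood--Sobolev inequality.
\<close>

section \<open>The bilinear Hardy--Littlewood--Sobolev inequality\<close>

text \<open>The bound for the kernels Z_n grows like n^(2k), and \<alpha> < 2k+1, so multiplying it
  by n^(-\<alpha>) never gives a summable majorant; moreover the fractional integral is known only
  as an L^2 limit g of partial sums. Each pairing with a bounded h is therefore damped by rho^n with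
  rho < 1, estimated uniformly in rho, and freed of rho at the end. The L^q norm of g is then
  recovered by duality. The constant mode has to be split off: as r tends to 0, P_r tends to Z_0 and
  not to 0, so only P_r - Z_0 can be bounded by a multiple of t^(-D), D = 2k+1, for all t > 0. This
  costs an L^1 bound of 2 in place of 1. In the bilinear estimate the integrand is split along H^v =
  F^p, where 1/p + 1/v = 1 + \<alpha>/D, so that v is the exponent conjugate to q. The two kernel
  bounds then give the strong-type inequality at once, and the conditions p > 1 and v > 1 are what
  makes the integrals in t converge.\<close>

lemma nn_integral_powr_near_0:
  fixes a T :: real
  assumes "0 < a" "0 \<le> T"
  shows "(\<integral>\<^sup>+t. ennreal (t powr (a - 1)) * indicator {0..T} t \<partial>lborel) = ennreal (T powr a / a)"
  using nn_integral_has_integral_lebesgue'[OF _ has_integral_powr_from_0[of "a - 1" T]] assms by simp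

lemma nn_integral_powr_near_inf:
  fixes b T :: real
  assumes "0 < b" "0 < T"
  shows "(\<integral>\<^sup>+t. ennreal (t powr (- b - 1)) * indicator {T..} t \<partial>lborel) = ennreal (T powr - b / b)"
  using nn_integral_has_integral_lebesgue'[OF _ has_integral_powr_to_inf[of "- b - 1" T]] assms by simp

text \<open>The two entries of the minimum agree at t = s^(-p/D), which is \<open>t0\<close>. Below
  it the first is used and the integral converges because 0 < a; above it the second is used and the
  integral converges because a < D * th.\<close>

lemma nn_integral_powr_min_le:
  fixes s :: real
  assumes s: "0 < s" and a: "0 < a" "a < D * th" and D: "0 < D"
  shows "(\<integral>\<^sup>+t. ennreal (t powr (a - 1) * min (s powr (p * th)) (t powr - (D * th))) * indicator {0<..} t \<partial>lborel)
    \<le> ennreal ((1 / a + 1 / (D * th - a)) * s powr (p * th - p * a / D))"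
proof -
  let ?m = "\<lambda>t. t powr (a - 1) * min (s powr (p * th)) (t powr - (D * th))"
  define t0 where "t0 = s powr - (p / D)"
  define b where "b = D * th - a"
  have t0: "0 < t0" using s by (simp add: t0_def)
  have b: "0 < b" using a by (simp add: b_def)
  have "(\<integral>\<^sup>+t. ennreal (?m t) * indicator {0<..} t \<partial>lborel)
    \<le> (\<integral>\<^sup>+t. ennreal (s powr (p * th)) * (ennreal (t powr (a - 1)) * indicator {0..t0} t)
         + ennreal (t powr (- b - 1)) * indicator {t0..} t \<partial>lborel)"
  proof (rule nn_integral_mono)
    fix t :: real
    show "ennreal (?m t) * indicator {0<..} t
      \<le> ennreal (s powr (p * th)) * (ennreal (t powr (a - 1)) * indicator {0..t0} t)
         + ennreal (t powr (- b - 1)) * indicator {t0..} t"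
    proof (cases "0 < t")
      case True
      show ?thesis
      proof (cases "t \<le> t0")
        case le: True
        have "ennreal (?m t)
          \<le> ennreal (s powr (p * th) * t powr (a - 1))"
          using mult_left_mono[of "min (s powr (p * th)) (t powr - (D * th))" "s powr (p * th)" "t powr (a - 1)"]
          by (intro ennreal_leI) (simp add: mult.commute)
        also have "\<dots> = ennreal (s powr (p * th)) * (ennreal (t powr (a - 1)) * indicator {0..t0} t)"
          using True le by (simp add: ennreal_mult)
        finally show ?thesis using True by (simp add: add_increasing2)
      next
        case False
        have "?m t \<le> t powr (a - 1) * t powr - (D * th)"
          by (intro mult_left_mono) auto
        also have "\<dots> = t powr (- b - 1)" unfolding powr_add[symmetric] b_def by (simp add: algebra_simps)
        finally show ?thesis using True False by (auto intro!: ennreal_leI)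
      qed
    qed simp
  qed
  also have "\<dots> = ennreal (s powr (p * th)) * ennreal (t0 powr a / a) + ennreal (t0 powr - b / b)"
    using nn_integral_powr_near_0[OF a(1), of t0] nn_integral_powr_near_inf[OF b t0] t0
    by (simp add: nn_integral_add nn_integral_cmult)
  also have "\<dots> = ennreal (s powr (p * th) * (t0 powr a / a) + t0 powr - b / b)"
    using a b by (simp add: ennreal_mult'[symmetric])
  also have "s powr (p * th) * (t0 powr a / a) + t0 powr - b / b
      = (1 / a + 1 / (D * th - a)) * s powr (p * th - p * a / D)"
  proof -
    have "s powr (p * th) * t0 powr a = s powr (p * th - p * a / D)"
      unfolding t0_def powr_powr powr_add[symmetric] by (simp add: field_simps)
    moreover have "t0 powr - b = s powr (p * th - p * a / D)"
    proof -
      have "- (p / D) * - b = p * th - p * a / D" using D by (simp add: b_def field_simps)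
      then show ?thesis unfolding t0_def powr_powr by (rule arg_cong)
    qed
    ultimately show ?thesis by (simp add: b_def distrib_right)
  qed
  finally show ?thesis .
qed

abbreviation tweight :: "real \<Rightarrow> real \<Rightarrow> ennreal" where
  "tweight a t \<equiv> ennreal (t powr (a - 1)) * indicator {0<..} t"

text \<open>The next definitions bound the part \<open>H\<^sup>v \<le> F\<^sup>p\<close> of the bilinear form. For \<open>t \<le> H\<^bsup>-v/D\<^esup>\<close> only the
  uniform bound on the integrals of the kernel is used, for larger \<open>t\<close> only its size \<open>\<Lambda> t\<^bsup>-D\<^esup>\<close>.\<close>

context sigma_finite_measure
begin

definition hls_near :: "real \<Rightarrow> real \<Rightarrow> real \<Rightarrow> ('a \<Rightarrow> real) \<Rightarrow> real \<Rightarrow> ennreal" where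
  "hls_near D p v F t = (\<integral>\<^sup>+y. ennreal (2 * F y * min (F y powr (p * (1 / v))) (t powr - (D * (1 / v)))) \<partial>M)"

definition hls_far :: "real \<Rightarrow> real \<Rightarrow> real \<Rightarrow> real \<Rightarrow> ('a \<Rightarrow> real) \<Rightarrow> ('a \<Rightarrow> real) \<Rightarrow> real \<Rightarrow> ennreal" where
  "hls_far D \<Lambda> p v F H t = (\<integral>\<^sup>+y. \<integral>\<^sup>+x. ennreal (\<Lambda> * t powr - D * F y * H x)
      * (if H x powr v \<le> F y powr p \<and> H x powr - (v / D) < t then 1 else 0) \<partial>M \<partial>M)"

lemma hls_near_measurable [measurable]:
  assumes [measurable]: "F \<in> borel_measurable M"
  shows "hls_near D p v F \<in> borel_measurable borel"
  unfolding hls_near_def by measurable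

lemma hls_far_measurable [measurable]:
  assumes [measurable]: "F \<in> borel_measurable M" "H \<in> borel_measurable M"
  shows "hls_far D \<Lambda> p v F H \<in> borel_measurable borel"
  unfolding hls_far_def by measurable

text \<open>Where H^v <= F^p and t <= H^(-v/D), the value of H at x is at most F^(p/v) and at most
  t^(-D/v), hence at most a minimum that no longer depends on x; the kernel then integrates out in x
  with the bound 2. For larger t the kernel is replaced by its supremum, so that only F and H
  remain.\<close>

lemma hls_half_pointwise:
  fixes F H :: "'a \<Rightarrow> real" and w :: "'a \<Rightarrow> 'a \<Rightarrow> real"
  assumes [measurable]: "F \<in> borel_measurable M" "H \<in> borel_measurable M"
      "(\<lambda>(x, y). w x y) \<in> borel_measurable (M \<Otimes>\<^sub>M M)"
    and nonneg: "\<And>y. 0 \<le> F y" "\<And>x. 0 \<le> H x" "\<And>x y. 0 \<le> w x y"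
    and col: "\<And>y. (\<integral>\<^sup>+x. ennreal (w x y) \<partial>M) \<le> 2"
    and sup: "\<And>x y. w x y \<le> \<Lambda> * t powr - D"
    and pos: "0 < t" "0 < D" "0 < p" "0 < v"
  shows "(\<integral>\<^sup>+y. \<integral>\<^sup>+x. ennreal (w x y * F y * H x) * (if H x powr v \<le> F y powr p then 1 else 0) \<partial>M \<partial>M)
    \<le> hls_near D p v F t + hls_far D \<Lambda> p v F H t"
proof -
  let ?far = "\<lambda>x y. ennreal (\<Lambda> * t powr - D * F y * H x)
          * (if H x powr v \<le> F y powr p \<and> H x powr - (v / D) < t then 1 else 0)"
  let ?m = "\<lambda>y. min (F y powr (p * (1 / v))) (t powr - (D * (1 / v)))"
  have pt: "ennreal (w x y * F y * H x) * (if H x powr v \<le> F y powr p then 1 else 0)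
      \<le> ennreal (F y * ?m y) * ennreal (w x y) + ?far x y" for x y
  proof (cases "H x powr v \<le> F y powr p \<and> H x \<noteq> 0")
    case False
    then consider "w x y * F y * H x = 0" | "\<not> H x powr v \<le> F y powr p" by fastforce
    then have "ennreal (w x y * F y * H x) * (if H x powr v \<le> F y powr p then 1 else 0) = 0"
      by cases (simp_all only: ennreal_0 mult_zero_left if_False mult_zero_right)
    then show ?thesis by (simp only: zero_le)
  next
    case True
    then have H: "0 < H x" using nonneg(2)[of x] by simp
    show ?thesis
    proof (cases "H x powr - (v / D) < t")
      case far: True
      have "w x y * (F y * H x) \<le> \<Lambda> * t powr - D * (F y * H x)"
        using sup nonneg by (intro mult_right_mono) auto
      then show ?thesis
        using True far by (auto intro!: add_increasing ennreal_leI simp: mult.assoc)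
    next
      case near: False
      have "H x = (H x powr v) powr (1 / v)" using H pos by (simp add: powr_powr)
      also have "\<dots> \<le> (F y powr p) powr (1 / v)" using True pos by (intro powr_mono2) auto
      finally have h1: "H x \<le> F y powr (p * (1 / v))" by (simp add: powr_powr)
      have "t powr (D * (1 / v)) \<le> (H x powr - (v / D)) powr (D * (1 / v))"
        using near pos by (intro powr_mono2) auto
      also have "\<dots> = H x powr - 1" unfolding powr_powr using pos by simp
      also have "\<dots> = 1 / H x" using H by (simp add: powr_minus_divide)
      finally have h2: "H x \<le> t powr - (D * (1 / v))"
        using H pos by (simp add: powr_minus field_simps)
      have "w x y * F y * H x \<le> w x y * F y * ?m y"
        using h1 h2 nonneg by (intro mult_left_mono) auto
      then have "ennreal (w x y * F y * H x) \<le> ennreal ((F y * ?m y) * w x y)"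
        by (intro ennreal_leI) (simp add: mult_ac)
      also have "\<dots> = ennreal (F y * ?m y) * ennreal (w x y)"
        using nonneg by (intro ennreal_mult) auto
      finally show ?thesis using True by (auto intro: add_increasing2)
    qed
  qed
  have "(\<integral>\<^sup>+y. \<integral>\<^sup>+x. ennreal (w x y * F y * H x) * (if H x powr v \<le> F y powr p then 1 else 0) \<partial>M \<partial>M)
    \<le> (\<integral>\<^sup>+y. \<integral>\<^sup>+x. ennreal (F y * ?m y) * ennreal (w x y) + ?far x y \<partial>M \<partial>M)"
    by (intro nn_integral_mono pt)
  also have "\<dots> = (\<integral>\<^sup>+y. ennreal (F y * ?m y) * (\<integral>\<^sup>+x. ennreal (w x y) \<partial>M)
      + (\<integral>\<^sup>+x. ?far x y \<partial>M) \<partial>M)"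
  proof (intro nn_integral_cong)
    fix y assume [measurable]: "y \<in> space M"
    have "(\<integral>\<^sup>+x. ennreal (F y * ?m y) * ennreal (w x y) \<partial>M) = ennreal (F y * ?m y) * (\<integral>\<^sup>+x. ennreal (w x y) \<partial>M)"
      by (intro nn_integral_cmult) measurable
    then show "(\<integral>\<^sup>+x. ennreal (F y * ?m y) * ennreal (w x y) + ?far x y \<partial>M)
      = ennreal (F y * ?m y) * (\<integral>\<^sup>+x. ennreal (w x y) \<partial>M)
      + (\<integral>\<^sup>+x. ?far x y \<partial>M)"
      by (subst nn_integral_add) measurable
  qed
  also have "\<dots> = (\<integral>\<^sup>+y. ennreal (F y * ?m y) * (\<integral>\<^sup>+x. ennreal (w x y) \<partial>M) \<partial>M) + hls_far D \<Lambda> p v F H t"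
    unfolding hls_far_def by (intro nn_integral_add) measurable
  also have "(\<integral>\<^sup>+y. ennreal (F y * ?m y) * (\<integral>\<^sup>+x. ennreal (w x y) \<partial>M) \<partial>M) \<le> hls_near D p v F t"
    unfolding hls_near_def
  proof (rule nn_integral_mono)
    fix y
    have "ennreal (F y * ?m y) * (\<integral>\<^sup>+x. ennreal (w x y) \<partial>M) \<le> ennreal (F y * ?m y) * 2"
      by (intro mult_left_mono col) auto
    also have "\<dots> = ennreal (F y * ?m y * 2)"
      using nonneg by (subst ennreal_mult) auto
    finally show "ennreal (F y * ?m y) * (\<integral>\<^sup>+x. ennreal (w x y) \<partial>M) \<le> ennreal (2 * F y * ?m y)"
      by (simp add: mult_ac)
  qed
  finally show ?thesis by (simp add: add_right_mono)
qed

text \<open>After Fubini the inner integral is the estimate \<open>nn_integral_powr_min_le\<close>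
  with s = F y and th = 1/v. The relation \<open>rel\<close> turns its exponent into p - 1, and the
  remaining factor F y completes F^p.\<close>

lemma hls_near_integral:
  assumes [measurable]: "F \<in> borel_measurable M" and F: "\<And>y. 0 \<le> F y"
    and int: "(\<integral>\<^sup>+y. ennreal (F y powr p) \<partial>M) \<le> 1"
    and a: "0 < a" "a < D * (1 / v)" "0 < D"
    and rel: "p * (1 / v) - p * a / D = p - 1"
  shows "(\<integral>\<^sup>+t. tweight a t * hls_near D p v F t \<partial>lborel)
    \<le> ennreal (2 * (1 / a + 1 / (D * (1 / v) - a)))"
proof -
  let ?c = "1 / a + 1 / (D * (1 / v) - a)"
  let ?m = "\<lambda>y t. min (F y powr (p * (1 / v))) (t powr - (D * (1 / v)))"
  interpret L: pair_sigma_finite M lborel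
    by (intro pair_sigma_finite.intro sigma_finite_measure_axioms sigma_finite_lborel)
  have "(\<integral>\<^sup>+t. tweight a t * hls_near D p v F t \<partial>lborel)
    = (\<integral>\<^sup>+t. \<integral>\<^sup>+y. tweight a t * ennreal (2 * F y * ?m y t) \<partial>M \<partial>lborel)"
    unfolding hls_near_def by (simp add: nn_integral_cmult)
  also have "\<dots> = (\<integral>\<^sup>+y. \<integral>\<^sup>+t. tweight a t * ennreal (2 * F y * ?m y t) \<partial>lborel \<partial>M)"
    by (rule L.Fubini') measurable
  also have "\<dots> \<le> (\<integral>\<^sup>+y. ennreal (2 * ?c) * ennreal (F y powr p) \<partial>M)"
  proof (rule nn_integral_mono)
    fix y
    show "(\<integral>\<^sup>+t. tweight a t * ennreal (2 * F y * ?m y t) \<partial>lborel)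
      \<le> ennreal (2 * ?c) * ennreal (F y powr p)"
    proof (cases "F y = 0")
      case False
      then have Fy: "0 < F y" using F[of y] by simp
      have "(\<integral>\<^sup>+t. tweight a t * ennreal (2 * F y * ?m y t) \<partial>lborel)
        = (\<integral>\<^sup>+t. ennreal (2 * F y) * (ennreal (t powr (a - 1) * ?m y t) * indicator {0<..} t) \<partial>lborel)"
        using Fy by (intro nn_integral_cong) (auto simp: ennreal_mult[symmetric] mult_ac split: split_indicator)
      also have "\<dots> = ennreal (2 * F y) * (\<integral>\<^sup>+t. ennreal (t powr (a - 1) * ?m y t) * indicator {0<..} t \<partial>lborel)"
        by (rule nn_integral_cmult) measurable
      also have "\<dots> \<le> ennreal (2 * F y) * ennreal (?c * F y powr (p * (1 / v) - p * a / D))"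
        by (intro mult_left_mono nn_integral_powr_min_le Fy a) auto
      also have "\<dots> = ennreal (2 * ?c * (F y * F y powr (p - 1)))"
        unfolding rel using Fy by (subst ennreal_mult'[symmetric]) (simp, simp only: mult_ac)
      also have "F y * F y powr (p - 1) = F y powr p"
        using Fy by (simp add: powr_mult_base)
      finally show ?thesis using a by (simp add: ennreal_mult'')
    qed simp
  qed
  also have "\<dots> = ennreal (2 * ?c) * (\<integral>\<^sup>+y. ennreal (F y powr p) \<partial>M)"
    by (rule nn_integral_cmult) measurable
  also have "\<dots> \<le> ennreal (2 * ?c) * 1"
    by (intro mult_left_mono int) auto
  finally show ?thesis by simp
qed

text \<open>Integrating t^(a-1-D) over t > H^(-v/D) leaves a multiple of F H^(1 - va/D) H^v. Since H
  <= F^(p/v) and 1 - va/D is nonnegative, \<open>rel\<close> gives H^(1 - va/D) <= F^(p-1). The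
  integrand is thus dominated by F^p H^v, whose two factors integrate separately.\<close>

lemma hls_far_integral:
  assumes [measurable]: "F \<in> borel_measurable M" "H \<in> borel_measurable M"
    and F: "\<And>y. 0 \<le> F y" and H: "\<And>x. 0 \<le> H x"
    and intF: "(\<integral>\<^sup>+y. ennreal (F y powr p) \<partial>M) \<le> 1" and intH: "(\<integral>\<^sup>+y. ennreal (H y powr v) \<partial>M) \<le> 1"
    and a: "0 < a" "a < D * (1 / v)" "a < D" "0 < D" and \<Lambda>: "0 \<le> \<Lambda>" and pv: "0 < p" "0 < v"
    and rel: "p * (1 / v) - p * a / D = p - 1"
  shows "(\<integral>\<^sup>+t. tweight a t * hls_far D \<Lambda> p v F H t \<partial>lborel)
    \<le> ennreal (\<Lambda> / (D - a))"
proof -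
  interpret L: pair_sigma_finite M lborel
    by (intro pair_sigma_finite.intro sigma_finite_measure_axioms sigma_finite_lborel)
  let ?g = "\<lambda>x y t. tweight a t * (ennreal (\<Lambda> * t powr - D * F y * H x)
      * (if H x powr v \<le> F y powr p \<and> H x powr - (v / D) < t then 1 else 0))"
  have "(\<integral>\<^sup>+t. tweight a t * hls_far D \<Lambda> p v F H t \<partial>lborel)
    = (\<integral>\<^sup>+t. \<integral>\<^sup>+y. \<integral>\<^sup>+x. ?g x y t \<partial>M \<partial>M \<partial>lborel)"
    unfolding hls_far_def by (simp add: nn_integral_cmult)
  also have "\<dots> = (\<integral>\<^sup>+y. \<integral>\<^sup>+t. \<integral>\<^sup>+x. ?g x y t \<partial>M \<partial>lborel \<partial>M)"
    by (rule L.Fubini') measurable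
  also have "\<dots> = (\<integral>\<^sup>+y. \<integral>\<^sup>+x. \<integral>\<^sup>+t. ?g x y t \<partial>lborel \<partial>M \<partial>M)"
    by (intro nn_integral_cong L.Fubini') measurable
  also have "\<dots> \<le> (\<integral>\<^sup>+y. \<integral>\<^sup>+x. ennreal (\<Lambda> / (D - a)) * ennreal (F y powr p) * ennreal (H x powr v) \<partial>M \<partial>M)"
  proof (intro nn_integral_mono)
    fix x y
    show "(\<integral>\<^sup>+t. ?g x y t \<partial>lborel) \<le> ennreal (\<Lambda> / (D - a)) * ennreal (F y powr p) * ennreal (H x powr v)"
    proof (cases "H x powr v \<le> F y powr p \<and> F y \<noteq> 0 \<and> H x \<noteq> 0")
      case False
      then have "?g x y t = 0" for t
        by (cases "H x = 0"; cases "F y = 0") simp_all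
      then show ?thesis by (simp only: nn_integral_const mult_zero_left zero_le)
    next
      case True
      then have Hx: "0 < H x" and Fy: "0 < F y" and le: "H x powr v \<le> F y powr p"
        using F[of y] H[of x] by auto
      let ?T = "H x powr - (v / D)"
      have "(\<integral>\<^sup>+t. ?g x y t \<partial>lborel)
         \<le> (\<integral>\<^sup>+t. ennreal (\<Lambda> * F y * H x) * (ennreal (t powr (- (D - a) - 1)) * indicator {?T..} t) \<partial>lborel)"
      proof (rule nn_integral_mono)
        fix t :: real
        show "?g x y t \<le> ennreal (\<Lambda> * F y * H x) * (ennreal (t powr (- (D - a) - 1)) * indicator {?T..} t)"
        proof (cases "?T < t")
          case True
          moreover have "0 < ?T" using Hx by simp
          ultimately have t: "0 < t" by linarith
          have eq: "t powr (a - 1) * (\<Lambda> * t powr - D * F y * H x) = \<Lambda> * F y * H x * t powr (- (D - a) - 1)"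
            using powr_add[of t "a - 1" "- D"] by (simp add: algebra_simps)
          have "?g x y t = ennreal (t powr (a - 1) * (\<Lambda> * t powr - D * F y * H x))"
            using True t le by (simp add: ennreal_mult')
          also have "\<dots> = ennreal (\<Lambda> * F y * H x) * (ennreal (t powr (- (D - a) - 1)) * indicator {?T..} t)"
            unfolding eq using True \<Lambda> Fy Hx by (simp add: ennreal_mult')
          finally show ?thesis by simp
        qed simp
      qed
      also have "\<dots> = ennreal (\<Lambda> * F y * H x) * ennreal (?T powr - (D - a) / (D - a))"
        using nn_integral_powr_near_inf[of "D - a" ?T] a Hx by (simp add: nn_integral_cmult)
      also have "\<dots> = ennreal (\<Lambda> / (D - a) * (F y * H x * ?T powr - (D - a)))"
        using \<Lambda> Fy Hx a by (simp add: ennreal_mult'[symmetric])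
      also have "\<dots> \<le> ennreal (\<Lambda> / (D - a) * (F y powr p * H x powr v))"
      proof (intro ennreal_leI mult_left_mono)
        have va: "0 \<le> 1 - v * a / D" using a pv by (simp add: field_simps)
        have "H x powr (1 - v * a / D) = (H x powr v) powr ((1 / v) * (1 - v * a / D))"
          using pv by (simp add: powr_powr)
        also have "\<dots> \<le> (F y powr p) powr ((1 / v) * (1 - v * a / D))"
          using le va pv by (intro powr_mono2) auto
        also have "\<dots> = F y powr (p * (1 / v) - p * a / D)"
          using pv by (simp add: powr_powr right_diff_distrib)
        finally have key: "H x powr (1 - v * a / D) \<le> F y powr (p - 1)" unfolding rel .
        have "F y * H x * ?T powr - (D - a) = F y * (H x powr 1 * H x powr (v / D * (D - a)))"
        proof -
          have "- (v / D) * - (D - a) = v / D * (D - a)" by (simp only: minus_mult_minus)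
          then have "?T powr - (D - a) = H x powr (v / D * (D - a))"
            unfolding powr_powr by (rule arg_cong)
          then show ?thesis using Hx by simp
        qed
        also have "H x powr 1 * H x powr (v / D * (D - a)) = H x powr (1 - v * a / D) * H x powr v"
          unfolding powr_add[symmetric] using a by (simp add: field_simps)
        also have "F y * (H x powr (1 - v * a / D) * H x powr v) \<le> F y * (F y powr (p - 1) * H x powr v)"
          using key Fy by (intro mult_left_mono mult_right_mono) auto
        also have "\<dots> = F y powr p * H x powr v"
          using Fy by (simp add: powr_mult_base mult.assoc[symmetric])
        finally show "F y * H x * ?T powr - (D - a) \<le> F y powr p * H x powr v" .
      qed (use \<Lambda> a in auto)
      also have "\<dots> = ennreal (\<Lambda> / (D - a)) * ennreal (F y powr p) * ennreal (H x powr v)"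
        using \<Lambda> a by (subst ennreal_mult, simp, simp, subst ennreal_mult) (simp_all only: mult.assoc powr_ge_zero)
      finally show ?thesis .
    qed
  qed
  also have "\<dots> = ennreal (\<Lambda> / (D - a)) * (\<integral>\<^sup>+y. ennreal (F y powr p) \<partial>M) * (\<integral>\<^sup>+x. ennreal (H x powr v) \<partial>M)"
    by (simp add: nn_integral_cmult nn_integral_multc)
  also have "\<dots> \<le> ennreal (\<Lambda> / (D - a)) * 1 * 1"
    by (intro mult_mono intF intH) auto
  finally show ?thesis by simp
qed

text \<open>The regions H^v <= F^p and F^p <= H^v are exchanged by swapping F, p, y with H, v, x.
  The relation \<open>rel\<close> is symmetric under this swap, while the column bound on the kernel
  becomes the row bound. The function \<open>c\<close> is any quantity dominated by the bilinear
  form at time t.\<close>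

lemma hls_bilinear:
  fixes F H :: "'a \<Rightarrow> real" and w :: "real \<Rightarrow> 'a \<Rightarrow> 'a \<Rightarrow> real" and c :: "real \<Rightarrow> real"
  assumes [measurable]: "F \<in> borel_measurable M" "H \<in> borel_measurable M"
      "\<And>t. (\<lambda>(x, y). w t x y) \<in> borel_measurable (M \<Otimes>\<^sub>M M)"
    and nonneg: "\<And>y. 0 \<le> F y" "\<And>x. 0 \<le> H x" "\<And>t x y. 0 \<le> w t x y"
    and col: "\<And>t y. 0 < t \<Longrightarrow> (\<integral>\<^sup>+x. ennreal (w t x y) \<partial>M) \<le> 2"
    and row: "\<And>t x. 0 < t \<Longrightarrow> (\<integral>\<^sup>+y. ennreal (w t x y) \<partial>M) \<le> 2"
    and sup: "\<And>t x y. 0 < t \<Longrightarrow> w t x y \<le> \<Lambda> * t powr - D"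
    and intF: "(\<integral>\<^sup>+y. ennreal (F y powr p) \<partial>M) \<le> 1" and intH: "(\<integral>\<^sup>+y. ennreal (H y powr v) \<partial>M) \<le> 1"
    and c: "\<And>t. 0 < t \<Longrightarrow> ennreal (c t) \<le> (\<integral>\<^sup>+y. \<integral>\<^sup>+x. ennreal (w t x y * F y * H x) \<partial>M \<partial>M)"
    and \<Lambda>: "0 \<le> \<Lambda>" and a: "0 < a" "a < D" and pv: "1 < p" "1 < v" and rel: "1 / p + 1 / v = 1 + a / D"
  shows "(\<integral>\<^sup>+t. tweight a t * ennreal (c t) \<partial>lborel)
    \<le> ennreal (2 * (1 / a + 1 / (D * (1 / v) - a)) + \<Lambda> / (D - a)
        + (2 * (1 / a + 1 / (D * (1 / p) - a)) + \<Lambda> / (D - a)))"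
proof -
  let ?wFH = "\<lambda>t x y. ennreal (w t x y * F y * H x)"
  interpret MM: pair_sigma_finite M M
    by (intro pair_sigma_finite.intro sigma_finite_measure_axioms)
  have D: "0 < D" using a by simp
  have relp: "p * (1 / v) - p * a / D = p - 1"
  proof -
    have "1 / v - a / D = 1 - 1 / p" using rel by linarith
    then have "p * (1 / v - a / D) = p * (1 - 1 / p)" by (rule arg_cong)
    then show ?thesis using pv by (simp add: right_diff_distrib)
  qed
  have relv: "v * (1 / p) - v * a / D = v - 1"
  proof -
    have "1 / p - a / D = 1 - 1 / v" using rel by linarith
    then have "v * (1 / p - a / D) = v * (1 - 1 / v)" by (rule arg_cong)
    then show ?thesis using pv by (simp add: right_diff_distrib)
  qed
  \<comment> \<open>Here p > 1 enters: a/D = 1/v - (1 - 1/p), which is strictly below 1/v.\<close>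
  have av: "a < D * (1 / v)"
  proof -
    have "1 / p < 1" using pv by simp
    then have "a / D < 1 / v" using rel by linarith
    then show ?thesis using D by (simp add: field_simps)
  qed
  have ap: "a < D * (1 / p)"
  proof -
    have "1 / v < 1" using pv by simp
    then have "a / D < 1 / p" using rel by linarith
    then show ?thesis using D by (simp add: field_simps)
  qed
  have pos: "0 < p" "0 < v" using pv by auto
  let ?\<Psi> = "\<lambda>t. hls_near D p v F t + hls_far D \<Lambda> p v F H t + (hls_near D v p H t + hls_far D \<Lambda> v p H F t)"
  have le: "ennreal (c t) \<le> ?\<Psi> t" if t: "0 < t" for t
  proof -
    have [measurable]: "case_prod (w t) \<in> borel_measurable (M \<Otimes>\<^sub>M M)" by (rule assms(3))
    let ?A = "\<lambda>x y. ?wFH t x y * (if H x powr v \<le> F y powr p then 1 else 0)"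
    let ?B = "\<lambda>x y. ?wFH t x y * (if F y powr p \<le> H x powr v then 1 else 0)"
    have "ennreal (c t) \<le> (\<integral>\<^sup>+y. \<integral>\<^sup>+x. ?wFH t x y \<partial>M \<partial>M)" by (rule c[OF t])
    also have "\<dots> \<le> (\<integral>\<^sup>+y. \<integral>\<^sup>+x. ?A x y + ?B x y \<partial>M \<partial>M)"
      by (intro nn_integral_mono) (auto intro: add_increasing add_increasing2)
    also have "\<dots> = (\<integral>\<^sup>+y. \<integral>\<^sup>+x. ?A x y \<partial>M \<partial>M) + (\<integral>\<^sup>+y. \<integral>\<^sup>+x. ?B x y \<partial>M \<partial>M)"
    proof -
      have "(\<integral>\<^sup>+y. \<integral>\<^sup>+x. ?A x y + ?B x y \<partial>M \<partial>M) = (\<integral>\<^sup>+y. (\<integral>\<^sup>+x. ?A x y \<partial>M) + (\<integral>\<^sup>+x. ?B x y \<partial>M) \<partial>M)"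
        by (intro nn_integral_cong nn_integral_add) measurable
      also have "\<dots> = (\<integral>\<^sup>+y. \<integral>\<^sup>+x. ?A x y \<partial>M \<partial>M) + (\<integral>\<^sup>+y. \<integral>\<^sup>+x. ?B x y \<partial>M \<partial>M)"
        by (intro nn_integral_add) measurable
      finally show ?thesis .
    qed
    also have "(\<integral>\<^sup>+y. \<integral>\<^sup>+x. ?B x y \<partial>M \<partial>M) = (\<integral>\<^sup>+x. \<integral>\<^sup>+y. ?B x y \<partial>M \<partial>M)"
      by (rule MM.Fubini') measurable
    also have "(\<integral>\<^sup>+y. \<integral>\<^sup>+x. ?A x y \<partial>M \<partial>M) \<le> hls_near D p v F t + hls_far D \<Lambda> p v F H t"
      by (rule hls_half_pointwise) (use nonneg col sup t D pos in auto)
    also have "(\<integral>\<^sup>+x. \<integral>\<^sup>+y. ?B x y \<partial>M \<partial>M) \<le> hls_near D v p H t + hls_far D \<Lambda> v p H F t"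
    proof -
      have "?B x y = ennreal (w t x y * H x * F y) * (if F y powr p \<le> H x powr v then 1 else 0)" for x y
        by (simp only: mult_ac)
      then show ?thesis
        by (simp only:) (rule hls_half_pointwise[where w = "\<lambda>y x. w t x y"];
          use nonneg row sup t D pos in \<open>auto intro: measurable_pair_swap'\<close>)
    qed
    finally show ?thesis by (simp add: add_mono)
  qed
  have "(\<integral>\<^sup>+t. tweight a t * ennreal (c t) \<partial>lborel)
     \<le> (\<integral>\<^sup>+t. tweight a t * ?\<Psi> t \<partial>lborel)"
    using le by (intro nn_integral_mono) (auto intro!: mult_left_mono split: split_indicator)
  also have "\<dots> = (\<integral>\<^sup>+t. tweight a t * hls_near D p v F t \<partial>lborel)
      + (\<integral>\<^sup>+t. tweight a t * hls_far D \<Lambda> p v F H t \<partial>lborel)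
      + ((\<integral>\<^sup>+t. tweight a t * hls_near D v p H t \<partial>lborel)
      + (\<integral>\<^sup>+t. tweight a t * hls_far D \<Lambda> v p H F t \<partial>lborel))"
    by (simp add: distrib_left nn_integral_add)
  also have "\<dots> \<le> ennreal (2 * (1 / a + 1 / (D * (1 / v) - a))) + ennreal (\<Lambda> / (D - a))
        + (ennreal (2 * (1 / a + 1 / (D * (1 / p) - a))) + ennreal (\<Lambda> / (D - a)))"
    by (intro add_mono hls_near_integral hls_far_integral nonneg intF intH a D av ap \<Lambda> relp relv pos assms(1,2))
  also have "\<dots> = ennreal (2 * (1 / a + 1 / (D * (1 / v) - a)) + \<Lambda> / (D - a)
        + (2 * (1 / a + 1 / (D * (1 / p) - a)) + \<Lambda> / (D - a)))"
  proof -
    have "0 \<le> 2 * (1 / a + 1 / (D * (1 / v) - a))" "0 \<le> 2 * (1 / a + 1 / (D * (1 / p) - a))" "0 \<le> \<Lambda> / (D - a)"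
      using a av ap \<Lambda> by (auto intro!: add_nonneg_nonneg)
    moreover have "ennreal A + ennreal B + (ennreal C + ennreal E) = ennreal (A + B + (C + E))"
      if "0 \<le> A" "0 \<le> B" "0 \<le> C" "0 \<le> E" for A B C E using that by simp
    ultimately show ?thesis by blast
  qed
  finally show ?thesis .
qed

end

section \<open>Gamma integrals for the multiplier n^(-a)\<close>

lemma nn_integral_Gamma_scale:
  assumes a: "0 < a" and n: "0 < n"
  shows "(\<integral>\<^sup>+t. ennreal (t powr (a - 1) * exp (- (n * t))) * indicator {0<..} t \<partial>lborel)
    = ennreal (Gamma a * n powr - a)"
proof -
  let ?f = "\<lambda>t. ennreal (t powr (a - 1) * exp (- t)) * indicator {0<..} t"
  let ?g = "\<lambda>t. ennreal (t powr (a - 1) * exp (- (n * t))) * indicator {0<..} t"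
  have "ennreal (Gamma a) = (\<integral>\<^sup>+t. ?f t \<partial>lborel)"
    unfolding Gamma_conv_nn_integral_real[OF a]
    by (intro nn_integral_cong)
      (auto simp: exp_minus divide_inverse split: split_indicator)
  also have "\<dots> = ennreal n * (\<integral>\<^sup>+t. ?f (n * t) \<partial>lborel)"
    using nn_integral_real_affine[of ?f n 0] n by simp
  also have "(\<integral>\<^sup>+t. ?f (n * t) \<partial>lborel) = (\<integral>\<^sup>+t. ennreal (n powr (a - 1)) * ?g t \<partial>lborel)"
    using n by (intro nn_integral_cong)
      (auto simp: powr_mult ennreal_mult'[symmetric] mult.assoc zero_less_mult_iff split: split_indicator)
  also have "\<dots> = ennreal (n powr (a - 1)) * (\<integral>\<^sup>+t. ?g t \<partial>lborel)"
    by (rule nn_integral_cmult) measurable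
  finally have "ennreal (Gamma a) = ennreal (n * n powr (a - 1)) * (\<integral>\<^sup>+t. ?g t \<partial>lborel)"
    using n by (simp add: ennreal_mult mult.assoc)
  also have "n * n powr (a - 1) = n powr a" using n by (simp add: powr_mult_base)
  finally have "ennreal (n powr - a) * ennreal (Gamma a)
      = ennreal (n powr - a) * (ennreal (n powr a) * (\<integral>\<^sup>+t. ?g t \<partial>lborel))" by simp
  also have "\<dots> = ennreal (n powr - a * n powr a) * (\<integral>\<^sup>+t. ?g t \<partial>lborel)"
    by (simp add: ennreal_mult mult.assoc)
  also have "n powr - a * n powr a = 1" using n by (simp add: powr_add[symmetric])
  finally show ?thesis using Gamma_real_pos[OF a] by (simp add: ennreal_mult mult.commute)
qed

text \<open>Writing n^(-a) as a Gamma integral turns the damped series into an average over t of the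
  series without multiplier at radius rho e^(-t). Summability at radius rho dominates everything and
  allows the sum and the integral to be exchanged.\<close>

lemma norm_Gamma_sum_le:
  fixes c :: "nat \<Rightarrow> complex"
  assumes a: "0 < a" and \<rho>: "0 \<le> \<rho>" and sm: "summable (\<lambda>n. \<rho> ^ n * norm (c n))"
  shows "ennreal (Gamma a * norm (\<Sum>n. of_real (\<rho> ^ Suc n * real (Suc n) powr - a) * c (Suc n)))
    \<le> (\<integral>\<^sup>+t. tweight a t
          * ennreal (norm (\<Sum>n. of_real ((\<rho> * exp (- t)) ^ Suc n) * c (Suc n))) \<partial>lborel)"
proof -
  let ?T = "\<lambda>t. \<Sum>n. of_real ((\<rho> * exp (- t)) ^ Suc n) * c (Suc n)"
  let ?G = "\<Sum>n. of_real (\<rho> ^ Suc n * real (Suc n) powr - a) * c (Suc n)"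
  define e where "e n t = t powr (a - 1) * exp (- (real (Suc n) * t)) * indicator {0<..} t" for n and t :: real
  have e0: "0 \<le> e n t" for n t by (simp add: e_def)
  have [measurable]: "e n \<in> borel_measurable borel" for n unfolding e_def by measurable
  have enn: "(\<integral>\<^sup>+t. ennreal (e n t) \<partial>lborel) = ennreal (Gamma a * real (Suc n) powr - a)" for n
  proof -
    have "ennreal (e n t) = ennreal (t powr (a - 1) * exp (- (real (Suc n) * t))) * indicator {0<..} t" for t
      by (simp add: e_def split: split_indicator)
    then show ?thesis using nn_integral_Gamma_scale[OF a, of "real (Suc n)"] by simp
  qed
  have G0: "0 \<le> Gamma a" using Gamma_real_pos[OF a] by simp
  have ei: "integrable lborel (e n)" "(\<integral>t. e n t \<partial>lborel) = Gamma a * real (Suc n) powr - a" for n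
    using nn_integral_eq_integrable[of "e n" lborel "Gamma a * real (Suc n) powr - a"] enn[of n] e0 G0 by auto
  define d where "d n = of_real (\<rho> ^ Suc n) * c (Suc n)" for n
  have dn: "norm (d n) = \<rho> ^ Suc n * norm (c (Suc n))" for n using \<rho> by (simp add: d_def norm_mult norm_power)
  have sd: "summable (\<lambda>n. norm (d n))"
    unfolding dn using sm by (rule summable_Suc_iff[THEN iffD2])
  have exp_le: "exp (- (real (Suc n) * t)) \<le> 1" if "0 < t" for n and t :: real using that by simp
  have s1: "summable (\<lambda>n. norm (e n t *\<^sub>R d n))" for t
  proof (rule summable_comparison_test'[of "\<lambda>n. t powr (a - 1) * norm (d n)" 0])
    show "summable (\<lambda>n. t powr (a - 1) * norm (d n))" by (intro summable_mult sd)
    fix n :: nat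
    have "e n t \<le> t powr (a - 1) * 1"
      unfolding e_def using exp_le[of t n]
      by (cases "0 < t") (auto intro!: mult_left_mono)
    then have "e n t * norm (d n) \<le> t powr (a - 1) * norm (d n)" by (intro mult_right_mono) auto
    then show "norm (norm (e n t *\<^sub>R d n)) \<le> t powr (a - 1) * norm (d n)" using e0[of n t] by simp
  qed
  have s2: "summable (\<lambda>n. \<integral>t. norm (e n t *\<^sub>R d n) \<partial>lborel)"
  proof (rule summable_comparison_test'[of "\<lambda>n. Gamma a * norm (d n)" 0])
    show "summable (\<lambda>n. Gamma a * norm (d n))" by (intro summable_mult sd)
    fix n :: nat
    have "real (Suc n) powr - a \<le> 1"
      using a powr_mono[of "- a" 0 "real (Suc n)"] by simp
    then have "Gamma a * real (Suc n) powr - a * norm (d n) \<le> Gamma a * 1 * norm (d n)"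
      using G0 by (intro mult_right_mono mult_left_mono) auto
    moreover have "norm (e n t *\<^sub>R d n) = norm (d n) * e n t" for t
      using e0[of n t] by simp
    then have "(\<integral>t. norm (e n t *\<^sub>R d n) \<partial>lborel) = norm (d n) * (Gamma a * real (Suc n) powr - a)"
      by (simp only: integral_mult_right_zero ei)
    then have "norm (\<integral>t. norm (e n t *\<^sub>R d n) \<partial>lborel) = Gamma a * real (Suc n) powr - a * norm (d n)"
      using G0 by (simp only:) simp
    ultimately show "norm (\<integral>t. norm (e n t *\<^sub>R d n) \<partial>lborel) \<le> Gamma a * norm (d n)"
      by (simp only: mult_1_right)
  qed
  have i: "integrable lborel (\<lambda>t. e n t *\<^sub>R d n)" for n using ei[of n] by simp
  have "(\<integral>t. (\<Sum>n. e n t *\<^sub>R d n) \<partial>lborel) = (\<Sum>n. \<integral>t. e n t *\<^sub>R d n \<partial>lborel)"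
    using s1 by (intro integral_suminf i s2) auto
  also have "\<dots> = (\<Sum>n. Gamma a *\<^sub>R (of_real (\<rho> ^ Suc n * real (Suc n) powr - a) * c (Suc n)))"
    using ei by (simp add: d_def scaleR_conv_of_real mult_ac)
  also have "\<dots> = Gamma a *\<^sub>R ?G"
  proof (rule suminf_scaleR_right[symmetric])
    show "summable (\<lambda>n. of_real (\<rho> ^ Suc n * real (Suc n) powr - a) * c (Suc n))"
    proof (rule summable_comparison_test'[of "\<lambda>n. norm (d n)" 0])
      fix n :: nat
      have le1: "real (Suc n) powr - a \<le> 1"
        using a powr_mono[of "- a" 0 "real (Suc n)"] by simp
      have "norm (of_real (\<rho> ^ Suc n * real (Suc n) powr - a) * c (Suc n)) = norm (d n) * real (Suc n) powr - a"
        unfolding dn using \<rho> by (simp add: norm_mult norm_power mult_ac)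
      also have "\<dots> \<le> norm (d n)" using le1 by (intro mult_left_le) auto
      finally show "norm (of_real (\<rho> ^ Suc n * real (Suc n) powr - a) * c (Suc n)) \<le> norm (d n)" .
    qed (rule sd)
  qed
  finally have eq: "(\<integral>t. (\<Sum>n. e n t *\<^sub>R d n) \<partial>lborel)
     = Gamma a *\<^sub>R ?G" .
  have pt: "(\<Sum>n. e n t *\<^sub>R d n) = (t powr (a - 1) * indicator {0<..} t) *\<^sub>R
      ?T t" for t
  proof (cases "0 < t")
    case True
    have "(exp (- t)) ^ Suc n = exp (- (real (Suc n) * t))" for n
      using exp_of_nat_mult[of "Suc n" "- t"] by (simp only: mult_minus_right)
    then have t: "e n t *\<^sub>R d n = t powr (a - 1) *\<^sub>R (of_real ((\<rho> * exp (- t)) ^ Suc n) * c (Suc n))" for n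
      using True by (simp only: e_def d_def power_mult_distrib scaleR_conv_of_real of_real_mult) (simp add: mult_ac)
    have "summable (\<lambda>n. of_real ((\<rho> * exp (- t)) ^ Suc n) * c (Suc n))"
    proof (rule summable_comparison_test'[OF sd, of 0])
      fix n :: nat
      have "(\<rho> * exp (- t)) ^ Suc n \<le> \<rho> ^ Suc n"
        using True \<rho> by (intro power_mono) (auto simp: mult_left_le)
      then show "norm (of_real ((\<rho> * exp (- t)) ^ Suc n) * c (Suc n)) \<le> norm (d n)"
        unfolding dn norm_mult norm_of_real using \<rho>
        by (intro mult_right_mono) (simp_all only: abs_of_nonneg zero_le_power mult_nonneg_nonneg exp_ge_zero norm_ge_zero)
    qed
    then show ?thesis unfolding t using True by (subst suminf_scaleR_right[symmetric]) auto
  qed (simp add: e_def)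
  have "ennreal (Gamma a * norm ?G)
      = ennreal (norm (\<integral>t. (\<Sum>n. e n t *\<^sub>R d n) \<partial>lborel))"
    unfolding eq using G0 by simp
  also have "\<dots> \<le> (\<integral>\<^sup>+t. ennreal (norm (\<Sum>n. e n t *\<^sub>R d n)) \<partial>lborel)"
    using s1 by (intro integral_norm_bound_ennreal integrable_suminf i s2) auto
  also have "\<dots> = (\<integral>\<^sup>+t. tweight a t
          * ennreal (norm (?T t)) \<partial>lborel)"
    unfolding pt by (intro nn_integral_cong) (auto simp: ennreal_mult split: split_indicator)
  finally show ?thesis .
qed

text \<open>If l were positive, f' would be positive just to the right of its zero x0, and the mean
  value theorem would produce larger values of f there.\<close>

lemma second_deriv_at_max:
  fixes f :: "real \<Rightarrow> real"
  assumes f: "\<And>x. (f has_real_derivative f' x) (at x)"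
    and f': "(f' has_real_derivative l) (at x0)"
    and d: "0 < d" and le: "\<And>y. \<bar>x0 - y\<bar> < d \<Longrightarrow> f y \<le> f x0"
  shows "f' x0 = 0" "l \<le> 0"
proof -
  show z: "f' x0 = 0"
    by (rule DERIV_local_max[OF f d]) (use le in auto)
  show "l \<le> 0"
  proof (rule ccontr)
    assume "\<not> l \<le> 0"
    then obtain e where e: "0 < e" "\<And>h. 0 < h \<Longrightarrow> h < e \<Longrightarrow> f' x0 < f' (x0 + h)"
      using DERIV_pos_inc_right[OF f'] by fastforce
    define h where "h = min d e / 2"
    have h: "0 < h" "h < d" "h < e" using d e by (auto simp: h_def)
    obtain y where y: "x0 < y" "y < x0 + h" "f (x0 + h) - f x0 = (x0 + h - x0) * f' y"
      using MVT2[of x0 "x0 + h" f f'] f h by auto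
    have "0 < f' y" using e(2)[of "y - x0"] y h z by simp
    with h have "0 < h * f' y" by simp
    then have "f x0 < f (x0 + h)" using y(3) by simp
    moreover have "f (x0 + h) \<le> f x0" using h by (intro le) auto
    ultimately show False by simp
  qed
qed

section \<open>The harmonics of degree m\<close>

locale cherednik =
  fixes k :: real
  assumes k_pos: "0 < k"
begin

text \<open>The Verblunsky coefficients of the weight \<open>\<bar>1 - w\<bar>\<^bsup>2k\<^esup>\<close> on the unit circle. The functions
  \<open>M\<^sub>m = R\<^sub>m + \<i> S\<^sub>m\<close> with \<open>S\<^sub>m = sin x Q\<^sub>m\<close> below follow the Szego recursion
  \<open>M\<^bsub>m+1\<^esub> = e\<^bsup>-ix\<^esup> M\<^sub>m + sz\<^sub>m e\<^bsup>ix\<^esup> cnj M\<^sub>m\<close>, so that \<open>M\<^sub>m = E\<^bsub>-m\<^esub>\<close> and \<open>e\<^bsup>ix\<^esup> cnj M\<^sub>m = E\<^bsub>m+1\<^esub>\<close>.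
  They are taken as functions of \<open>z = e\<^bsup>ix\<^esup>\<close>, which makes them continuous on the circle.\<close>

definition sz :: "nat \<Rightarrow> real" where
  "sz m = k / (k + real m + 1)"

lemma sz_bounds: "0 < sz m" "sz m < 1"
  using k_pos by (auto simp: sz_def)

text \<open>The ratio (1 + sz m) / (1 - sz m) = (2k+m+1) / (m+1) is what the derivative formulas,
  the splitting of the norms and the growth of the kernels all come down to.\<close>

lemma Suc_sz: "(real m + 1) * (1 + sz m) = (2 * k + real m + 1) * (1 - sz m)"
  using k_pos by (simp add: sz_def divide_simps)

fun Rp :: "nat \<Rightarrow> complex \<Rightarrow> real" and Qp :: "nat \<Rightarrow> complex \<Rightarrow> real" where
  "Rp 0 z = 1"
| "Qp 0 z = 0"
| "Rp (Suc m) z = (1 + sz m) * (Re z * Rp m z + (Im z)\<^sup>2 * Qp m z)"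
| "Qp (Suc m) z = (1 - sz m) * (Re z * Qp m z - Rp m z)"

text \<open>\<open>Q\<close> is even in x, so its derivative is divisible by sin x;
  \<open>Wp\<close> is the quotient Q' / sin x. A recursion of its own, obtained by differentiating
  that of \<open>Qp\<close>, keeps it polynomial where sin x = 0.\<close>

fun Wp :: "nat \<Rightarrow> complex \<Rightarrow> real" where
  "Wp 0 z = 0"
| "Wp (Suc m) z = (1 - sz m) * (Re z * Wp m z - (2 * k + real m + 1) * Qp m z)"

definition Sp :: "nat \<Rightarrow> complex \<Rightarrow> real" where
  "Sp m z = Im z * Qp m z"

lemma Rp_Suc: "Rp (Suc m) z = (1 + sz m) * (Re z * Rp m z + Im z * Sp m z)"
  by (simp add: Sp_def power2_eq_square algebra_simps)

lemma Sp_Suc: "Sp (Suc m) z = (1 - sz m) * (Re z * Sp m z - Im z * Rp m z)"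
  by (simp add: Sp_def algebra_simps)

lemma Sp_0 [simp]: "Sp 0 z = 0"
  by (simp add: Sp_def)

text \<open>Read with W = Q' / sin x, this says S' = -2k cos x Q - m R, one half of the first-order
  system for R and S. It is proved by algebra alone because the induction for the derivatives below
  relies on it.\<close>

lemma Wp_relation:
  assumes z: "(Re z)\<^sup>2 + (Im z)\<^sup>2 = 1"
  shows "(Im z)\<^sup>2 * Wp m z = - (1 + 2 * k) * Re z * Qp m z - real m * Rp m z"
proof (induction m)
  case (Suc m)
  have 1: "(Im z)\<^sup>2 * Wp (Suc m) z
      = (1 - sz m) * (Re z * ((Im z)\<^sup>2 * Wp m z) - (2 * k + real m + 1) * (Im z)\<^sup>2 * Qp m z)"
    by (simp add: algebra_simps)
  have 2: "real (Suc m) * Rp (Suc m) z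
      = ((real m + 1) * (1 + sz m)) * (Re z * Rp m z + (Im z)\<^sup>2 * Qp m z)"
    by (simp add: algebra_simps)
  show ?case
    unfolding 1 2 Suc Suc_sz by (simp add: algebra_simps power2_eq_square)
qed simp

definition R :: "nat \<Rightarrow> real \<Rightarrow> real" where "R m x = Rp m (cis x)"
definition Q :: "nat \<Rightarrow> real \<Rightarrow> real" where "Q m x = Qp m (cis x)"
definition W :: "nat \<Rightarrow> real \<Rightarrow> real" where "W m x = Wp m (cis x)"
definition S :: "nat \<Rightarrow> real \<Rightarrow> real" where "S m x = sin x * Q m x"

lemma S_cis: "S m x = Sp m (cis x)"
  by (simp add: S_def Sp_def Q_def)

lemma RS_0 [simp]: "R 0 x = 1" "Q 0 x = 0" "S 0 x = 0"
  by (simp_all add: R_def Q_def S_def)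

lemma R_Suc: "R (Suc m) x = (1 + sz m) * (cos x * R m x + sin x * S m x)"
  by (simp add: R_def S_cis Rp_Suc del: Rp.simps)

lemma S_Suc: "S (Suc m) x = (1 - sz m) * (cos x * S m x - sin x * R m x)"
  by (simp add: R_def S_cis Sp_Suc del: Qp.simps)

lemma W_relation: "(sin x)\<^sup>2 * W m x = - (1 + 2 * k) * cos x * Q m x - real m * R m x"
  using Wp_relation[of "cis x" m] by (simp add: W_def Q_def R_def)

text \<open>The formula for R' and the one for S' in \<open>S_deriv\<close> are the imaginary and
  real parts of the eigenvalue equation T^k E = -(m+k) E for E_{-m} on the imaginary axis, with the
  quotient by sin x multiplied out. Each step of the recursion mixes R and Q, hence the joint
  induction.\<close>

lemma R_Q_deriv:
  "(R m has_real_derivative (2 * k + real m) * S m x) (at x) \<and>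
   (Q m has_real_derivative sin x * W m x) (at x)"
proof (induction m)
  case 0
  have "R 0 = (\<lambda>x. 1)" "Q 0 = (\<lambda>x. 0)" by auto
  then show ?case by (auto simp: W_def)
next
  case (Suc m)
  have eqR: "R (Suc m) = (\<lambda>x. (1 + sz m) * (cos x * R m x + (sin x)\<^sup>2 * Q m x))"
    by (auto simp: R_def Q_def)
  have eqQ: "Q (Suc m) = (\<lambda>x. (1 - sz m) * (cos x * Q m x - R m x))"
    by (auto simp: R_def Q_def)
  note [derivative_intros] = conjunct1[OF Suc] conjunct2[OF Suc]
  have "(R (Suc m) has_real_derivative (1 + sz m) *
      (- sin x * R m x + cos x * ((2 * k + real m) * S m x)
        + 2 * sin x * cos x * Q m x + (sin x)\<^sup>2 * (sin x * W m x))) (at x)"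
    unfolding eqR by (auto intro!: derivative_eq_intros)
  also have "(1 + sz m) * (- sin x * R m x + cos x * ((2 * k + real m) * S m x)
        + 2 * sin x * cos x * Q m x + (sin x)\<^sup>2 * (sin x * W m x))
      = sin x * ((real m + 1) * (1 + sz m)) * (cos x * Q m x - R m x)"
    using W_relation[of x m] unfolding S_def by algebra
  also have "\<dots> = (2 * k + real (Suc m)) * S (Suc m) x"
    unfolding Suc_sz by (simp add: S_def eqQ algebra_simps)
  finally have 1: "(R (Suc m) has_real_derivative (2 * k + real (Suc m)) * S (Suc m) x) (at x)" .
  have "(Q (Suc m) has_real_derivative (1 - sz m) *
      (- sin x * Q m x + cos x * (sin x * W m x) - (2 * k + real m) * S m x)) (at x)"
    unfolding eqQ by (auto intro!: derivative_eq_intros)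
  also have "(1 - sz m) * (- sin x * Q m x + cos x * (sin x * W m x) - (2 * k + real m) * S m x)
     = sin x * W (Suc m) x"
    by (simp add: W_def S_def Q_def algebra_simps)
  finally show ?case using 1 by blast
qed

lemmas R_deriv = conjunct1[OF R_Q_deriv]
lemmas Q_deriv = conjunct2[OF R_Q_deriv]

lemma S_deriv: "(S m has_real_derivative - 2 * k * cos x * Q m x - real m * R m x) (at x)"
proof -
  have eq: "S m = (\<lambda>x. sin x * Q m x)" by (auto simp: S_def)
  have "(S m has_real_derivative cos x * Q m x + sin x * (sin x * W m x)) (at x)"
    unfolding eq by (auto intro!: derivative_eq_intros Q_deriv)
  also have "cos x * Q m x + sin x * (sin x * W m x) = - 2 * k * cos x * Q m x - real m * R m x"
    using W_relation[of x m] by (simp add: power2_eq_square algebra_simps)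
  finally show ?thesis .
qed

lemma continuous_Rp_Qp: "continuous_on A (Rp m) \<and> continuous_on A (Qp m)"
  by (induction m) (auto intro!: continuous_intros)

lemma continuous_Rp [continuous_intros]: "continuous_on A f \<Longrightarrow> continuous_on A (\<lambda>x. Rp m (f x))"
  using continuous_Rp_Qp continuous_on_compose2 by blast

lemma continuous_Qp [continuous_intros]: "continuous_on A f \<Longrightarrow> continuous_on A (\<lambda>x. Qp m (f x))"
  using continuous_Rp_Qp continuous_on_compose2 by blast

lemma continuous_Wp [continuous_intros]: "continuous_on A f \<Longrightarrow> continuous_on A (\<lambda>x. Wp m (f x))"
  by (induction m) (auto intro!: continuous_intros)

lemma continuous_R [continuous_intros]: "continuous_on A f \<Longrightarrow> continuous_on A (\<lambda>x. R m (f x))"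
  unfolding R_def by (intro continuous_intros)

lemma continuous_Q [continuous_intros]: "continuous_on A f \<Longrightarrow> continuous_on A (\<lambda>x. Q m (f x))"
  unfolding Q_def by (intro continuous_intros)

lemma continuous_W [continuous_intros]: "continuous_on A f \<Longrightarrow> continuous_on A (\<lambda>x. W m (f x))"
  unfolding W_def by (intro continuous_intros)

lemma continuous_S [continuous_intros]: "continuous_on A (f :: 'a :: t2_space \<Rightarrow> real) \<Longrightarrow> continuous_on A (\<lambda>x. S m (f x))"
  unfolding S_def by (intro continuous_intros)

lemma R_measurable [measurable]: "R m \<in> borel_measurable borel"
  by (intro borel_measurable_continuous_onI continuous_intros)

lemma S_measurable [measurable]: "S m \<in> borel_measurable borel"
  by (intro borel_measurable_continuous_onI continuous_intros)

lemma R_Q_even: "R m (- x) = R m x \<and> Q m (- x) = Q m x"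
  by (induction m) (auto simp: R_def Q_def)

lemma R_minus [simp]: "R m (- x) = R m x"
  and S_minus [simp]: "S m (- x) = - S m x"
  using R_Q_even by (auto simp: S_def)

text \<open>\<open>Gm m\<close> is the value of \<open>M\<^sub>m\<close> at \<open>x = 0\<close>.\<close>

definition Gm :: "nat \<Rightarrow> real" where
  "Gm m = (\<Prod>i<m. 1 + sz i)"

lemma Gm_Suc: "Gm (Suc m) = (1 + sz m) * Gm m"
  by (simp add: Gm_def)

lemma Gm_pos: "0 < Gm m"
  unfolding Gm_def using sz_bounds by (intro prod_pos) (auto simp: add_pos_pos)

text \<open>Apart from the factors 1 + sz and 1 - sz, one step of the recursion rotates the vector
  (R, S) by the angle -x.\<close>

lemma RS_rotate:
  "(R (Suc m) x / (1 + sz m))\<^sup>2 + (S (Suc m) x / (1 - sz m))\<^sup>2 = (R m x)\<^sup>2 + (S m x)\<^sup>2"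
proof -
  have "R (Suc m) x / (1 + sz m) = cos x * R m x + sin x * S m x"
    using sz_bounds[of m] by (simp add: R_Suc)
  moreover have "S (Suc m) x / (1 - sz m) = cos x * S m x - sin x * R m x"
    using sz_bounds[of m] by (simp add: S_Suc)
  ultimately show ?thesis
    using sin_cos_squared_add[of x] by algebra
qed

text \<open>Each step is a rotation followed by stretching the axes by at most 1 + sz, so the
  modulus of M_m nowhere exceeds its value \<open>Gm m\<close> at x = 0. Stated for all z on the
  circle, the bound later yields uniform convergence in z.\<close>

lemma RS_bound_Rp: "cmod z = 1 \<Longrightarrow> (Rp m z)\<^sup>2 + (Sp m z)\<^sup>2 \<le> (Gm m)\<^sup>2"
proof (induction m)
  case (Suc m)
  let ?a = "Re z * Rp m z + Im z * Sp m z" and ?b = "Re z * Sp m z - Im z * Rp m z"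
  have z: "(Re z)\<^sup>2 + (Im z)\<^sup>2 = 1" using Suc.prems by (simp add: cmod_def)
  have "(Rp (Suc m) z)\<^sup>2 + (Sp (Suc m) z)\<^sup>2 = (1 + sz m)\<^sup>2 * ?a\<^sup>2 + (1 - sz m)\<^sup>2 * ?b\<^sup>2"
    unfolding Rp_Suc Sp_Suc by (simp only: power_mult_distrib)
  also have "\<dots> \<le> (1 + sz m)\<^sup>2 * ?a\<^sup>2 + (1 + sz m)\<^sup>2 * ?b\<^sup>2"
    using sz_bounds[of m] by (intro add_left_mono mult_right_mono power_mono) auto
  also have "\<dots> = (1 + sz m)\<^sup>2 * ((Rp m z)\<^sup>2 + (Sp m z)\<^sup>2)"
    using z by algebra
  also have "\<dots> \<le> (1 + sz m)\<^sup>2 * (Gm m)\<^sup>2"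
    using Suc by (intro mult_left_mono) auto
  finally show ?case by (simp add: Gm_Suc power_mult_distrib)
qed (simp add: Gm_def)

lemma Rp_Sp_le: "cmod z = 1 \<Longrightarrow> \<bar>Rp m z\<bar> \<le> Gm m \<and> \<bar>Sp m z\<bar> \<le> Gm m"
proof -
  assume "cmod z = 1"
  from RS_bound_Rp[OF this, of m]
  have "(Rp m z)\<^sup>2 \<le> (Gm m)\<^sup>2" "(Sp m z)\<^sup>2 \<le> (Gm m)\<^sup>2"
    by (smt (verit) zero_le_power2)+
  then show ?thesis using Gm_pos[of m] by (auto simp: abs_le_square_iff[symmetric])
qed

lemma R_le: "\<bar>R m x\<bar> \<le> Gm m" and S_le: "\<bar>S m x\<bar> \<le> Gm m"
  using Rp_Sp_le[of "cis x" m] by (auto simp: R_def S_cis)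

section \<open>Orthogonality and norms\<close>

abbreviation \<mu> :: "real measure" where "\<mu> \<equiv> mk k"

definition wt :: "real \<Rightarrow> real" where
  "wt x = indicator {-pi..pi} x * \<bar>sin x\<bar> powr (2 * k)"

lemma wt_measurable [measurable]: "wt \<in> borel_measurable borel"
  unfolding wt_def by measurable

lemma wt_nonneg: "0 \<le> wt x"
  by (simp add: wt_def)

lemma wt_le: "wt x \<le> indicator {-pi..pi} x"
  using k_pos by (auto simp: wt_def powr_le1 split: split_indicator)

lemma mu_eq: "\<mu> = density lborel (\<lambda>x. ennreal (wt x))"
  by (simp add: mk_def wt_def)

lemma sets_mu [simp, measurable_cong]: "sets \<mu> = sets borel"
  by (simp add: mu_eq)

lemma space_mu [simp]: "space \<mu> = UNIV"
  by (simp add: mu_eq)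

lemma emeasure_mu_le: "emeasure \<mu> UNIV \<le> ennreal (2 * pi)"
proof -
  have "emeasure \<mu> UNIV = (\<integral>\<^sup>+x. ennreal (wt x) \<partial>lborel)"
    by (simp add: mu_eq emeasure_density)
  also have "\<dots> \<le> (\<integral>\<^sup>+x. indicator {-pi..pi} x \<partial>lborel)"
    using wt_le by (intro nn_integral_mono) (metis ennreal_indicator ennreal_leI)
  also have "\<dots> = ennreal (2 * pi)" by simp
  finally show ?thesis .
qed

sublocale mu: finite_measure \<mu>
  by standard (metis emeasure_mu_le ennreal_less_top infinity_ennreal_def leD space_mu)

lemma integrable_mu_bounded:
  fixes f :: "real \<Rightarrow> 'a::{banach, second_countable_topology}"
  assumes [measurable]: "f \<in> borel_measurable borel" and "\<And>x. norm (f x) \<le> B"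
  shows "integrable \<mu> f"
  using assms by (intro mu.integrable_const_bound[where B = B]) auto

lemma integrable_mu_iff:
  fixes f :: "real \<Rightarrow> 'a::{banach, second_countable_topology}"
  assumes [measurable]: "f \<in> borel_measurable borel"
  shows "integrable \<mu> f \<longleftrightarrow> integrable lborel (\<lambda>x. wt x *\<^sub>R f x)"
  unfolding mu_eq by (rule integrable_density) (auto simp: wt_nonneg)

lemma integral_mu:
  fixes f :: "real \<Rightarrow> 'a::{banach, second_countable_topology}"
  assumes [measurable]: "f \<in> borel_measurable borel"
  shows "(\<integral>x. f x \<partial>\<mu>) = (\<integral>x. wt x *\<^sub>R f x \<partial>lborel)"
  unfolding mu_eq by (rule integral_density) (auto simp: wt_nonneg)

lemma integrable_mu_cont:
  fixes f :: "real \<Rightarrow> 'a::{banach, second_countable_topology}"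
  assumes f: "continuous_on UNIV f"
  shows "integrable \<mu> f"
proof -
  have [measurable]: "f \<in> borel_measurable borel"
    using f by (rule borel_measurable_continuous_onI)
  have "compact (f ` {-pi..pi})"
    by (intro compact_continuous_image continuous_on_subset[OF f]) auto
  then obtain B where B: "\<And>x. x \<in> {-pi..pi} \<Longrightarrow> norm (f x) \<le> B"
    using compact_imp_bounded bounded_iff by (metis image_eqI)
  have "0 \<le> B" using order_trans[OF norm_ge_zero B[of 0]] by simp
  have "integrable lborel (\<lambda>x. wt x *\<^sub>R f x)"
  proof (rule Bochner_Integration.integrable_bound)
    show "integrable lborel (\<lambda>x. B * indicator {-pi..pi} x :: real)" by simp
    show "AE x in lborel. norm (wt x *\<^sub>R f x) \<le> norm (B * indicator {-pi..pi} x :: real)"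
    proof (rule AE_I2)
      fix x
      show "norm (wt x *\<^sub>R f x) \<le> norm (B * indicator {-pi..pi} x :: real)"
      proof (cases "x \<in> {-pi..pi}")
        case True
        then have "wt x * norm (f x) \<le> 1 * B"
          using wt_le[of x] wt_nonneg[of x] B[OF True] by (intro mult_mono) auto
        then show ?thesis using True wt_nonneg[of x] \<open>0 \<le> B\<close> by simp
      qed (simp add: wt_def)
    qed
  qed measurable
  then show ?thesis by (simp add: integrable_mu_iff)
qed

lemma integral_mu_reflect:
  fixes f :: "real \<Rightarrow> 'a::{banach, second_countable_topology}"
  assumes [measurable]: "f \<in> borel_measurable borel"
  shows "(\<integral>x. f (- x) \<partial>\<mu>) = (\<integral>x. f x \<partial>\<mu>)"
proof -
  have "wt (- x) = wt x" for x by (auto simp: wt_def split: split_indicator)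
  then have "(\<integral>x. wt x *\<^sub>R f x \<partial>lborel) = (\<integral>x. wt x *\<^sub>R f (- x) \<partial>lborel)"
    by (subst lborel_integral_real_affine[where c = "-1" and t = 0]) auto
  then show ?thesis by (simp add: integral_mu)
qed

lemma integral_mu_odd:
  fixes f :: "real \<Rightarrow> real"
  assumes [measurable]: "f \<in> borel_measurable borel" and "\<And>x. f (- x) = - f x"
  shows "(\<integral>x. f x \<partial>\<mu>) = 0"
  using integral_mu_reflect[of f] assms by simp

lemma wt_pos: "x \<in> {-pi<..<pi} \<Longrightarrow> x \<noteq> 0 \<Longrightarrow> 0 < wt x"
  using sin_gt_zero[of x] sin_gt_zero[of "- x"]
  by (cases "x > 0") (auto simp: wt_def)

text \<open>Times the weight, the integrand is the derivative of |sin x|^(2k) sin x q(x), which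
  vanishes at both endpoints. The formula for the derivative is established where sin x is nonzero;
  the fundamental theorem tolerates the exceptional point 0.\<close>

lemma integral_by_parts_mu:
  assumes q: "\<And>x. (q has_real_derivative q' x) (at x)"
    and q': "continuous_on UNIV q'"
  shows "(\<integral>x. sin x * q' x + (1 + 2 * k) * cos x * q x \<partial>\<mu>) = 0"
proof -
  let ?f = "\<lambda>x. sin x * q' x + (1 + 2 * k) * cos x * q x"
  let ?F = "\<lambda>x. \<bar>sin x\<bar> powr (2 * k) * (sin x * q x)"
  have cq: "continuous_on UNIV q"
    using q by (meson DERIV_isCont continuous_at_imp_continuous_on)
  have cf: "continuous_on UNIV ?f"
    by (intro continuous_intros cq q')
  have cf': "continuous_on {-pi..pi} (\<lambda>x. \<bar>sin x\<bar> powr (2 * k) * ?f x)"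
    using k_pos by (intro continuous_intros continuous_on_powr' continuous_on_subset[OF cf]) auto
  have [measurable]: "?f \<in> borel_measurable borel"
    using cf by (rule borel_measurable_continuous_onI)
  have sq: "\<bar>sin x\<bar> powr (2 * k) = ((sin x)\<^sup>2) powr k" for x :: real
    by (cases "sin x = 0") (auto simp: powr_powr[symmetric])
  have D: "(?F has_real_derivative \<bar>sin x\<bar> powr (2 * k) * ?f x) (at x)" if x: "sin x \<noteq> 0" for x
  proof -
    have "((\<lambda>x. ((sin x)\<^sup>2) powr k) has_real_derivative
        k * ((sin x)\<^sup>2) powr (k - 1) * (2 * sin x * cos x)) (at x)"
      using x by (intro DERIV_cong[OF DERIV_fun_powr[where r = k]]) (auto intro!: derivative_eq_intros)
    also have "((sin x)\<^sup>2) powr (k - 1) = ((sin x)\<^sup>2) powr k / (sin x)\<^sup>2"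
      using x by (simp add: powr_diff)
    finally have pw: "((\<lambda>x. ((sin x)\<^sup>2) powr k) has_real_derivative
        k * (((sin x)\<^sup>2) powr k / (sin x)\<^sup>2) * (2 * sin x * cos x)) (at x)" .
    have "(?F has_real_derivative
        k * (((sin x)\<^sup>2) powr k / (sin x)\<^sup>2) * (2 * sin x * cos x) * (sin x * q x)
        + ((sin x)\<^sup>2) powr k * (cos x * q x + sin x * q' x)) (at x)"
      unfolding sq
      by (rule DERIV_cong[OF DERIV_mult[OF pw DERIV_mult[OF DERIV_sin q]]]) (simp add: algebra_simps)
    also have "k * (((sin x)\<^sup>2) powr k / (sin x)\<^sup>2) * (2 * sin x * cos x) * (sin x * q x)
        + ((sin x)\<^sup>2) powr k * (cos x * q x + sin x * q' x) = \<bar>sin x\<bar> powr (2 * k) * ?f x"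
      unfolding sq using x by (simp add: field_simps power2_eq_square)
    finally show ?thesis .
  qed
  have "((\<lambda>x. \<bar>sin x\<bar> powr (2 * k) * ?f x) has_integral (?F pi - ?F (-pi))) {-pi..pi}"
  proof (rule fundamental_theorem_of_calculus_interior_strong[where S = "{0}"])
    fix x assume "x \<in> {-pi<..<pi} - {0}"
    then have "sin x \<noteq> 0"
      using wt_pos[of x] by (auto simp: wt_def)
    from D[OF this] show "(?F has_vector_derivative \<bar>sin x\<bar> powr (2 * k) * ?f x) (at x)"
      by (simp add: has_real_derivative_iff_has_vector_derivative)
  next
    show "continuous_on {-pi..pi} ?F"
      using k_pos by (intro continuous_intros continuous_on_powr' continuous_on_subset[OF cq]) auto
  qed auto
  then have HK: "integral {-pi..pi} (\<lambda>x. \<bar>sin x\<bar> powr (2 * k) * ?f x) = 0"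
    by (simp add: integral_unique)
  have si: "set_integrable lborel {-pi..pi} (\<lambda>x. \<bar>sin x\<bar> powr (2 * k) * ?f x)"
    by (rule borel_integrable_compact[OF compact_Icc cf', folded set_integrable_def, simplified])
  have "(\<integral>x. ?f x \<partial>\<mu>) = (LINT x:{-pi..pi}|lborel. \<bar>sin x\<bar> powr (2 * k) * ?f x)"
    unfolding set_lebesgue_integral_def
    by (subst integral_mu) (measurable, simp add: wt_def mult.assoc)
  also have "\<dots> = 0"
    using set_borel_integral_eq_integral(2)[OF si] HK by simp
  finally show ?thesis .
qed

lemma RS_int [simp]:
  "integrable \<mu> (\<lambda>x. R i x * R j x)" "integrable \<mu> (\<lambda>x. S i x * S j x)"
  "integrable \<mu> (\<lambda>x. R i x * S j x)" "integrable \<mu> (\<lambda>x. S i x * R j x)"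
  by (intro integrable_mu_cont continuous_intros)+

text \<open>Exchanging \<open>n\<close> and \<open>m\<close> here gives two linear relations between the two integrals, which force both
  of them to vanish for \<open>n \<noteq> m\<close>.\<close>

lemma RS_parts:
  "real n * (\<integral>x. R n x * R m x \<partial>\<mu>) = (2 * k + real m) * (\<integral>x. S n x * S m x \<partial>\<mu>)"
proof -
  \<comment> \<open>Integration by parts with q = Q_n R_m; \<open>W_relation\<close> then eliminates
    W and restores the missing factors of sin x.\<close>
  have "(\<integral>x. sin x * (sin x * W n x * R m x + Q n x * ((2 * k + real m) * S m x))
        + (1 + 2 * k) * cos x * (Q n x * R m x) \<partial>\<mu>) = 0"
    by (rule integral_by_parts_mu)
      (auto intro!: derivative_eq_intros R_deriv Q_deriv continuous_intros)
  also have "(\<lambda>x. sin x * (sin x * W n x * R m x + Q n x * ((2 * k + real m) * S m x))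
        + (1 + 2 * k) * cos x * (Q n x * R m x))
      = (\<lambda>x. (2 * k + real m) * (S n x * S m x) - real n * (R n x * R m x))"
  proof
    fix x
    show "sin x * (sin x * W n x * R m x + Q n x * ((2 * k + real m) * S m x))
        + (1 + 2 * k) * cos x * (Q n x * R m x)
      = (2 * k + real m) * (S n x * S m x) - real n * (R n x * R m x)"
      using W_relation[of x n] unfolding S_def by algebra
  qed
  finally show ?thesis by simp
qed

lemma R_orth: "n \<noteq> m \<Longrightarrow> (\<integral>x. R n x * R m x \<partial>\<mu>) = 0"
  and S_orth: "n \<noteq> m \<Longrightarrow> (\<integral>x. S n x * S m x \<partial>\<mu>) = 0"
proof -
  assume nm: "n \<noteq> m"
  let ?r = "\<integral>x. R n x * R m x \<partial>\<mu>" and ?s = "\<integral>x. S n x * S m x \<partial>\<mu>"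
  have 1: "real n * ?r = (2 * k + real m) * ?s" by (rule RS_parts)
  have 2: "real m * ?r = (2 * k + real n) * ?s"
    using RS_parts[of m n] by (simp add: mult.commute)
  have "(real n - real m) * (2 * k + real n + real m) * ?r = 0"
    using 1 2 by algebra
  then show r: "?r = 0" using nm k_pos by (auto simp: add_eq_0_iff)
  then show "?s = 0" using 1 k_pos by (auto simp: add_eq_0_iff)
qed

lemma RS_orth: "(\<integral>x. R n x * S m x \<partial>\<mu>) = 0" "(\<integral>x. S n x * R m x \<partial>\<mu>) = 0"
  by (rule integral_mu_odd; simp)+

definition nR :: "nat \<Rightarrow> real" where "nR n = (\<integral>x. R n x * R n x \<partial>\<mu>)"
definition nS :: "nat \<Rightarrow> real" where "nS n = (\<integral>x. S n x * S n x \<partial>\<mu>)"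
definition hn :: "nat \<Rightarrow> real" where "hn n = nR n + nS n"

lemma nS_0 [simp]: "nS 0 = 0" by (simp add: nS_def)

lemma nR_nS_Suc: "(1 - sz n) * nR (Suc n) = (1 + sz n) * nS (Suc n)"
proof -
  have 1: "(real n + 1) * nR (Suc n) = (2 * k + real n + 1) * nS (Suc n)"
    using RS_parts[of "Suc n" "Suc n"] by (simp add: nR_def nS_def algebra_simps)
  have "(real n + 1) * ((1 - sz n) * nR (Suc n)) = (1 - sz n) * (2 * k + real n + 1) * nS (Suc n)"
    using 1 by algebra
  also have "\<dots> = (real n + 1) * ((1 + sz n) * nS (Suc n))"
    using Suc_sz[of n] by algebra
  finally show ?thesis by simp
qed

lemma hn_rotate: "hn n = nR (Suc n) / (1 + sz n)\<^sup>2 + nS (Suc n) / (1 - sz n)\<^sup>2"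
proof -
  have "hn n = (\<integral>x. (R n x)\<^sup>2 + (S n x)\<^sup>2 \<partial>\<mu>)"
    by (simp add: hn_def nR_def nS_def power2_eq_square)
  also have "\<dots> = (\<integral>x. (R (Suc n) x * R (Suc n) x) / (1 + sz n)\<^sup>2
      + (S (Suc n) x * S (Suc n) x) / (1 - sz n)\<^sup>2 \<partial>\<mu>)"
    unfolding RS_rotate[symmetric] by (simp add: power_divide power2_eq_square)
  also have "\<dots> = nR (Suc n) / (1 + sz n)\<^sup>2 + nS (Suc n) / (1 - sz n)\<^sup>2"
    unfolding nR_def nS_def by (subst Bochner_Integration.integral_add) auto
  finally show ?thesis .
qed

text \<open>The diagonal case of \<open>RS_parts\<close> fixes the ratio of \<open>nR\<close> to
  \<open>nS\<close>, and \<open>hn_rotate\<close> then determines both. The last equation is the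
  classical norm recursion for orthogonal polynomials on the unit circle with Verblunsky
  coefficients \<open>sz\<close>.\<close>

lemma nR_nS_hn_Suc:
  "nR (Suc n) = (1 + sz n) * hn (Suc n) / 2"
  "nS (Suc n) = (1 - sz n) * hn (Suc n) / 2"
  "hn (Suc n) = (1 - (sz n)\<^sup>2) * hn n"
proof -
  show r: "nR (Suc n) = (1 + sz n) * hn (Suc n) / 2" 
    and s: "nS (Suc n) = (1 - sz n) * hn (Suc n) / 2"
    using nR_nS_Suc[of n] unfolding hn_def by algebra+
  have ne: "1 + sz n \<noteq> 0" "1 - sz n \<noteq> 0" using sz_bounds[of n] by auto
  have cancel: "a * c / 2 / a\<^sup>2 = c / 2 * (1 / a)" if "a \<noteq> 0" for a c :: real
    using that by (simp add: power2_eq_square)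
  have "hn n = (hn (Suc n) / 2) * (1 / (1 + sz n) + 1 / (1 - sz n))"
    unfolding hn_rotate[of n] r s cancel[OF ne(1)] cancel[OF ne(2)] by (simp add: algebra_simps)
  also have "\<dots> = hn (Suc n) / ((1 + sz n) * (1 - sz n))"
    using ne by (simp add: field_simps)
  finally have "hn n * ((1 + sz n) * (1 - sz n)) = hn (Suc n)"
    using ne by simp
  then show "hn (Suc n) = (1 - (sz n)\<^sup>2) * hn n"
    by (simp add: algebra_simps power2_eq_square)
qed

lemma measure_mu_pos: "0 < measure \<mu> UNIV"
proof (rule ccontr)
  assume "\<not> 0 < measure \<mu> UNIV"
  then have "measure \<mu> UNIV = 0" by (simp add: order_antisym not_less)
  then have "emeasure \<mu> UNIV = 0" by (simp add: mu.emeasure_eq_measure)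
  then have "AE x in \<mu>. False" by (auto simp: AE_iff_null null_sets_def)
  then have "AE x in lborel. \<not> 0 < wt x"
    unfolding mu_eq by (subst (asm) AE_density) auto
  moreover have "AE x in lborel. x \<notin> {0::real}"
    by (rule AE_not_in) auto
  ultimately have "AE x in lborel. x \<notin> {-pi<..<pi}"
    by eventually_elim (use wt_pos in auto)
  then have "emeasure lborel {-pi<..<pi} = 0"
    by (subst (asm) AE_iff_measurable[where N = "{-pi<..<pi}"]) auto
  then show False using pi_gt_zero by (simp del: pi_gt_zero)
qed

lemma hn_0: "hn 0 = measure \<mu> UNIV" "nR 0 = measure \<mu> UNIV"
  by (simp_all add: hn_def nR_def)

lemma hn_pos: "0 < hn n"
proof (induction n)
  case (Suc n)
  have "(sz n)\<^sup>2 < 1" using sz_bounds[of n] by (simp add: power_less_one_iff abs_square_less_1)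
  then show ?case using Suc by (simp add: nR_nS_hn_Suc(3))
qed (simp add: hn_0 measure_mu_pos)

lemma nR_pos: "0 < nR n"
  using hn_pos[of n] sz_bounds by (cases n) (auto simp: hn_0 measure_mu_pos nR_nS_hn_Suc(1) add_pos_pos)

lemma nS_pos: "0 < n \<Longrightarrow> 0 < nS n"
  using hn_pos[of n] sz_bounds by (cases n) (auto simp: nR_nS_hn_Suc(2))

section \<open>Trigonometric polynomials\<close>

text \<open>These are the real trigonometric polynomials of degree at most N, presented by
  generators that are already orthogonal. Once the ordinary cosines and sines are found in it,
  orthogonality to all exponentials of lower degree is immediate.\<close>

inductive_set V :: "nat \<Rightarrow> (real \<Rightarrow> real) set" for N where
  R_in: "m \<le> N \<Longrightarrow> R m \<in> V N"
| S_in: "m \<le> N \<Longrightarrow> S m \<in> V N"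
| add_in: "f \<in> V N \<Longrightarrow> g \<in> V N \<Longrightarrow> (\<lambda>x. f x + g x) \<in> V N"
| scale_in: "f \<in> V N \<Longrightarrow> (\<lambda>x. c * f x) \<in> V N"

lemma V_mono: "f \<in> V N \<Longrightarrow> N \<le> M \<Longrightarrow> f \<in> V M"
  by (induction rule: V.induct) (auto intro: V.intros)

lemma V_lin:
  assumes "f \<in> V N" "g \<in> V N" "\<And>x. h x = a * f x + b * g x"
  shows "h \<in> V N"
proof -
  have "(\<lambda>x. a * f x + b * g x) \<in> V N" using assms by (intro V.intros)
  moreover have "h = (\<lambda>x. a * f x + b * g x)" using assms by auto
  ultimately show ?thesis by simp
qed

lemma one_in_V: "(\<lambda>x. 1) \<in> V N"
proof -
  have "R 0 \<in> V N" by (rule R_in) simp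
  moreover have "R 0 = (\<lambda>x. 1)" by auto
  ultimately show ?thesis by simp
qed

text \<open>The terms with sin x are eliminated between the recursion from n+1 to n+2 and the
  inverted recursion from n+1 to n, which leaves three-term recurrences.\<close>

lemma cos_R_Suc: "cos x * R (Suc n) x
    = (1 - (sz n)\<^sup>2) / 2 * R n x + (1 + sz n) / (1 + sz (Suc n)) / 2 * R (Suc (Suc n)) x"
  and cos_S_Suc: "cos x * S (Suc n) x
    = (1 - (sz n)\<^sup>2) / 2 * S n x + (1 - sz n) / (1 - sz (Suc n)) / 2 * S (Suc (Suc n)) x"
proof -
  have 1: "R (Suc (Suc n)) x / (1 + sz (Suc n)) = cos x * R (Suc n) x + sin x * S (Suc n) x"
    using sz_bounds[of "Suc n"] by (simp add: R_Suc[of "Suc n"])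
  have 2: "S (Suc (Suc n)) x / (1 - sz (Suc n)) = cos x * S (Suc n) x - sin x * R (Suc n) x"
    using sz_bounds[of "Suc n"] by (simp add: S_Suc[of "Suc n"])
  have r: "(1 - (sz n)\<^sup>2) * R n x = (1 - sz n) * cos x * R (Suc n) x - (1 + sz n) * sin x * S (Suc n) x"
    unfolding R_Suc S_Suc using sin_cos_squared_add[of x] by algebra
  have s: "(1 - (sz n)\<^sup>2) * S n x = (1 + sz n) * cos x * S (Suc n) x + (1 - sz n) * sin x * R (Suc n) x"
    unfolding R_Suc S_Suc using sin_cos_squared_add[of x] by algebra
  have half: "y = p / 2 * u + c / e / 2 * d" if "2 * y = p * u + c * (d / e)" for y p u c d e :: real
  proof -
    have "c / e / 2 * d = c * (d / e) / 2" "p / 2 * u = p * u / 2" by simp_all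
    moreover have "y = (p * u + c * (d / e)) / 2" by (subst that[symmetric]) simp
    ultimately show ?thesis by (simp only: add_divide_distrib)
  qed
  have "2 * (cos x * R (Suc n) x)
      = (1 - (sz n)\<^sup>2) * R n x + (1 + sz n) * (R (Suc (Suc n)) x / (1 + sz (Suc n)))"
    unfolding 1 r by (simp add: algebra_simps)
  then show "cos x * R (Suc n) x
    = (1 - (sz n)\<^sup>2) / 2 * R n x + (1 + sz n) / (1 + sz (Suc n)) / 2 * R (Suc (Suc n)) x"
    by (rule half)
  have "2 * (cos x * S (Suc n) x)
      = (1 - (sz n)\<^sup>2) * S n x + (1 - sz n) * (S (Suc (Suc n)) x / (1 - sz (Suc n)))"
    unfolding 2 s by (simp add: algebra_simps)
  then show "cos x * S (Suc n) x
    = (1 - (sz n)\<^sup>2) / 2 * S n x + (1 - sz n) / (1 - sz (Suc n)) / 2 * S (Suc (Suc n)) x"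
    by (rule half)
qed

lemma cos_R_in: "(\<lambda>x. cos x * R n x) \<in> V (Suc n)"
proof (cases n)
  case 0
  have "R (Suc 0) \<in> V (Suc 0)" by (rule R_in) simp
  from V_lin[OF this this, of _ "1 / (1 + sz 0)" 0] show ?thesis
    using 0 sz_bounds[of 0] by (simp add: R_Suc)
next
  case (Suc m)
  show ?thesis unfolding Suc
    by (rule V_lin[OF R_in R_in cos_R_Suc]) auto
qed

lemma cos_S_in: "(\<lambda>x. cos x * S n x) \<in> V (Suc n)"
proof (cases n)
  case 0
  have "S 0 \<in> V (Suc 0)" by (rule S_in) simp
  moreover have "S 0 = (\<lambda>x. 0)" by auto
  ultimately show ?thesis using 0 by simp
next
  case (Suc m)
  show ?thesis unfolding Suc
    by (rule V_lin[OF S_in S_in cos_S_Suc]) auto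
qed

lemma sin_S_in: "(\<lambda>x. sin x * S n x) \<in> V (Suc n)"
  by (rule V_lin[OF R_in[of "Suc n"] cos_R_in, of _ _ "1 / (1 + sz n)" "-1"])
    (use sz_bounds[of n] in \<open>auto simp: R_Suc\<close>)

lemma sin_R_in: "(\<lambda>x. sin x * R n x) \<in> V (Suc n)"
  by (rule V_lin[OF S_in[of "Suc n"] cos_S_in, of _ _ "- 1 / (1 - sz n)" 1])
    (use sz_bounds[of n] in \<open>auto simp: S_Suc divide_simps\<close>)

lemma cos_sin_in:
  "f \<in> V N \<Longrightarrow> (\<lambda>x. cos x * f x) \<in> V (Suc N) \<and> (\<lambda>x. sin x * f x) \<in> V (Suc N)"
proof (induction rule: V.induct)
  case (R_in m)
  then show ?case using V_mono[OF cos_R_in, of m "Suc N"] V_mono[OF sin_R_in, of m "Suc N"] by simp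
next
  case (S_in m)
  then show ?case using V_mono[OF cos_S_in, of m "Suc N"] V_mono[OF sin_S_in, of m "Suc N"] by simp
next
  case (add_in f g)
  then show ?case by (auto simp: distrib_left intro: V.add_in)
next
  case (scale_in f c)
  then show ?case by (auto simp: mult.left_commute intro: V.scale_in)
qed

lemma trig_in_V: "(\<lambda>x. cos (real n * x)) \<in> V n \<and> (\<lambda>x. sin (real n * x)) \<in> V n"
proof (induction n)
  case 0
  have "(\<lambda>x. 0 * 1) \<in> V 0" by (intro scale_in one_in_V)
  then show ?case using one_in_V by simp
next
  case (Suc n)
  then have *: "(\<lambda>x. cos x * cos (real n * x)) \<in> V (Suc n)" "(\<lambda>x. sin x * cos (real n * x)) \<in> V (Suc n)"
    "(\<lambda>x. cos x * sin (real n * x)) \<in> V (Suc n)" "(\<lambda>x. sin x * sin (real n * x)) \<in> V (Suc n)"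
    using cos_sin_in by blast+
  show ?case
  proof
    show "(\<lambda>x. cos (real (Suc n) * x)) \<in> V (Suc n)"
      by (rule V_lin[OF *(1,4), of _ 1 "-1"]) (simp add: distrib_right cos_add algebra_simps)
    show "(\<lambda>x. sin (real (Suc n) * x)) \<in> V (Suc n)"
      by (rule V_lin[OF *(2,3), of _ 1 1]) (simp add: distrib_right sin_add algebra_simps)
  qed
qed

lemma V_continuous: "f \<in> V N \<Longrightarrow> continuous_on UNIV f"
  by (induction rule: V.induct) (auto intro!: continuous_intros)

lemma V_orth:
  assumes "f \<in> V N" "N < m"
  shows "(\<integral>x. R m x * f x \<partial>\<mu>) = 0 \<and> (\<integral>x. S m x * f x \<partial>\<mu>) = 0"
  using assms
proof (induction rule: V.induct)
  case (add_in f g)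
  then have "continuous_on UNIV f" "continuous_on UNIV g" by (auto intro: V_continuous)
  then have "integrable \<mu> (\<lambda>x. R m x * f x)" "integrable \<mu> (\<lambda>x. R m x * g x)"
     "integrable \<mu> (\<lambda>x. S m x * f x)" "integrable \<mu> (\<lambda>x. S m x * g x)"
    by (auto intro!: integrable_mu_cont continuous_intros)
  then show ?case using add_in by (auto simp: distrib_left)
next
  case (scale_in f c)
  then show ?case by (auto simp: mult.left_commute)
qed (auto simp: R_orth S_orth RS_orth)

lemma V_expand:
  "f \<in> V N \<Longrightarrow> \<exists>A B. f = (\<lambda>x. \<Sum>m\<le>N. A m * R m x + B m * S m x)"
proof (induction rule: V.induct)
  case (R_in m)
  then have "R m = (\<lambda>x. \<Sum>i\<le>N. (if i = m then 1 else 0) * R i x + 0 * S i x)"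
    by (auto simp: if_distrib[of "\<lambda>c. c * _"] sum.delta cong: if_cong)
  then show ?case by (intro exI)
next
  case (S_in m)
  then have "S m = (\<lambda>x. \<Sum>i\<le>N. 0 * R i x + (if i = m then 1 else 0) * S i x)"
    by (auto simp: if_distrib[of "\<lambda>c. c * _"] sum.delta cong: if_cong)
  then show ?case by (intro exI)
next
  case (add_in f g)
  then obtain A B A' B' where "f = (\<lambda>x. \<Sum>m\<le>N. A m * R m x + B m * S m x)"
    "g = (\<lambda>x. \<Sum>m\<le>N. A' m * R m x + B' m * S m x)" by blast
  then have "(\<lambda>x. f x + g x) = (\<lambda>x. \<Sum>m\<le>N. (A m + A' m) * R m x + (B m + B' m) * S m x)"
    by (auto simp: sum.distrib[symmetric] algebra_simps)
  then show ?case by (intro exI)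
next
  case (scale_in f c)
  then obtain A B where "f = (\<lambda>x. \<Sum>m\<le>N. A m * R m x + B m * S m x)" by blast
  then have "(\<lambda>x. c * f x) = (\<lambda>x. \<Sum>m\<le>N. (c * A m) * R m x + (c * B m) * S m x)"
    by (auto simp: sum_distrib_left algebra_simps)
  then show ?case by (intro exI)
qed

lemma polynomial_in_V:
  fixes p :: "complex \<Rightarrow> real"
  assumes "real_polynomial_function p"
  shows "\<exists>N. (\<lambda>x. p (cis x)) \<in> V N"
proof -
  \<comment> \<open>The extra factor f carries the induction through products: q is absorbed into f
    first, then p acts on the result.\<close>
  have "f \<in> V M \<Longrightarrow> \<exists>N. (\<lambda>x. p (cis x) * f x) \<in> V N" for f M
    using assms
  proof (induction arbitrary: f M rule: real_polynomial_function.induct)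
    case (linear p)
    have eq: "p (cis x) = p 1 * cos x + p \<i> * sin x" for x
    proof -
      have "cis x = cos x *\<^sub>R 1 + sin x *\<^sub>R \<i>" by (simp add: complex_eq_iff)
      then show ?thesis
        using bounded_linear.linear[OF linear(1)] by (simp add: linear_add linear_scale)
    qed
    have "(\<lambda>x. p (cis x) * f x) \<in> V (Suc M)"
      using cos_sin_in[OF linear(2)]
      by (auto intro!: V_lin[of "\<lambda>x. cos x * f x" _ "\<lambda>x. sin x * f x" _ "p 1" "p \<i>"]
          simp: eq algebra_simps)
    then show ?case by blast
  next
    case (const c)
    then show ?case by (auto intro: V.scale_in)
  next
    case (add p q)
    then obtain N N' where "(\<lambda>x. p (cis x) * f x) \<in> V N" "(\<lambda>x. q (cis x) * f x) \<in> V N'" by metis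
    then have "(\<lambda>x. p (cis x) * f x) \<in> V (max N N')" "(\<lambda>x. q (cis x) * f x) \<in> V (max N N')"
      by (auto intro: V_mono)
    then show ?case by (auto simp: distrib_right intro: V.add_in)
  next
    case (mult p q)
    then obtain N where "(\<lambda>x. q (cis x) * f x) \<in> V N" by blast
    from mult.IH(1)[OF this] show ?case by (simp add: mult.assoc)
  qed
  from this[OF one_in_V] show ?thesis by simp
qed

section \<open>Identification of the non-symmetric Jacobi polynomials\<close>

lemma cis_int_eq: "exp (\<i> * of_int j * of_real x) = cis (real_of_int j * x)"
  by (simp add: cis_conv_exp mult.assoc)

lemma integral_cis:
  "(LBINT x:{-pi..pi}. cis (real_of_int j * x)) = (if j = 0 then 2 * of_real pi else 0)"
proof (cases "j = 0")
  case False
  let ?F = "\<lambda>x. cis (real_of_int j * x) / (\<i> * of_int j)"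
  have D: "(?F has_vector_derivative cis (real_of_int j * x)) (at x within {-pi..pi})" for x
    using False unfolding cis_conv_exp
    by (auto intro!: derivative_eq_intros has_vector_derivative_real_field simp: field_simps)
  have "(LBINT x:{-pi..pi}. cis (real_of_int j * x)) = ?F pi - ?F (-pi)"
    unfolding set_lebesgue_integral_def
    using D by (intro integral_FTC_atLeastAtMost continuous_intros) auto
  also have "\<dots> = 0"
  proof -
    have "cis (real_of_int j * pi) = cis (- (real_of_int j * pi))"
      by (auto simp: complex_eq_iff sin_zero_iff_int2)
    then show ?thesis by simp
  qed
  finally show ?thesis using False by simp
qed (simp add: set_lebesgue_integral_def scaleR_conv_of_real)

lemma AE_mu_imp: "AE x in \<mu>. P x \<Longrightarrow> AE x in lborel. x \<in> {-pi..pi} \<longrightarrow> P x"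
proof -
  assume "AE x in \<mu>. P x"
  then have "AE x in lborel. 0 < ennreal (wt x) \<longrightarrow> P x"
    unfolding mu_eq by (subst (asm) AE_density) auto
  moreover have "AE x in lborel. x \<notin> {-pi, 0, pi::real}"
    by (rule AE_not_in) (auto intro: finite_imp_null_set_lborel)
  ultimately show ?thesis
    by eventually_elim (use wt_pos in force)
qed

abbreviation ee :: "int \<Rightarrow> real \<Rightarrow> complex" where
  "ee j x \<equiv> cis (real_of_int j * x)"

text \<open>A combination orthogonal to each of its own terms has norm zero, so it vanishes almost
  everywhere for \<mu>. The weight is positive off finitely many points of [-pi, pi], so it vanishes
  there almost everywhere for Lebesgue measure too, and ordinary Fourier coefficients recover
  d.\<close>

lemma exponentials_independent:
  fixes d :: "int \<Rightarrow> complex"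
  assumes F: "finite F"
    and orth: "\<And>l. l \<in> F \<Longrightarrow>
      inner_k k (\<lambda>x. \<Sum>j\<in>F. d j * ee j x) (ee l) = 0"
    and l: "l \<in> F"
  shows "d l = 0"
proof -
  let ?D = "\<lambda>x. \<Sum>j\<in>F. d j * ee j x"
  have cD: "continuous_on A ?D" for A :: "real set" by (intro continuous_intros)
  have "(\<integral>x. ?D x * cnj (?D x) \<partial>\<mu>) = (\<integral>x. (\<Sum>l\<in>F. cnj (d l) * (?D x * cnj (ee l x))) \<partial>\<mu>)"
    by (intro Bochner_Integration.integral_cong)
      (auto simp: sum_distrib_left sum_distrib_right mult_ac)
  also have "\<dots> = (\<Sum>l\<in>F. \<integral>x. cnj (d l) * (?D x * cnj (ee l x)) \<partial>\<mu>)"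
    by (intro Bochner_Integration.integral_sum integrable_mu_cont continuous_intros)
  also have "\<dots> = 0"
    using orth by (intro sum.neutral) (auto simp: inner_k_def)
  finally have "(\<integral>x. complex_of_real ((cmod (?D x))\<^sup>2) \<partial>\<mu>) = 0"
    by (simp only: complex_norm_square)
  then have "(\<integral>x. (cmod (?D x))\<^sup>2 \<partial>\<mu>) = 0"
    by (simp only: integral_complex_of_real of_real_eq_0_iff)
  moreover have "integrable \<mu> (\<lambda>x. (cmod (?D x))\<^sup>2)"
    by (intro integrable_mu_cont continuous_intros)
  ultimately have "AE x in \<mu>. (cmod (?D x))\<^sup>2 = 0"
    by (subst (asm) integral_nonneg_eq_0_iff_AE) auto
  from AE_mu_imp[OF this] have z: "AE x in lborel. x \<in> {-pi..pi} \<longrightarrow> ?D x = 0"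
    by simp
  have "0 = (LBINT x:{-pi..pi}. ?D x * cis (- (real_of_int l * x)))"
    unfolding set_lebesgue_integral_def
    by (rule integral_eq_zero_AE[symmetric]) (use z in \<open>eventually_elim, auto split: split_indicator\<close>)
  also have "\<dots> = (LBINT x:{-pi..pi}. \<Sum>j\<in>F. d j * cis (real_of_int (j - l) * x))"
    by (intro set_lebesgue_integral_cong)
      (auto simp: sum_distrib_right mult.assoc cis_mult left_diff_distrib)
  also have "\<dots> = (\<Sum>j\<in>F. LBINT x:{-pi..pi}. d j * cis (real_of_int (j - l) * x))"
    unfolding set_lebesgue_integral_def scaleR_sum_right
    by (intro Bochner_Integration.integral_sum borel_integrable_compact continuous_intros) auto
  also have "\<dots> = (\<Sum>j\<in>F. d j * (if j = l then 2 * of_real pi else 0))"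
    by (intro sum.cong refl, subst set_integral_mult_right, subst integral_cis) simp
  also have "\<dots> = d l * (2 * of_real pi)"
    using F l by (simp add: if_distrib[of "\<lambda>c. _ * c"] sum.delta cong: if_cong)
  finally show ?thesis by simp
qed

lemma finite_tri: "finite {j. tri j n}"
  by (rule finite_subset[of _ "{-\<bar>n\<bar>..\<bar>n\<bar>}"]) (auto simp: tri_def)

text \<open>The difference of two candidates is a combination of lower exponentials that is
  orthogonal to all of them, hence zero. This is the uniqueness that the definite description in
  \<open>Ek\<close> asks for.\<close>

lemma Ek_eqI:
  assumes E: "\<And>z. E z = exp (of_int n * z) + (\<Sum>j\<in>{j. tri j n}. c j * exp (of_int j * z))"
    and orth: "\<And>j. tri j n \<Longrightarrow>
      inner_k k (\<lambda>x. E (\<i> * of_real x)) (ee j) = 0"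
  shows "Ek k n = E"
proof -
  let ?P = "\<lambda>E. \<exists>c :: int \<Rightarrow> complex.
      E = (\<lambda>z. exp (of_int n * z) + (\<Sum>j\<in>{j. tri j n}. c j * exp (of_int j * z))) \<and>
      (\<forall>j. tri j n \<longrightarrow> inner_k k (\<lambda>x. E (\<i> * of_real x)) (\<lambda>x. exp (\<i> * of_int j * of_real x)) = 0)"
  have P: "?P E"
    using E orth by (intro exI[of _ c]) (auto simp: cis_int_eq)
  have "E' = E" if "?P E'" for E'
  proof -
    from that obtain c' where E': "\<And>z. E' z = exp (of_int n * z) + (\<Sum>j\<in>{j. tri j n}. c' j * exp (of_int j * z))"
      and orth': "\<And>j. tri j n \<Longrightarrow>
        inner_k k (\<lambda>x. E' (\<i> * of_real x)) (ee j) = 0"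
      by (auto simp: cis_int_eq)
    have on_line: "E (\<i> * of_real x) = ee n x + (\<Sum>j\<in>{j. tri j n}. c j * ee j x)"
      "E' (\<i> * of_real x) = ee n x + (\<Sum>j\<in>{j. tri j n}. c' j * ee j x)"
      for x
      unfolding E E' by (simp_all add: cis_conv_exp mult_ac)
    have "c' l - c l = 0" if l: "tri l n" for l
    proof (rule exponentials_independent[OF finite_tri, of n "\<lambda>j. c' j - c j"])
      fix l assume "l \<in> {j. tri j n}"
      then have l: "tri l n" by simp
      have "inner_k k (\<lambda>x. \<Sum>j\<in>{j. tri j n}. (c' j - c j) * ee j x) (ee l)
        = inner_k k (\<lambda>x. E' (\<i> * of_real x) - E (\<i> * of_real x)) (ee l)"
        unfolding on_line by (simp add: left_diff_distrib sum_subtractf)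
      also have "\<dots> = inner_k k (\<lambda>x. E' (\<i> * of_real x)) (ee l)
         - inner_k k (\<lambda>x. E (\<i> * of_real x)) (ee l)"
        unfolding inner_k_def left_diff_distrib on_line
        by (intro Bochner_Integration.integral_diff integrable_mu_cont continuous_intros)
      finally show "inner_k k (\<lambda>x. \<Sum>j\<in>{j. tri j n}. (c' j - c j) * ee j x)
          (ee l) = 0"
        using orth[OF l] orth'[OF l] by simp
    qed (use l in simp)
    then show ?thesis unfolding fun_eq_iff E E' by (auto intro!: sum.cong)
  qed
  with P show ?thesis
    unfolding Ek_def by (intro the_equality)
qed

text \<open>The exponential coefficients of E_{-m}, extended by zero to all integers, with leading
  coefficient 1 at j = -m. The recursion is that of M_m read on exponents: multiplication by e^(-z)
  shifts j, while reflecting z and multiplying by e^z turns j into 1 - j.\<close>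

fun bc :: "nat \<Rightarrow> int \<Rightarrow> real" where
  "bc 0 j = (if j = 0 then 1 else 0)"
| "bc (Suc m) j = bc m (j + 1) + sz m * bc m (1 - j)"

lemma bc_supp: "bc m j \<noteq> 0 \<Longrightarrow> \<bar>j\<bar> \<le> int m \<and> even (int m - j)"
proof (induction m arbitrary: j)
  case (Suc m)
  then have "bc m (j + 1) \<noteq> 0 \<or> bc m (1 - j) \<noteq> 0" by auto
  then show ?case
  proof
    assume "bc m (j + 1) \<noteq> 0"
    from Suc.IH[OF this] show ?thesis by auto
  next
    assume "bc m (1 - j) \<noteq> 0"
    from Suc.IH[OF this] show ?thesis by auto
  qed
qed (auto split: if_splits)

lemma bc_lead: "bc m (- int m) = 1"
proof (induction m)
  case (Suc m)
  have "bc m (1 - (- int (Suc m))) = 0" using bc_supp[of m "1 - (- int (Suc m))"] by auto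
  moreover have "- int (Suc m) + 1 = - int m" by simp
  ultimately show ?case using Suc by (simp only: bc.simps)
qed simp

definition Mc :: "nat \<Rightarrow> complex \<Rightarrow> complex" where
  "Mc m z = (\<Sum>j\<in>{-int m..int m}. of_real (bc m j) * exp (of_int j * z))"

lemma Mc_superset:
  "finite A \<Longrightarrow> {-int m..int m} \<subseteq> A \<Longrightarrow> (\<Sum>j\<in>A. of_real (bc m j) * exp (of_int j * z)) = Mc m z"
  unfolding Mc_def by (rule sum.mono_neutral_right) (use bc_supp in force)+

lemma Mc_Suc: "Mc (Suc m) z = exp (- z) * Mc m z + of_real (sz m) * exp z * Mc m (- z)"
proof -
  let ?A = "{-int (Suc m)..int (Suc m)}"
  have "Mc (Suc m) z = (\<Sum>j\<in>?A. of_real (bc m (j + 1)) * exp (of_int j * z))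
      + (\<Sum>j\<in>?A. of_real (sz m) * (of_real (bc m (1 - j)) * exp (of_int j * z)))"
    unfolding Mc_def by (simp add: sum.distrib[symmetric] algebra_simps)
  also have "(\<Sum>j\<in>?A. of_real (bc m (j + 1)) * exp (of_int j * z))
      = (\<Sum>j\<in>{-int m..int m + 2}. exp (- z) * (of_real (bc m j) * exp (of_int j * z)))"
    by (rule sum.reindex_bij_witness[of _ "\<lambda>j. j - 1" "\<lambda>j. j + 1"])
      (auto simp: exp_add[symmetric] exp_diff[symmetric] exp_minus algebra_simps simp flip: exp_minus)
  also have "\<dots> = exp (- z) * Mc m z"
    by (simp only: sum_distrib_left[symmetric], subst Mc_superset) auto
  also have "(\<Sum>j\<in>?A. of_real (sz m) * (of_real (bc m (1 - j)) * exp (of_int j * z)))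
      = (\<Sum>j\<in>{-int m..int m + 2}. of_real (sz m) * exp z * (of_real (bc m j) * exp (of_int j * (- z))))"
    by (rule sum.reindex_bij_witness[of _ "\<lambda>j. 1 - j" "\<lambda>j. 1 - j"])
      (auto simp: exp_add[symmetric] algebra_simps)
  also have "\<dots> = of_real (sz m) * exp z * Mc m (- z)"
    by (simp only: sum_distrib_left[symmetric], subst Mc_superset) auto
  finally show ?thesis .
qed

lemma Mc_line: "Mc m (\<i> * of_real x) = Complex (R m x) (S m x)"
proof (induction m arbitrary: x)
  case 0
  show ?case by (simp add: Mc_def complex_eq_iff)
next
  case (Suc m)
  have e: "exp (\<i> * of_real x) = cis x" "exp (- (\<i> * of_real x)) = cis (- x)"
    by (simp_all add: cis_conv_exp)
  have neg: "Mc m (- (\<i> * of_real x)) = Complex (R m x) (- S m x)"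
    using Suc[of "- x"] by simp
  show ?case
    unfolding Mc_Suc Suc neg e by (simp add: complex_eq_iff R_Suc S_Suc algebra_simps)
qed

lemma Mc_0: "Mc m 0 = of_real (Gm m)"
proof -
  have "R m 0 = Gm m \<and> S m 0 = 0"
    by (induction m) (auto simp: Gm_def R_Suc S_Suc)
  then show ?thesis using Mc_line[of m 0] by (simp add: complex_eq_iff)
qed

lemma integral_Complex:
  assumes "integrable \<mu> a" "integrable \<mu> b"
  shows "(\<integral>x. Complex (a x) (b x) \<partial>\<mu>) = Complex (\<integral>x. a x \<partial>\<mu>) (\<integral>x. b x \<partial>\<mu>)"
proof -
  have "(\<integral>x. Complex (a x) (b x) \<partial>\<mu>) = (\<integral>x. complex_of_real (a x) + \<i> * complex_of_real (b x) \<partial>\<mu>)"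
    by (simp add: complex_eq_iff Complex_eq)
  also have "\<dots> = complex_of_real (\<integral>x. a x \<partial>\<mu>) + \<i> * complex_of_real (\<integral>x. b x \<partial>\<mu>)"
    using assms by (subst Bochner_Integration.integral_add) auto
  finally show ?thesis by (simp add: complex_eq_iff)
qed

text \<open>The exponential splits into the cosine and sine of |j|x, which lie in \<open>V n\<close>
  for n = |j| < m. The free weights a and b let one lemma serve E_{-m} and E_m, which combine R_m
  and S_m differently.\<close>

lemma RS_orth_cis:
  assumes j: "\<bar>j\<bar> < int m"
  shows "inner_k k (\<lambda>x. Complex (a * R m x) (b * S m x)) (ee j) = 0"
proof -
  define n where "n = nat \<bar>j\<bar>"
  define e :: real where "e = (if j \<ge> 0 then 1 else -1)"
  have c: "cos (real_of_int j * x) = cos (real n * x)" for x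
    by (cases "j \<ge> 0") (auto simp: n_def)
  have s: "sin (real_of_int j * x) = e * sin (real n * x)" for x
    by (cases "j \<ge> 0") (auto simp: n_def e_def)
  have nm: "n < m" using j by (auto simp: n_def)
  note o = V_orth[OF conjunct1[OF trig_in_V] nm] V_orth[OF conjunct2[OF trig_in_V] nm]
  have i: "integrable \<mu> (\<lambda>x. R m x * cos (real n * x))" "integrable \<mu> (\<lambda>x. R m x * sin (real n * x))"
    "integrable \<mu> (\<lambda>x. S m x * cos (real n * x))" "integrable \<mu> (\<lambda>x. S m x * sin (real n * x))"
    by (intro integrable_mu_cont continuous_intros)+
  have "inner_k k (\<lambda>x. Complex (a * R m x) (b * S m x)) (ee j)
    = (\<integral>x. Complex (a * (R m x * cos (real n * x)) + b * e * (S m x * sin (real n * x)))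
        (b * (S m x * cos (real n * x)) - a * e * (R m x * sin (real n * x))) \<partial>\<mu>)"
    unfolding inner_k_def
    by (intro Bochner_Integration.integral_cong) (auto simp: complex_eq_iff c s)
  also have "\<dots> = 0"
    using i o by (subst integral_Complex) (auto simp: complex_eq_iff)
  finally show ?thesis .
qed

text \<open>The product e^(ix) cnj M_m contains one step of the recursion with its factors 1 + sz
  and 1 - sz removed. Hence E_{m+1} lies in the same two-dimensional span of R_{m+1} and S_{m+1} as
  E_{-(m+1)}.\<close>

lemma Ek_pos_line: "exp (\<i> * of_real x) * Mc m (- (\<i> * of_real x))
    = Complex (1 / (1 + sz m) * R (Suc m) x) (- 1 / (1 - sz m) * S (Suc m) x)"
proof -
  have e: "exp (\<i> * of_real x) = cis x"
    by (simp_all add: cis_conv_exp)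
  have neg: "Mc m (- (\<i> * of_real x)) = Complex (R m x) (- S m x)"
    using Mc_line[of m "- x"] by simp
  have "1 / (1 + sz m) * R (Suc m) x = cos x * R m x + sin x * S m x"
    using sz_bounds[of m] by (simp add: R_Suc)
  moreover have "- 1 / (1 - sz m) * S (Suc m) x = sin x * R m x - cos x * S m x"
    using sz_bounds[of m] by (simp add: S_Suc divide_simps)
  ultimately show ?thesis
    unfolding e neg by (simp add: complex_eq_iff)
qed

text \<open>For n = m+1 > 0 the exponent -n is not below n in the order, and indeed the exponents
  here only run from -m+1 to m+1. Those of the wrong parity drop out because \<open>bc\<close>
  vanishes there.\<close>

lemma Ek_pos_expand:
  "exp z * Mc m (- z) = exp (of_int (int (Suc m)) * z)
     + (\<Sum>j\<in>{j. tri j (int (Suc m))}. of_real (bc m (1 - j)) * exp (of_int j * z))"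
proof -
  let ?A = "{-int m + 1..int m + 1}"
  have "exp z * Mc m (- z) = (\<Sum>j\<in>?A. of_real (bc m (1 - j)) * exp (of_int j * z))"
    unfolding Mc_def sum_distrib_left
    by (rule sum.reindex_bij_witness[of _ "\<lambda>j. 1 - j" "\<lambda>j. 1 - j"])
      (auto simp: exp_add[symmetric] algebra_simps)
  also have "\<dots> = of_real (bc m (- int m)) * exp (of_int (int m + 1) * z)
      + (\<Sum>j\<in>?A - {int m + 1}. of_real (bc m (1 - j)) * exp (of_int j * z))"
    by (subst sum.remove[of _ "int m + 1"]) auto
  also have "(\<Sum>j\<in>?A - {int m + 1}. of_real (bc m (1 - j)) * exp (of_int j * z))
     = (\<Sum>j\<in>{j. tri j (int (Suc m))}. of_real (bc m (1 - j)) * exp (of_int j * z))"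
  proof (rule sum.mono_neutral_right)
    show "{j. tri j (int (Suc m))} \<subseteq> ?A - {int m + 1}"
    proof
      fix x assume "x \<in> {j. tri j (int (Suc m))}"
      then have "\<bar>x\<bar> < int m + 1" "even (int m + 1 - \<bar>x\<bar>)" by (auto simp: tri_def)
      then show "x \<in> ?A - {int m + 1}" by (simp only: atLeastAtMost_iff Diff_iff singleton_iff) presburger
    qed
    show "\<forall>j\<in>?A - {int m + 1} - {j. tri j (int (Suc m))}. complex_of_real (bc m (1 - j)) * exp (of_int j * z) = 0"
    proof
      fix j assume j: "j \<in> ?A - {int m + 1} - {j. tri j (int (Suc m))}"
      have "bc m (1 - j) = 0"
      proof (rule ccontr)
        assume "bc m (1 - j) \<noteq> 0"
        from bc_supp[OF this] have "even (int m - (1 - j))" by simp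
        then have "even (int (Suc m) - \<bar>j\<bar>)" by (auto simp: abs_if)
        then have "tri j (int (Suc m))" using j by (auto simp: tri_def)
        then show False using j by simp
      qed
      then show "complex_of_real (bc m (1 - j)) * exp (of_int j * z) = 0" by simp
    qed
  qed auto
  finally show ?thesis by (simp add: bc_lead add.commute)
qed

lemma Ek_pos: "Ek k (int (Suc m)) = (\<lambda>z. exp z * Mc m (- z))"
proof (rule Ek_eqI[OF Ek_pos_expand])
  fix j assume "tri j (int (Suc m))"
  then have "\<bar>j\<bar> < int (Suc m)" by (auto simp: tri_def)
  then show "inner_k k (\<lambda>x. exp (\<i> * of_real x) * Mc m (- (\<i> * of_real x))) (ee j) = 0"
    unfolding Ek_pos_line by (rule RS_orth_cis)
qed

text \<open>In contrast to the positive case, for m > 0 the exponent m does lie below -m, so it is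
  one of the lower terms.\<close>

lemma Ek_neg_expand:
  "Mc m z = exp (of_int (- int m) * z)
     + (\<Sum>j\<in>{j. tri j (- int m)}. of_real (bc m j) * exp (of_int j * z))"
proof -
  let ?A = "{-int m..int m}"
  have "Mc m z = of_real (bc m (- int m)) * exp (of_int (- int m) * z)
      + (\<Sum>j\<in>?A - {- int m}. of_real (bc m j) * exp (of_int j * z))"
    unfolding Mc_def by (subst sum.remove[of _ "- int m"]) auto
  also have "(\<Sum>j\<in>?A - {- int m}. of_real (bc m j) * exp (of_int j * z))
     = (\<Sum>j\<in>{j. tri j (- int m)}. of_real (bc m j) * exp (of_int j * z))"
  proof (rule sum.mono_neutral_right)
    show "{j. tri j (- int m)} \<subseteq> ?A - {- int m}"
      by (auto simp: tri_def)
    show "\<forall>j\<in>?A - {- int m} - {j. tri j (- int m)}. complex_of_real (bc m j) * exp (of_int j * z) = 0"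
    proof
      fix j assume j: "j \<in> ?A - {- int m} - {j. tri j (- int m)}"
      have "bc m j = 0"
      proof (rule ccontr)
        assume "bc m j \<noteq> 0"
        from bc_supp[OF this] have "even (int m - j)" by simp
        then have "even (int m - \<bar>j\<bar>)" by (auto simp: abs_if)
        then have "tri j (- int m)" using j by (auto simp: tri_def)
        then show False using j by simp
      qed
      then show "complex_of_real (bc m j) * exp (of_int j * z) = 0" by simp
    qed
  qed auto
  finally show ?thesis by (simp add: bc_lead)
qed

text \<open>The top exponential is traded for \<open>E\<^sub>m\<close>, which differs from it by exponentials of lower degree.\<close>

lemma Mc_orth_top:
  "inner_k k (\<lambda>x. Mc (Suc m) (\<i> * of_real x)) (ee (int (Suc m))) = 0"
proof -
  let ?C = "\<lambda>x. Complex (1 / (1 + sz m) * (R (Suc m) x * R (Suc m) x) - 1 / (1 - sz m) * (S (Suc m) x * S (Suc m) x))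
         (1 / (1 - sz m) * (R (Suc m) x * S (Suc m) x) + 1 / (1 + sz m) * (R (Suc m) x * S (Suc m) x))"
  let ?T = "{j. tri j (int (Suc m))}"
  let ?M = "\<lambda>x. Mc (Suc m) (\<i> * of_real x)"
  have cM: "continuous_on A ?M" for A :: "real set"
    unfolding Mc_def by (intro continuous_intros)
  have top: "ee (int (Suc m)) x
      = Complex (1 / (1 + sz m) * R (Suc m) x) (- 1 / (1 - sz m) * S (Suc m) x)
        - (\<Sum>j\<in>?T. of_real (bc m (1 - j)) * ee j x)" for x
    using Ek_pos_expand[of "\<i> * of_real x" m] unfolding Ek_pos_line
    by (simp add: cis_conv_exp mult_ac)
  have "inner_k k ?M (ee (int (Suc m)))
    = (\<integral>x. ?C x
        - (\<Sum>j\<in>?T. of_real (bc m (1 - j)) * (?M x * cnj (ee j x))) \<partial>\<mu>)"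
    unfolding inner_k_def top
    by (intro Bochner_Integration.integral_cong refl)
      (simp add: Mc_line complex_eq_iff sum_distrib_left sum_subtractf algebra_simps)
  also have "\<dots> = (\<integral>x. ?C x \<partial>\<mu>)
        - (\<integral>x. (\<Sum>j\<in>?T. of_real (bc m (1 - j)) * (?M x * cnj (ee j x))) \<partial>\<mu>)"
    unfolding Complex_eq
    by (intro Bochner_Integration.integral_diff integrable_mu_cont continuous_intros cM)
  also have "(\<integral>x. (\<Sum>j\<in>?T. of_real (bc m (1 - j)) * (?M x * cnj (ee j x))) \<partial>\<mu>)
     = (\<Sum>j\<in>?T. \<integral>x. of_real (bc m (1 - j)) * (?M x * cnj (ee j x)) \<partial>\<mu>)"
    by (intro Bochner_Integration.integral_sum integrable_mu_cont continuous_intros cM)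
  also have "\<dots> = 0"
  proof (rule sum.neutral, rule ballI)
    fix j assume "j \<in> ?T"
    then have "\<bar>j\<bar> < int (Suc m)" by (auto simp: tri_def)
    from RS_orth_cis[OF this, of 1 1]
    show "(\<integral>x. complex_of_real (bc m (1 - j)) * (?M x * cnj (ee j x)) \<partial>\<mu>) = 0"
      by (simp add: inner_k_def Mc_line)
  qed
  also have "(\<integral>x. ?C x \<partial>\<mu>)
     = Complex (nR (Suc m) / (1 + sz m) - nS (Suc m) / (1 - sz m)) 0"
    by (subst integral_Complex) (auto simp: nR_def nS_def RS_orth)
  also have "\<dots> = 0"
    using sz_bounds[of m] by (simp add: nR_nS_hn_Suc(1,2) complex_eq_iff) (simp add: divide_simps algebra_simps)
  finally show ?thesis by simp
qed

lemma Ek_neg: "Ek k (- int m) = Mc m"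
proof (rule Ek_eqI[OF Ek_neg_expand])
  fix j assume t: "tri j (- int m)"
  show "inner_k k (\<lambda>x. Mc m (\<i> * of_real x)) (ee j) = 0"
  proof (cases "\<bar>j\<bar> < int m")
    case True
    from RS_orth_cis[OF this, of 1 1] show ?thesis by (simp add: Mc_line)
  next
    case False
    with t have "j = int m" "0 < m" by (auto simp: tri_def)
    then obtain i where "m = Suc i" "j = int (Suc i)" by (cases m) auto
    then show ?thesis using Mc_orth_top[of i] by simp
  qed
qed

lemma calE_neg: "calE k (- int m) x = Complex (R m x) (S m x) / of_real (Gm m)"
  by (simp add: calE_def Ek_neg Mc_line Mc_0)

lemma calE_pos: "calE k (int (Suc m)) x
    = Complex (1 / (1 + sz m) * R (Suc m) x) (- 1 / (1 - sz m) * S (Suc m) x) / of_real (Gm m)"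
  unfolding calE_def Ek_pos Ek_pos_line by (simp add: Mc_0)

section \<open>The maximum principle\<close>

lemma cis_reduce:
  obtains x' where "x' \<in> {-pi..pi}" "cis x' = cis x"
proof
  show "Arg (cis x) \<in> {-pi..pi}" using Arg_bounded[of "cis x"] by auto
  show "cis (Arg (cis x)) = cis x" by (simp add: cis_Arg)
qed

text \<open>The harmonic extension \<open>u\<close> solves
  \<open>u\<^sub>t\<^sub>t - 2k u\<^sub>t + u\<^sub>x\<^sub>x + 2k cot x u\<^sub>x = k (u(x) - u(-x)) / sin\<^sup>2 x\<close>; the next two identities are this
  equation for a single mode, cleared of the singularities at \<open>sin x = 0\<close>.\<close>

lemma mode_equation:
  "(sin x)\<^sup>2 * ((a * (2 * k + real m) * (cos x * Q m x + sin x * (sin x * W m x))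
        + b * (2 * k * sin x * Q m x - 2 * k * cos x * (sin x * W m x) - real m * ((2 * k + real m) * S m x)))
      + real m * real m * (a * R m x + b * S m x) - 2 * k * (- real m * (a * R m x + b * S m x)))
    + 2 * k * cos x * sin x * (a * ((2 * k + real m) * S m x) + b * (- 2 * k * cos x * Q m x - real m * R m x))
   = 2 * k * (b * S m x)"
  using W_relation[of x m] sin_cos_squared_add[of x] unfolding S_def by algebra

lemma mode_equation_sin0:
  assumes "sin x = 0"
  shows "(1 + 2 * k) * (a * (2 * k + real m) * (cos x * Q m x + sin x * (sin x * W m x))
        + b * (2 * k * sin x * Q m x - 2 * k * cos x * (sin x * W m x) - real m * ((2 * k + real m) * S m x)))
      + real m * real m * (a * R m x + b * S m x) - 2 * k * (- real m * (a * R m x + b * S m x)) = 0"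
  using W_relation[of x m] assms unfolding S_def by algebra

text \<open>The sum is the harmonic extension u at radius r = e^(-t). Subtracting \<epsilon> s makes
  the inequality strict: at an interior maximum u_t = \<epsilon> and u_x = 0, while u_tt and u_xx
  are at most 0 and the reflection term is nonnegative, so the two sides of the mode equation have
  incompatible signs. The maximum therefore sits at t = 0, where u <= c.\<close>

lemma poisson_maximum_principle:
  assumes c: "\<And>x. (\<Sum>m\<le>N. A m * R m x + B m * S m x) \<le> c" and t: "0 \<le> t"
  shows "(\<Sum>m\<le>N. exp (- (real m * t)) * (A m * R m x + B m * S m x)) \<le> c"
proof -
  let ?y = "\<lambda>m x. A m * R m x + B m * S m x"
  define u where "u = (\<lambda>t x. \<Sum>m\<le>N. exp (- (real m * t)) * (?y m x))"
  define K where "K = (\<Sum>m\<le>N. (\<bar>A m\<bar> + \<bar>B m\<bar>) * Gm m)"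
  have K: "\<bar>u t x\<bar> \<le> K" if "0 \<le> t" for t x
  proof -
    have "\<bar>u t x\<bar> \<le> (\<Sum>m\<le>N. \<bar>exp (- (real m * t)) * (?y m x)\<bar>)"
      unfolding u_def by (rule sum_abs)
    also have "\<dots> \<le> K" unfolding K_def
    proof (rule sum_mono)
      fix m
      have "\<bar>?y m x\<bar> \<le> \<bar>A m\<bar> * \<bar>R m x\<bar> + \<bar>B m\<bar> * \<bar>S m x\<bar>"
        by (metis abs_mult abs_triangle_ineq)
      also have "\<dots> \<le> \<bar>A m\<bar> * Gm m + \<bar>B m\<bar> * Gm m"
        by (intro add_mono mult_left_mono R_le S_le) auto
      finally have "1 * \<bar>?y m x\<bar> \<le> (\<bar>A m\<bar> + \<bar>B m\<bar>) * Gm m"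
        by (simp add: distrib_right)
      moreover have "exp (- (real m * t)) * \<bar>?y m x\<bar> \<le> 1 * \<bar>?y m x\<bar>"
        using that by (intro mult_right_mono) auto
      ultimately show "\<bar>exp (- (real m * t)) * (?y m x)\<bar> \<le> (\<bar>A m\<bar> + \<bar>B m\<bar>) * Gm m"
        by (simp add: abs_mult)
    qed
    finally show ?thesis .
  qed
  have u_cis: "u t x = u t x'" if "cis x = cis x'" for t x x'
    using that by (simp add: u_def R_def S_cis)
  have "u t x \<le> c + e" if e: "0 < e" for e
  proof -
    define \<epsilon> where "\<epsilon> = e / (t + 1)"
    have \<epsilon>: "0 < \<epsilon>" "\<epsilon> * t \<le> e" using e t by (auto simp: \<epsilon>_def field_simps)
    \<comment> \<open>With this T the perturbed function at time T lies below its value at (0, 0),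
      which rules out the far boundary.\<close>
    define T where "T = t + 1 + 2 * K / \<epsilon>"
    have K0: "0 \<le> K" using K[of 0 0] by simp
    have T: "t < T" "K - \<epsilon> * T < - K" using \<epsilon>(1) K0 t by (auto simp: T_def field_simps add_pos_nonneg)
    let ?v = "\<lambda>(s, y). u s y - \<epsilon> * s"
    have "\<exists>z\<in>{0..T} \<times> {-pi..pi}. \<forall>w\<in>{0..T} \<times> {-pi..pi}. ?v w \<le> ?v z"
    proof (rule continuous_attains_sup)
      show "compact ({0..T} \<times> {-pi..pi})" by (intro compact_Times compact_Icc)
      show "{0..T} \<times> {-pi..pi} \<noteq> {}" using T t by auto
      show "continuous_on ({0..T} \<times> {-pi..pi}) ?v"
        unfolding u_def case_prod_beta by (intro continuous_intros)
    qed
    then obtain t0 x0 where t0: "t0 \<in> {0..T}" and x0: "x0 \<in> {-pi..pi}"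
      and max0: "\<And>s y. s \<in> {0..T} \<Longrightarrow> y \<in> {-pi..pi} \<Longrightarrow> u s y - \<epsilon> * s \<le> u t0 x0 - \<epsilon> * t0"
      by fastforce
    \<comment> \<open>Periodicity extends the maximum over [-pi, pi] to all real y, so x0 counts as
      an interior maximum in x even if it is an endpoint.\<close>
    have max: "u s y - \<epsilon> * s \<le> u t0 x0 - \<epsilon> * t0" if "s \<in> {0..T}" for s y
      using max0[OF that] cis_reduce[of y] u_cis by metis
    have "t0 \<noteq> T"
    proof
      assume "t0 = T"
      then have "u 0 0 \<le> u T x0 - \<epsilon> * T" using max[of 0 0] t T by simp
      also have "\<dots> \<le> K - \<epsilon> * T" using K[of T x0] t T by simp
      also have "\<dots> < - K" by (rule T)
      finally show False using K[of 0 0] by simp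
    qed
    have "t0 = 0"
    proof (rule ccontr)
      assume "t0 \<noteq> 0"
      then have t0': "0 < t0" "t0 < T" using t0 \<open>t0 \<noteq> T\<close> by auto
      define a where "a m = exp (- (real m * t0)) * A m" for m
      define b where "b m = exp (- (real m * t0)) * B m" for m
      define ut where "ut = (\<Sum>m\<le>N. - real m * (a m * R m x0 + b m * S m x0))"
      define utt where "utt = (\<Sum>m\<le>N. real m * real m * (a m * R m x0 + b m * S m x0))"
      define ux where "ux = (\<Sum>m\<le>N. a m * ((2 * k + real m) * S m x0)
          + b m * (- 2 * k * cos x0 * Q m x0 - real m * R m x0))"
      define uxx where "uxx = (\<Sum>m\<le>N. a m * (2 * k + real m) * (cos x0 * Q m x0 + sin x0 * (sin x0 * W m x0))
        + b m * (2 * k * sin x0 * Q m x0 - 2 * k * cos x0 * (sin x0 * W m x0) - real m * ((2 * k + real m) * S m x0)))"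
      have 1: "ut = \<epsilon>" "utt \<le> 0"
      proof -
        let ?g = "\<lambda>s. \<Sum>m\<le>N. - real m * exp (- (real m * s)) * (?y m x0)"
        have d1: "((\<lambda>s. u s x0 - \<epsilon> * s) has_real_derivative ?g s - \<epsilon>) (at s)" for s
          unfolding u_def by (auto intro!: derivative_eq_intros sum.cong simp: algebra_simps)
        have d2: "((\<lambda>s. ?g s - \<epsilon>) has_real_derivative
            (\<Sum>m\<le>N. real m * real m * exp (- (real m * t0)) * (?y m x0))) (at t0)"
          by (auto intro!: derivative_eq_intros sum.cong simp: algebra_simps)
        have d3: "0 < min t0 (T - t0)" using t0' by auto
        have d4: "u s x0 - \<epsilon> * s \<le> u t0 x0 - \<epsilon> * t0" if "\<bar>t0 - s\<bar> < min t0 (T - t0)" for s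
          using that by (intro max) auto
        have *: "?g t0 - \<epsilon> = 0"
          "(\<Sum>m\<le>N. real m * real m * exp (- (real m * t0)) * (?y m x0)) \<le> 0"
          using second_deriv_at_max[OF d1 d2 d3 d4] by blast+
        have "ut = ?g t0" "utt = (\<Sum>m\<le>N. real m * real m * exp (- (real m * t0)) * (?y m x0))"
          unfolding ut_def utt_def a_def b_def by (auto intro!: sum.cong simp: algebra_simps)
        then show "ut = \<epsilon>" "utt \<le> 0" using * by auto
      qed
      have 2: "ux = 0" "uxx \<le> 0"
      proof -
        have u: "u t0 = (\<lambda>y. \<Sum>m\<le>N. a m * R m y + b m * S m y)"
          unfolding u_def a_def b_def by (auto intro!: sum.cong simp: algebra_simps)
        have d1: "(u t0 has_real_derivative (\<Sum>m\<le>N. a m * ((2 * k + real m) * S m y)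
            + b m * (- 2 * k * cos y * Q m y - real m * R m y))) (at y)" for y
          unfolding u by (auto intro!: derivative_eq_intros R_deriv S_deriv sum.cong simp: algebra_simps)
        have d2: "((\<lambda>y. \<Sum>m\<le>N. a m * ((2 * k + real m) * S m y)
            + b m * (- 2 * k * cos y * Q m y - real m * R m y)) has_real_derivative uxx) (at x0)"
          unfolding uxx_def S_def
          by (auto intro!: derivative_eq_intros R_deriv Q_deriv sum.cong simp: S_def algebra_simps)
        have d3: "u t0 y \<le> u t0 x0" for y using max[OF t0, of y] by simp
        show "ux = 0" "uxx \<le> 0"
          unfolding ux_def using second_deriv_at_max[OF d1 d2 zero_less_one d3] by blast+
      qed
      \<comment> \<open>Comparing the maximum at x0 with the value at -x0 gives the nonlocal
        reflection term its sign.\<close>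
      have \<sigma>: "0 \<le> (\<Sum>m\<le>N. b m * S m x0)"
      proof -
        have "u t0 (- x0) \<le> u t0 x0" using max[OF t0, of "- x0"] by simp
        moreover have "u t0 x0 - u t0 (- x0) = 2 * (\<Sum>m\<le>N. b m * S m x0)"
          unfolding u_def sum_subtractf[symmetric] sum_distrib_left
          by (intro sum.cong) (auto simp: b_def algebra_simps)
        ultimately show ?thesis by simp
      qed
      show False
      proof (cases "sin x0 = 0")
        case False
        have "(sin x0)\<^sup>2 * (uxx + utt - 2 * k * ut) + 2 * k * cos x0 * sin x0 * ux
            = 2 * k * (\<Sum>m\<le>N. b m * S m x0)"
          unfolding ux_def uxx_def ut_def utt_def sum_distrib_left sum_subtractf[symmetric] sum.distrib[symmetric]
          by (intro sum.cong refl mode_equation)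
        moreover have "uxx + utt - 2 * k * ut < 0"
          using 1 2 mult_pos_pos[OF k_pos \<epsilon>(1)] by simp
        then have "(sin x0)\<^sup>2 * (uxx + utt - 2 * k * ut) < 0"
          using False by (simp add: mult_less_0_iff)
        moreover have "0 \<le> 2 * k * (\<Sum>m\<le>N. b m * S m x0)"
          using \<sigma> k_pos by simp
        ultimately show False using 2 by simp
      next
        \<comment> \<open>Where sin x0 = 0 the limit form of the equation takes over: u_xx acquires
          the factor 1 + 2k and the reflection term disappears.\<close>
        case True
        have "(1 + 2 * k) * uxx + utt - 2 * k * ut = (\<Sum>m\<le>N. 0)"
          unfolding uxx_def ut_def utt_def sum_distrib_left sum_subtractf[symmetric] sum.distrib[symmetric]
          by (intro sum.cong refl mode_equation_sin0 True)
        moreover have "(1 + 2 * k) * uxx \<le> 0" using 2 k_pos by (simp add: mult_le_0_iff)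
        ultimately show False using 1 mult_pos_pos[OF k_pos \<epsilon>(1)] by simp
      qed
    qed
    have "u t x - \<epsilon> * t \<le> u 0 x0" using max[of t x] t T \<open>t0 = 0\<close> by simp
    also have "\<dots> \<le> c" using c[of x0] by (simp add: u_def)
    finally show ?thesis using \<epsilon> by simp
  qed
  then show ?thesis unfolding u_def by (rule field_le_epsilon)
qed

section \<open>The Poisson kernel\<close>

text \<open>At \<open>n = 0\<close> the second summand is the junk value \<open>0 / 0 = 0\<close>, as it should be.\<close>

definition Zk :: "nat \<Rightarrow> real \<Rightarrow> real \<Rightarrow> real" where
  "Zk n x y = R n x * R n y / nR n + S n x * S n y / nS n"

lemma Zk_sym: "Zk n x y = Zk n y x"
  by (simp add: Zk_def mult.commute)

lemma Zk_measurable [measurable]: "(\<lambda>(x, y). Zk n x y) \<in> borel_measurable (borel \<Otimes>\<^sub>M borel)"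
  unfolding Zk_def by measurable

text \<open>This is (2k+1)_n / n!, the Taylor coefficient of (1 - r)^(-(2k+1)), which grows like
  n^(2k).\<close>

definition \<beta> :: "nat \<Rightarrow> real" where
  "\<beta> n = (-1) ^ n * ((- (2 * k + 1)) gchoose n)"

lemma \<beta>_Suc: "\<beta> (Suc n) = \<beta> n * ((2 * k + 1 + real n) / (real n + 1))"
proof -
  have "(- (2 * k + 1)) gchoose Suc n = ((- (2 * k + 1)) gchoose n) * (- ((2 * k + 1 + real n) / (real n + 1)))"
    by (simp add: gbinomial_prod_rev divide_simps) (simp add: algebra_simps)
  then show ?thesis by (simp only: \<beta>_def power_Suc)
qed

lemma \<beta>_pos: "0 < \<beta> n"
proof (induction n)
  case (Suc n)
  then show ?case unfolding \<beta>_Suc using k_pos by (intro mult_pos_pos divide_pos_pos) auto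
qed (simp add: \<beta>_def)

lemma \<beta>_sums:
  assumes "\<bar>r\<bar> < 1"
  shows "(\<lambda>n. r ^ n * \<beta> n) sums (1 - r) powr - (2 * k + 1)"
  using gen_binomial_real[of "- r" "- (2 * k + 1)"] assms
  by (simp add: \<beta>_def power_minus[of r] mult_ac)

text \<open>The left side is the squared value at 0 of the normalised E_{-n}. One step multiplies it
  by (1 + sz)^2 / (1 - sz^2) = (1 + sz) / (1 - sz), the same ratio as for \<beta>. This is the
  origin of the exponent 2k+1.\<close>

lemma Gm_hn: "(Gm n)\<^sup>2 / hn n = \<beta> n / hn 0"
proof (induction n)
  case 0
  then show ?case by (simp add: Gm_def \<beta>_def)
next
  case (Suc n)
  have s: "0 < 1 + sz n" "0 < 1 - sz n" using sz_bounds[of n] by auto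
  have e: "(1 + sz n) / (1 - sz n) = (2 * k + 1 + real n) / (real n + 1)"
    using Suc_sz[of n] s by (simp add: field_simps)
  have f: "1 - (sz n)\<^sup>2 = (1 + sz n) * (1 - sz n)"
    by (simp add: power2_eq_square algebra_simps)
  have "(Gm (Suc n))\<^sup>2 / hn (Suc n) = ((Gm n)\<^sup>2 / hn n) * ((1 + sz n) / (1 - sz n))"
    unfolding Gm_Suc nR_nS_hn_Suc(3) f using s hn_pos[of n]
    by (simp add: power2_eq_square divide_simps)
  then show ?case by (simp add: Suc e \<beta>_Suc)
qed

definition CZ :: real where "CZ = 4 * (1 + k) / hn 0"

lemma CZ_pos: "0 < CZ"
  using k_pos hn_pos[of 0] by (simp add: CZ_def)

text \<open>The factor 1 + k bounds 1 / (1 - sz m), which is largest at m = 0, and so compares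
  \<open>nR\<close> and \<open>nS\<close> with half of \<open>hn\<close>; the two summands then
  account for the 4 in \<open>CZ\<close>. The form in z and w is the one required by the Weierstrass
  test on the circle.\<close>

lemma Zk_bound_Rp:
  assumes "cmod z = 1" "cmod w = 1"
  shows "\<bar>Rp n z * Rp n w / nR n + Sp n z * Sp n w / nS n\<bar> \<le> CZ * \<beta> n"
proof -
  let ?b = "(Gm n * Gm n) * (2 * (1 + k) / hn n)"
  have inv: "1 / nR n \<le> 2 * (1 + k) / hn n" "1 / nS n \<le> 2 * (1 + k) / hn n"
  proof -
    have h: "0 < hn n" by (rule hn_pos)
    show "1 / nR n \<le> 2 * (1 + k) / hn n"
    proof (cases n)
      case 0
      then show ?thesis using h k_pos by (simp add: hn_0 divide_right_mono)
    next
      case (Suc m)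
      have "2 * 1 \<le> (2 + k * 2) * (1 + sz m)"
        using k_pos sz_bounds[of m] by (intro mult_mono) auto
      then show ?thesis using h sz_bounds[of m] k_pos
        by (simp add: Suc nR_nS_hn_Suc(1) divide_simps) (simp add: algebra_simps)
    qed
    show "1 / nS n \<le> 2 * (1 + k) / hn n"
    proof (cases n)
      case 0
      then show ?thesis using h k_pos by simp
    next
      case (Suc m)
      have "1 \<le> (1 + k) * (1 - sz m)"
        using k_pos by (simp add: sz_def divide_simps) (simp add: algebra_simps)
      then have "2 \<le> 2 * (1 + k) * (1 - sz m)" by (simp add: algebra_simps)
      then have "hn n * 2 \<le> hn n * (2 * (1 + k) * (1 - sz m))" using h by simp
      then show ?thesis using h sz_bounds[of m] k_pos
        unfolding Suc nR_nS_hn_Suc(2) by (simp add: divide_simps)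
    qed
  qed
  have nn: "0 \<le> 1 / nR n" "0 \<le> 1 / nS n"
    using nR_pos[of n] nS_pos[of n] by (cases "n = 0"; simp add: less_imp_le)+
  have a: "\<bar>Rp n z * Rp n w / nR n\<bar> \<le> ?b"
  proof -
    have "\<bar>Rp n z * Rp n w / nR n\<bar> = (\<bar>Rp n z\<bar> * \<bar>Rp n w\<bar>) * (1 / nR n)"
      using nn(1) by (simp add: abs_mult)
    also have "\<dots> \<le> ?b"
      using Rp_Sp_le[OF assms(1), of n] Rp_Sp_le[OF assms(2), of n] Gm_pos[of n] inv nn
      by (intro mult_mono) auto
    finally show ?thesis .
  qed
  have b: "\<bar>Sp n z * Sp n w / nS n\<bar> \<le> ?b"
  proof -
    have "\<bar>Sp n z * Sp n w / nS n\<bar> = (\<bar>Sp n z\<bar> * \<bar>Sp n w\<bar>) * (1 / nS n)"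
      using nn(2) by (simp add: abs_mult)
    also have "\<dots> \<le> ?b"
      using Rp_Sp_le[OF assms(1), of n] Rp_Sp_le[OF assms(2), of n] Gm_pos[of n] inv nn
      by (intro mult_mono) auto
    finally show ?thesis .
  qed
  have "\<bar>Rp n z * Rp n w / nR n + Sp n z * Sp n w / nS n\<bar>
      \<le> \<bar>Rp n z * Rp n w / nR n\<bar> + \<bar>Sp n z * Sp n w / nS n\<bar>"
    by (rule abs_triangle_ineq)
  also have "\<dots> \<le> ?b + ?b"
    by (rule add_mono[OF a b])
  also have "\<dots> = 4 * (1 + k) * ((Gm n)\<^sup>2 / hn n)"
    by (simp add: power2_eq_square)
  also have "\<dots> = CZ * \<beta> n"
    unfolding Gm_hn CZ_def by simp
  finally show ?thesis .
qed

lemma Zk_bound: "\<bar>Zk n x y\<bar> \<le> CZ * \<beta> n"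
  using Zk_bound_Rp[of "cis x" "cis y" n] by (simp add: Zk_def R_def S_cis)

lemma Zk_integrable:
  fixes u :: "real \<Rightarrow> 'a::{banach, second_countable_topology}"
  assumes "integrable \<mu> u"
  shows "integrable \<mu> (\<lambda>y. Zk n x y *\<^sub>R u y)"
proof (rule Bochner_Integration.integrable_bound)
  show "integrable \<mu> (\<lambda>y. (CZ * \<beta> n) *\<^sub>R u y)" using assms by simp
  have [measurable]: "u \<in> borel_measurable \<mu>" using assms by simp
  show "(\<lambda>y. Zk n x y *\<^sub>R u y) \<in> borel_measurable \<mu>" by measurable
  show "AE y in \<mu>. norm (Zk n x y *\<^sub>R u y) \<le> norm ((CZ * \<beta> n) *\<^sub>R u y)"
    using Zk_bound[of n x] CZ_pos \<beta>_pos[of n] by (auto intro!: mult_right_mono)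
qed

lemma Zk_reproducing:
  "(\<integral>y. Zk n x y * R m y \<partial>\<mu>) = (if n = m then R m x else 0)"
  "(\<integral>y. Zk n x y * S m y \<partial>\<mu>) = (if n = m then S m x else 0)"
proof -
  have "(\<integral>y. Zk n x y * R m y \<partial>\<mu>)
     = (\<integral>y. (R n x / nR n) * (R n y * R m y) + (S n x / nS n) * (S n y * R m y) \<partial>\<mu>)"
    by (intro Bochner_Integration.integral_cong) (auto simp: Zk_def algebra_simps)
  also have "\<dots> = (R n x / nR n) * (\<integral>y. R n y * R m y \<partial>\<mu>)"
    by (subst Bochner_Integration.integral_add) (auto simp: RS_orth)
  also have "\<dots> = (if n = m then R m x else 0)"
    using nR_pos[of n] by (auto simp: R_orth nR_def)
  finally show "(\<integral>y. Zk n x y * R m y \<partial>\<mu>) = (if n = m then R m x else 0)" .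
  have "(\<integral>y. Zk n x y * S m y \<partial>\<mu>)
     = (\<integral>y. (R n x / nR n) * (R n y * S m y) + (S n x / nS n) * (S n y * S m y) \<partial>\<mu>)"
    by (intro Bochner_Integration.integral_cong) (auto simp: Zk_def algebra_simps)
  also have "\<dots> = (S n x / nS n) * (\<integral>y. S n y * S m y \<partial>\<mu>)"
    by (subst Bochner_Integration.integral_add) (auto simp: RS_orth)
  also have "\<dots> = (if n = m then S m x else 0)"
    using nS_pos[of n] by (cases "n = 0") (auto simp: S_orth nS_def)
  finally show "(\<integral>y. Zk n x y * S m y \<partial>\<mu>) = (if n = m then S m x else 0)" .
qed

definition Pk :: "real \<Rightarrow> real \<Rightarrow> real \<Rightarrow> real" where
  "Pk r x y = (\<Sum>n. r ^ n * Zk n x y)"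

lemma Pk_measurable [measurable]: "(\<lambda>(x, y). Pk r x y) \<in> borel_measurable (borel \<Otimes>\<^sub>M borel)"
  unfolding Pk_def by measurable

lemma Pk_sym: "Pk r x y = Pk r y x"
  by (simp add: Pk_def Zk_sym[of _ x y])

lemma Pk_term_bound: "0 \<le> r \<Longrightarrow> \<bar>r ^ n * Zk n x y\<bar> \<le> CZ * (r ^ n * \<beta> n)"
  using mult_left_mono[OF Zk_bound[of n x y], of "r ^ n"] by (simp add: abs_mult mult_ac)

lemma summable_beta: "0 \<le> r \<Longrightarrow> r < 1 \<Longrightarrow> summable (\<lambda>n. CZ * (r ^ n * \<beta> n))"
  using \<beta>_sums[of r] by (intro summable_mult) (auto simp: sums_iff)

lemma Pk_summable: "0 \<le> r \<Longrightarrow> r < 1 \<Longrightarrow> summable (\<lambda>n. \<bar>r ^ n * Zk n x y\<bar>)"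
  by (rule summable_comparison_test'[OF summable_beta[of r], of 0]) (use Pk_term_bound in auto)

abbreviation L1 :: "(real \<Rightarrow> 'a::real_normed_vector) \<Rightarrow> real" where
  "L1 u \<equiv> \<integral>y. norm (u y) \<partial>\<mu>"

abbreviation Pop :: "real \<Rightarrow> (real \<Rightarrow> 'a::{banach, second_countable_topology}) \<Rightarrow> real \<Rightarrow> 'a" where
  "Pop r u x \<equiv> \<integral>y. Pk r x y *\<^sub>R u y \<partial>\<mu>"

lemma Pk_integral:
  fixes u :: "real \<Rightarrow> 'a::{banach, second_countable_topology}"
  assumes r: "0 \<le> r" "r < 1" and u: "integrable \<mu> u"
  shows "(\<lambda>n. r ^ n *\<^sub>R (\<integral>y. Zk n x y *\<^sub>R u y \<partial>\<mu>)) sums Pop r u x"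
    and "integrable \<mu> (\<lambda>y. Pk r x y *\<^sub>R u y)"
proof -
  let ?f = "\<lambda>n y. (r ^ n * Zk n x y) *\<^sub>R u y"
  have i: "integrable \<mu> (?f n)" for n
    unfolding scaleR_scaleR[symmetric] by (intro integrable_scaleR_right Zk_integrable u)
  have su: "summable (\<lambda>n. norm (?f n y))" for y
    using summable_mult2[OF Pk_summable[OF r, of x y], of "norm (u y)"] by simp
  have si: "summable (\<lambda>n. \<integral>y. norm (?f n y) \<partial>\<mu>)"
  proof (rule summable_comparison_test'[of "\<lambda>n. CZ * (r ^ n * \<beta> n) * L1 u" 0])
    show "summable (\<lambda>n. CZ * (r ^ n * \<beta> n) * L1 u)"
      by (intro summable_mult2 summable_beta r)
    fix n :: nat
    have "norm (\<integral>y. norm (?f n y) \<partial>\<mu>) = (\<integral>y. norm (?f n y) \<partial>\<mu>)" by simp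
    also have "\<dots> \<le> (\<integral>y. CZ * (r ^ n * \<beta> n) * norm (u y) \<partial>\<mu>)"
    proof (rule integral_mono)
      show "integrable \<mu> (\<lambda>y. norm (?f n y))" by (intro integrable_norm i)
      show "integrable \<mu> (\<lambda>y. CZ * (r ^ n * \<beta> n) * norm (u y))" using u by simp
      show "norm (?f n y) \<le> CZ * (r ^ n * \<beta> n) * norm (u y)" for y
        using Pk_term_bound[OF r(1), of n x y] by (simp add: mult_right_mono del: abs_mult)
    qed
    also have "\<dots> = CZ * (r ^ n * \<beta> n) * L1 u" by simp
    finally show "norm (\<integral>y. norm (?f n y) \<partial>\<mu>) \<le> CZ * (r ^ n * \<beta> n) * L1 u" .
  qed
  have eq: "(\<Sum>n. ?f n y) = Pk r x y *\<^sub>R u y" for y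
    unfolding Pk_def using Pk_summable[OF r, of x y]
    by (intro suminf_scaleR_left[symmetric]) (auto dest: summable_rabs_cancel)
  show "integrable \<mu> (\<lambda>y. Pk r x y *\<^sub>R u y)"
    using integrable_suminf[OF i _ si] su by (simp add: eq)
  have "(\<lambda>n. \<integral>y. ?f n y \<partial>\<mu>) sums Pop r u x"
    using sums_integral[OF i _ si] su by (simp add: eq)
  then show "(\<lambda>n. r ^ n *\<^sub>R (\<integral>y. Zk n x y *\<^sub>R u y \<partial>\<mu>)) sums Pop r u x"
    by (simp flip: scaleR_scaleR)
qed

lemma Pk_reproducing:
  assumes r: "0 \<le> r" "r < 1"
  shows "(\<integral>y. Pk r x y * R m y \<partial>\<mu>) = r ^ m * R m x" "(\<integral>y. Pk r x y * S m y \<partial>\<mu>) = r ^ m * S m x"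
proof -
  have i: "integrable \<mu> (R m)" "integrable \<mu> (S m)"
    by (auto intro!: integrable_mu_cont continuous_intros)
  have "(\<lambda>n. if n = m then r ^ m * R m x else 0) sums (\<integral>y. Pk r x y * R m y \<partial>\<mu>)"
    using Pk_integral(1)[OF r i(1), of x] by (simp add: Zk_reproducing if_distrib cong: if_cong)
  then show "(\<integral>y. Pk r x y * R m y \<partial>\<mu>) = r ^ m * R m x"
    using sums_single[of m "\<lambda>_. r ^ m * R m x"] sums_unique2 by blast
  have "(\<lambda>n. if n = m then r ^ m * S m x else 0) sums (\<integral>y. Pk r x y * S m y \<partial>\<mu>)"
    using Pk_integral(1)[OF r i(2), of x] by (simp add: Zk_reproducing if_distrib cong: if_cong)
  then show "(\<integral>y. Pk r x y * S m y \<partial>\<mu>) = r ^ m * S m x"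
    using sums_single[of m "\<lambda>_. r ^ m * S m x"] sums_unique2 by blast
qed

text \<open>On \<open>V N\<close> the Poisson operator multiplies degree m by r^m = e^(-mt) with t =
  -ln r, so its output is the harmonic extension of v and the maximum principle applies.\<close>

lemma Pk_V_le:
  assumes r: "0 < r" "r < 1" and v: "v \<in> V N" "\<And>y. v y \<le> c"
  shows "(\<integral>y. Pk r x y * v y \<partial>\<mu>) \<le> c"
proof -
  obtain A B where v': "v = (\<lambda>x. \<Sum>m\<le>N. A m * R m x + B m * S m x)"
    using V_expand[OF v(1)] by blast
  have r': "0 \<le> r" using r by simp
  have i: "integrable \<mu> (R m)" "integrable \<mu> (S m)" for m
    by (auto intro!: integrable_mu_cont continuous_intros)
  have ii: "integrable \<mu> (\<lambda>y. Pk r x y * R m y)" "integrable \<mu> (\<lambda>y. Pk r x y * S m y)" for m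
    using Pk_integral(2)[OF r' r(2) i(1), of x m] Pk_integral(2)[OF r' r(2) i(2), of x m] by simp_all
  have "(\<integral>y. Pk r x y * v y \<partial>\<mu>)
      = (\<integral>y. (\<Sum>m\<le>N. A m * (Pk r x y * R m y) + B m * (Pk r x y * S m y)) \<partial>\<mu>)"
    unfolding v' by (simp add: sum_distrib_left algebra_simps)
  also have "\<dots> = (\<Sum>m\<le>N. A m * (r ^ m * R m x) + B m * (r ^ m * S m x))"
    using ii by (simp add: Pk_reproducing[OF r' r(2)])
  also have "\<dots> = (\<Sum>m\<le>N. exp (- (real m * (- ln r))) * (A m * R m x + B m * S m x))"
  proof (intro sum.cong refl)
    fix m
    have "exp (- (real m * (- ln r))) = r ^ m"
      using r by (simp add: exp_of_nat_mult)
    then show "A m * (r ^ m * R m x) + B m * (r ^ m * S m x)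
       = exp (- (real m * (- ln r))) * (A m * R m x + B m * S m x)"
      by (simp add: algebra_simps)
  qed
  also have "\<dots> \<le> c"
    using v r unfolding v' by (intro poisson_maximum_principle) auto
  finally show ?thesis .
qed

text \<open>The maximum principle is tested against polynomial approximations of \<open>P / (\<bar>P\<bar> + \<epsilon>)\<close>.\<close>

lemma Pk_L1:
  assumes r: "0 < r" "r < 1"
  shows "(\<integral>y. \<bar>Pk r x y\<bar> \<partial>\<mu>) \<le> 1"
proof -
  let ?Z = "\<lambda>n z. Rp n (cis x) * Rp n z / nR n + Sp n (cis x) * Sp n z / nS n"
  have r': "0 \<le> r" using r by simp
  \<comment> \<open>The kernel becomes a continuous function on the compact circle, where
    Stone-Weierstrass supplies polynomials whose restrictions lie in some
    \<open>V N\<close>.\<close>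
  define p where "p z = (\<Sum>n. r ^ n * (?Z n z))" for z
  have p: "Pk r x y = p (cis y)" for y
    by (simp add: Pk_def Zk_def p_def R_def S_cis)
  have cp: "continuous_on (sphere 0 1) p"
  proof -
    have "uniform_limit (sphere 0 1)
       (\<lambda>N z. \<Sum>n<N. r ^ n * (?Z n z)) p sequentially"
      unfolding p_def
    proof (rule Weierstrass_m_test[OF _ summable_beta[OF r' r(2)]])
      fix n and z :: complex assume "z \<in> sphere 0 1"
      then have "\<bar>?Z n z\<bar> \<le> CZ * \<beta> n"
        by (intro Zk_bound_Rp) auto
      from mult_left_mono[OF this, of "r ^ n"]
      show "norm (r ^ n * (?Z n z)) \<le> CZ * (r ^ n * \<beta> n)"
        using r by (simp add: abs_mult mult_ac)
    qed
    then show ?thesis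
      by (rule uniform_limit_theorem[rotated])
        (auto intro!: always_eventually continuous_intros simp: Sp_def divide_inverse)
  qed
  have iP: "integrable \<mu> (\<lambda>y. Pk r x y)"
    using Pk_integral(2)[OF r' r(2), of "\<lambda>_. 1 :: real" x] by simp
  define I where "I = (\<integral>y. \<bar>Pk r x y\<bar> \<partial>\<mu>)"
  define m where "m = measure \<mu> UNIV"
  have "I \<le> 1 + e" if e: "0 < e" for e
  proof -
    \<comment> \<open>The errors below add up to \<epsilon> (m + I + 1), which this choice makes
      equal to e.\<close>
    define \<epsilon> where "\<epsilon> = e / (m + I + 1)"
    have mI: "0 \<le> m" "0 \<le> I" by (simp_all add: m_def I_def)
    have \<epsilon>: "0 < \<epsilon>" using e mI by (simp add: \<epsilon>_def)
    let ?\<phi> = "\<lambda>z. p z / (\<bar>p z\<bar> + \<epsilon>)"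
    have c\<phi>: "continuous_on (sphere 0 1) ?\<phi>"
      using \<epsilon> by (intro continuous_intros cp) (auto simp: add_nonneg_eq_0_iff)
    obtain g where g: "real_polynomial_function g" "\<And>z. z \<in> sphere 0 1 \<Longrightarrow> \<bar>?\<phi> z - g z\<bar> < \<epsilon>"
      using Stone_Weierstrass_real_polynomial_function[OF compact_sphere c\<phi> \<epsilon>] by blast
    obtain N where N: "(\<lambda>y. g (cis y)) \<in> V N" using polynomial_in_V[OF g(1)] by blast
    have g': "\<bar>?\<phi> (cis y) - g (cis y)\<bar> < \<epsilon>" for y by (rule g) auto
    have "\<bar>?\<phi> (cis y)\<bar> \<le> 1" for y
      using \<epsilon> by (simp add: abs_divide divide_simps)
    then have gle: "g (cis y) \<le> 1 + \<epsilon>" for y using g'[of y] by (smt (verit))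
    have ig: "integrable \<mu> (\<lambda>y. Pk r x y * g (cis y))"
      using Pk_integral(2)[OF r' r(2) integrable_mu_cont[OF V_continuous[OF N]], of x] by simp
    have "I \<le> (\<integral>y. Pk r x y * g (cis y) + \<epsilon> * \<bar>Pk r x y\<bar> + \<epsilon> \<partial>\<mu>)"
      unfolding I_def
    proof (rule integral_mono)
      show "integrable \<mu> (\<lambda>y. \<bar>Pk r x y\<bar>)" using iP by simp
      show "integrable \<mu> (\<lambda>y. Pk r x y * g (cis y) + \<epsilon> * \<bar>Pk r x y\<bar> + \<epsilon>)"
        using iP ig by auto
      fix y
      let ?P = "Pk r x y"
      have "\<bar>?P\<bar> - \<epsilon> \<le> ?P * (?P / (\<bar>?P\<bar> + \<epsilon>))"
      proof -
        have "(\<bar>?P\<bar> - \<epsilon>) * (\<bar>?P\<bar> + \<epsilon>) \<le> ?P * ?P"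
          by (simp add: algebra_simps)
        then show ?thesis using \<epsilon> by (simp add: field_simps)
      qed
      moreover have "?P * (?P / (\<bar>?P\<bar> + \<epsilon>)) - ?P * g (cis y) \<le> \<epsilon> * \<bar>?P\<bar>"
      proof -
        have "?P * (?P / (\<bar>?P\<bar> + \<epsilon>)) - ?P * g (cis y) = ?P * (?\<phi> (cis y) - g (cis y))"
          by (simp add: p right_diff_distrib)
        also have "\<dots> \<le> \<bar>?P\<bar> * \<bar>?\<phi> (cis y) - g (cis y)\<bar>"
          by (metis abs_ge_self abs_mult)
        also have "\<dots> \<le> \<bar>?P\<bar> * \<epsilon>" using g'[of y] by (intro mult_left_mono) auto
        finally show ?thesis by (simp add: mult.commute)
      qed
      ultimately show "\<bar>?P\<bar> \<le> ?P * g (cis y) + \<epsilon> * \<bar>?P\<bar> + \<epsilon>" by simp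
    qed
    also have "\<dots> = (\<integral>y. Pk r x y * g (cis y) \<partial>\<mu>) + \<epsilon> * I + \<epsilon> * m"
      using iP ig by (simp add: I_def m_def)
    also have "(\<integral>y. Pk r x y * g (cis y) \<partial>\<mu>) \<le> 1 + \<epsilon>"
      by (rule Pk_V_le[OF r N gle])
    finally have "I \<le> 1 + \<epsilon> * (m + I + 1)" by (simp add: algebra_simps)
    also have "\<epsilon> * (m + I + 1) = e" using mI by (simp add: \<epsilon>_def)
    finally show ?thesis .
  qed
  then show ?thesis unfolding I_def by (rule field_le_epsilon)
qed

section \<open>The fractional integral\<close>

definition Zop :: "nat \<Rightarrow> (real \<Rightarrow> complex) \<Rightarrow> real \<Rightarrow> complex" where
  "Zop n u x = (\<integral>y. Zk n x y *\<^sub>R u y \<partial>\<mu>)"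

abbreviation Rcoef :: "nat \<Rightarrow> (real \<Rightarrow> complex) \<Rightarrow> complex" where
  "Rcoef n u \<equiv> \<integral>y. R n y *\<^sub>R u y \<partial>\<mu>"

abbreviation Scoef :: "nat \<Rightarrow> (real \<Rightarrow> complex) \<Rightarrow> complex" where
  "Scoef n u \<equiv> \<integral>y. S n y *\<^sub>R u y \<partial>\<mu>"

lemma RS_scale_integrable:
  assumes u: "integrable \<mu> (u :: real \<Rightarrow> complex)"
  shows "integrable \<mu> (\<lambda>y. R n y *\<^sub>R u y)" "integrable \<mu> (\<lambda>y. S n y *\<^sub>R u y)"
proof -
  have [measurable]: "u \<in> borel_measurable \<mu>" using u by simp
  have "integrable \<mu> (\<lambda>y. Gm n *\<^sub>R u y)" using u by simp
  then show "integrable \<mu> (\<lambda>y. R n y *\<^sub>R u y)" "integrable \<mu> (\<lambda>y. S n y *\<^sub>R u y)"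
    by (rule Bochner_Integration.integrable_bound;
        use R_le S_le Gm_pos[of n] in \<open>auto intro!: mult_right_mono\<close>)+
qed

lemma Zop_eq:
  assumes u: "integrable \<mu> u"
  shows "Zop n u x = (R n x / nR n) *\<^sub>R Rcoef n u + (S n x / nS n) *\<^sub>R Scoef n u"
proof -
  have "Zop n u x = (\<integral>y. (R n x / nR n) *\<^sub>R (R n y *\<^sub>R u y) + (S n x / nS n) *\<^sub>R (S n y *\<^sub>R u y) \<partial>\<mu>)"
    unfolding Zop_def Zk_def by (simp add: scaleR_add_left)
  also have "\<dots> = (\<integral>y. (R n x / nR n) *\<^sub>R (R n y *\<^sub>R u y) \<partial>\<mu>) + (\<integral>y. (S n x / nS n) *\<^sub>R (S n y *\<^sub>R u y) \<partial>\<mu>)"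
    by (intro Bochner_Integration.integral_add integrable_scaleR_right RS_scale_integrable u)
  also have "\<dots> = (R n x / nR n) *\<^sub>R Rcoef n u + (S n x / nS n) *\<^sub>R Scoef n u"
    by (simp only: integral_scaleR_right)
  finally show ?thesis .
qed

lemma Zop_continuous:
  assumes "integrable \<mu> u"
  shows "continuous_on UNIV (Zop n u)"
proof -
  have "continuous_on UNIV (\<lambda>x. (R n x * inverse (nR n)) *\<^sub>R Rcoef n u
      + (S n x * inverse (nS n)) *\<^sub>R Scoef n u)"
    by (intro continuous_intros)
  then show ?thesis unfolding divide_inverse[symmetric] Zop_eq[OF assms, symmetric] .
qed

lemma Zop_integrable: "integrable \<mu> u \<Longrightarrow> integrable \<mu> (Zop n u)"
  using Zop_continuous by (rule integrable_mu_cont)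

lemma Zop_bound:
  assumes u: "integrable \<mu> u"
  shows "norm (Zop n u x) \<le> CZ * \<beta> n * L1 u"
proof -
  have "norm (Zop n u x) \<le> (\<integral>y. norm (Zk n x y *\<^sub>R u y) \<partial>\<mu>)"
    unfolding Zop_def by (rule integral_norm_bound)
  also have "\<dots> \<le> (\<integral>y. CZ * \<beta> n * norm (u y) \<partial>\<mu>)"
  proof (rule integral_mono)
    show "integrable \<mu> (\<lambda>y. norm (Zk n x y *\<^sub>R u y))" using Zk_integrable[OF u] by (rule integrable_norm)
    show "norm (Zk n x y *\<^sub>R u y) \<le> CZ * \<beta> n * norm (u y)" for y
      using Zk_bound[of n x y] by (simp add: mult_right_mono)
  qed (use u in simp)
  finally show ?thesis by simp
qed

lemma Zop_Zop:
  assumes u: "integrable \<mu> u"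
  shows "Zop n (Zop m u) x = (if n = m then Zop m u x else 0)"
proof -
  let ?a = "(1 / nR m) *\<^sub>R Rcoef m u" and ?b = "(1 / nS m) *\<^sub>R Scoef m u"
  have i: "integrable \<mu> (\<lambda>y. Zk n x y * R m y)" "integrable \<mu> (\<lambda>y. Zk n x y * S m y)"
    unfolding Zk_def divide_inverse by (intro integrable_mu_cont continuous_intros)+
  have "Zop n (Zop m u) x = (\<integral>y. (Zk n x y * R m y) *\<^sub>R ?a + (Zk n x y * S m y) *\<^sub>R ?b \<partial>\<mu>)"
    unfolding Zop_def[of n] Zop_eq[OF u] by (simp add: scaleR_add_right)
  also have "\<dots> = (\<integral>y. Zk n x y * R m y \<partial>\<mu>) *\<^sub>R ?a + (\<integral>y. Zk n x y * S m y \<partial>\<mu>) *\<^sub>R ?b"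
    using i by (subst Bochner_Integration.integral_add) auto
  also have "\<dots> = (if n = m then Zop m u x else 0)"
    unfolding Zk_reproducing Zop_eq[OF u] by simp
  finally show ?thesis .
qed

lemma Zop_diff: "integrable \<mu> u \<Longrightarrow> integrable \<mu> v \<Longrightarrow> Zop n (\<lambda>y. u y - v y) x = Zop n u x - Zop n v x"
  unfolding Zop_def scaleR_diff_right by (intro Bochner_Integration.integral_diff Zk_integrable)

lemma Zop_sum:
  assumes "\<And>i. i \<in> I \<Longrightarrow> integrable \<mu> (u i)"
  shows "Zop n (\<lambda>y. \<Sum>i\<in>I. c i *\<^sub>R u i y) x = (\<Sum>i\<in>I. c i *\<^sub>R Zop n (u i) x)"
proof -
  have "Zop n (\<lambda>y. \<Sum>i\<in>I. c i *\<^sub>R u i y) x = (\<integral>y. (\<Sum>i\<in>I. c i *\<^sub>R (Zk n x y *\<^sub>R u i y)) \<partial>\<mu>)"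
    unfolding Zop_def by (simp add: scaleR_sum_right mult.commute)
  also have "\<dots> = (\<Sum>i\<in>I. \<integral>y. c i *\<^sub>R (Zk n x y *\<^sub>R u i y) \<partial>\<mu>)"
    by (intro Bochner_Integration.integral_sum integrable_scaleR_right Zk_integrable assms)
  finally show ?thesis by (simp only: integral_scaleR_right Zop_def)
qed

section \<open>Partial sums of the fractional integral in terms of the projections\<close>

lemma coef_times:
  assumes f: "integrable \<mu> f" and g: "g \<noteq> 0"
    and e: "\<And>x. calE k j x = Complex (a * R n x) (b * S n x) / of_real g"
  shows "coef k f j * calE k j x
    = (of_real a * Rcoef n f - \<i> * of_real b * Scoef n f)
      * Complex (a * R n x) (b * S n x) / of_real (a\<^sup>2 * nR n + b\<^sup>2 * nS n)"
proof -
  note RS = RS_scale_integrable[OF f, of n]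
  have 1: "inner_k k f (calE k j) = (of_real a * Rcoef n f
      - \<i> * of_real b * Scoef n f) / of_real g"
  proof -
    have "inner_k k f (calE k j) = (\<integral>y. of_real (a / g) * (R n y *\<^sub>R f y)
        - \<i> * of_real (b / g) * (S n y *\<^sub>R f y) \<partial>\<mu>)"
      unfolding inner_k_def e
      by (intro Bochner_Integration.integral_cong refl) (use g in \<open>simp add: complex_eq_iff field_simps\<close>)
    also have "\<dots> = of_real (a / g) * Rcoef n f - \<i> * of_real (b / g) * Scoef n f"
      by (subst Bochner_Integration.integral_diff)
        (intro integrable_mult_right RS | simp only: integral_mult_right_zero)+
    finally show ?thesis by (simp add: diff_divide_distrib)
  qed
  have 2: "inner_k k (calE k j) (calE k j) = of_real ((a\<^sup>2 * nR n + b\<^sup>2 * nS n) / g\<^sup>2)"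
  proof -
    have "inner_k k (calE k j) (calE k j) = (\<integral>y. complex_of_real (a\<^sup>2 / g\<^sup>2 * (R n y * R n y) + b\<^sup>2 / g\<^sup>2 * (S n y * S n y)) \<partial>\<mu>)"
      unfolding inner_k_def e
      by (intro Bochner_Integration.integral_cong refl)
        (use g in \<open>simp add: complex_eq_iff power2_eq_square add_divide_distrib mult_ac\<close>)
    also have "\<dots> = of_real (a\<^sup>2 / g\<^sup>2 * nR n + b\<^sup>2 / g\<^sup>2 * nS n)"
      unfolding integral_complex_of_real nR_def nS_def
      by (subst Bochner_Integration.integral_add) auto
    finally show ?thesis by (simp add: add_divide_distrib)
  qed
  show ?thesis
    unfolding coef_def 1 2 e using g by (simp add: power2_eq_square)
qed

text \<open>E_n and E_{-n}, with n = m+1, form an orthogonal basis of the span of R_n and S_n, so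
  their two projections add up to the projection onto that span. In coordinates the mixed terms in A
  t and B r cancel between the two summands, and p + q = 2 combines the others.\<close>

lemma coef_block:
  assumes f: "integrable \<mu> f"
  shows "coef k f (int (Suc m)) * calE k (int (Suc m)) x + coef k f (- int (Suc m)) * calE k (- int (Suc m)) x
    = Zop (Suc m) f x"
proof -
  let ?n = "Suc m" and ?s = "sz m"
  let ?h = "hn ?n"
  define A where "A = Rcoef ?n f"
  define B where "B = Scoef ?n f"
  have s: "1 + ?s \<noteq> 0" "1 - ?s \<noteq> 0" and h: "?h \<noteq> 0"
    using sz_bounds[of m] hn_pos[of ?n] by auto
  have g: "Gm m \<noteq> 0" "Gm ?n \<noteq> 0" using Gm_pos[of m] Gm_pos[of ?n] by auto
  have pos: "coef k f (int ?n) * calE k (int ?n) x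
      = (of_real (1 / (1 + ?s)) * A - \<i> * of_real (- 1 / (1 - ?s)) * B)
        * Complex (1 / (1 + ?s) * R ?n x) (- 1 / (1 - ?s) * S ?n x) / of_real (hn m)"
    unfolding coef_times[OF f g(1) calE_pos[of m], of x] A_def[symmetric] B_def[symmetric] hn_rotate[of m]
    by (simp add: power_divide)
  have neg: "coef k f (- int ?n) * calE k (- int ?n) x = (A - \<i> * B) * Complex (R ?n x) (S ?n x) / of_real ?h"
    using coef_times[OF f g(2), of "- int ?n" 1 ?n 1 x] calE_neg[of ?n]
    by (simp add: A_def B_def hn_def)
  have hm: "hn m = ?h / ((1 + ?s) * (1 - ?s))"
  proof -
    have "?h = ((1 + ?s) * (1 - ?s)) * hn m"
      unfolding nR_nS_hn_Suc(3)[of m] by (simp add: power2_eq_square algebra_simps)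
    then show ?thesis using s by simp
  qed
  have Z: "Zop ?n f x = of_real (R ?n x / nR ?n) * A + of_real (S ?n x / nS ?n) * B"
    unfolding Zop_eq[OF f] A_def B_def by (simp add: scaleR_conv_of_real)
  define p where "p = complex_of_real (1 + ?s)"
  define q where "q = complex_of_real (1 - ?s)"
  define r where "r = complex_of_real (R ?n x)"
  define t where "t = complex_of_real (S ?n x)"
  define H where "H = complex_of_real ?h"
  have pq: "p \<noteq> 0" "q \<noteq> 0" "H \<noteq> 0" "p + q = 2"
    using s h unfolding p_def q_def H_def by (simp_all only: of_real_eq_0_iff not_False_eq_True of_real_add[symmetric]) auto
  have "coef k f (int ?n) * calE k (int ?n) x = (A / p + \<i> * B / q) * (r / p - \<i> * t / q) / (H / (p * q))"
    unfolding pos hm p_def q_def r_def t_def H_def Complex_eq by simp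
  moreover have "coef k f (- int ?n) * calE k (- int ?n) x = (A - \<i> * B) * (r + \<i> * t) / H"
    unfolding neg r_def t_def H_def Complex_eq ..
  moreover have "Zop ?n f x = r / (p * H / 2) * A + t / (q * H / 2) * B"
    unfolding Z nR_nS_hn_Suc(1,2) p_def q_def r_def t_def H_def by simp
  moreover have "(A / p + \<i> * B / q) * (r / p - \<i> * t / q) / (H / (p * q)) + (A - \<i> * B) * (r + \<i> * t) / H
      = r / (p * H / 2) * A + t / (q * H / 2) * B"
  proof -
    have e: "(A / p + \<i> * B / q) * (r / p - \<i> * t / q) / (H / (p * q)) + (A - \<i> * B) * (r + \<i> * t) / H
       = (A * r * (q / p + 1) + B * t * (p / q + 1)) / H"
      using pq(1-3) by (simp add: field_simps)
    have e1: "q / p + 1 = 2 / p" "p / q + 1 = 2 / q" using pq by (simp_all add: field_simps)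
    show ?thesis unfolding e e1 using pq by (simp add: field_simps)
  qed
  ultimately show ?thesis by simp
qed

lemma fracI_partial_eq:
  assumes f: "integrable \<mu> f"
  shows "fracI_partial k \<alpha> f N x = (\<Sum>j<N. (real (Suc j) powr - \<alpha>) *\<^sub>R Zop (Suc j) f x)"
proof (induction N)
  case 0
  show ?case by (simp add: fracI_partial_def)
next
  case (Suc N)
  let ?t = "\<lambda>n. of_real (real_of_int \<bar>n\<bar> powr - \<alpha>) * coef k f n * calE k n x"
  have "{- int (Suc N)..int (Suc N)} - {0}
      = insert (int (Suc N)) (insert (- int (Suc N)) ({- int N..int N} - {0}))" by auto
  then have "fracI_partial k \<alpha> f (Suc N) x = ?t (int (Suc N)) + (?t (- int (Suc N)) + fracI_partial k \<alpha> f N x)"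
    unfolding fracI_partial_def by (simp only:) (subst sum.insert, simp, force, subst sum.insert, auto)
  also have "?t (int (Suc N)) + (?t (- int (Suc N)) + fracI_partial k \<alpha> f N x)
      = (real (Suc N) powr - \<alpha>) *\<^sub>R Zop (Suc N) f x + fracI_partial k \<alpha> f N x"
    unfolding coef_block[OF f, symmetric] by (simp add: scaleR_conv_of_real algebra_simps)
  finally show ?case using Suc by simp
qed

section \<open>The Poisson kernel without its constant mode\<close>

lemma Pk_L1_nn:
  assumes "0 < r" "r < 1"
  shows "(\<integral>\<^sup>+y. ennreal \<bar>Pk r x y\<bar> \<partial>\<mu>) \<le> 1"
proof -
  have "integrable \<mu> (\<lambda>y. Pk r x y)"
    using Pk_integral(2)[of r "\<lambda>_. 1 :: real" x] assms by simp
  then have "(\<integral>\<^sup>+y. ennreal \<bar>Pk r x y\<bar> \<partial>\<mu>) = ennreal (\<integral>y. \<bar>Pk r x y\<bar> \<partial>\<mu>)"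
    by (intro nn_integral_eq_integral) auto
  also have "\<dots> \<le> ennreal 1" by (intro ennreal_leI Pk_L1 assms)
  finally show ?thesis by simp
qed

text \<open>As r tends to 0 the Poisson kernel tends to the constant 1 / \<mu>(UNIV). Only after its
  removal is there decay for large t when r = e^(-t).\<close>

definition Wk :: "real \<Rightarrow> real \<Rightarrow> real \<Rightarrow> real" where
  "Wk r x y = Pk r x y - Zk 0 x y"

lemma Wk_measurable [measurable]: "(\<lambda>(x, y). Wk r x y) \<in> borel_measurable (borel \<Otimes>\<^sub>M borel)"
  unfolding Wk_def by measurable

lemma Wk_sym: "Wk r x y = Wk r y x"
  by (simp add: Wk_def Pk_sym[of r x y] Zk_sym[of 0 x y])

lemma Wk_L1_nn:
  assumes "0 < r" "r < 1"
  shows "(\<integral>\<^sup>+y. ennreal \<bar>Wk r x y\<bar> \<partial>\<mu>) \<le> 2"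
proof -
  have Z: "\<bar>Zk 0 x y\<bar> = 1 / measure \<mu> UNIV" for y
    using measure_mu_pos by (simp add: Zk_def hn_0)
  have "(\<integral>\<^sup>+y. ennreal \<bar>Wk r x y\<bar> \<partial>\<mu>) \<le> (\<integral>\<^sup>+y. ennreal \<bar>Pk r x y\<bar> + ennreal (1 / measure \<mu> UNIV) \<partial>\<mu>)"
  proof (rule nn_integral_mono)
    fix y
    have "\<bar>Wk r x y\<bar> \<le> \<bar>Pk r x y\<bar> + 1 / measure \<mu> UNIV"
      using abs_triangle_ineq4[of "Pk r x y" "Zk 0 x y"] unfolding Wk_def Z .
    then have "ennreal \<bar>Wk r x y\<bar> \<le> ennreal (\<bar>Pk r x y\<bar> + 1 / measure \<mu> UNIV)" by (rule ennreal_leI)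
    then show "ennreal \<bar>Wk r x y\<bar> \<le> ennreal \<bar>Pk r x y\<bar> + ennreal (1 / measure \<mu> UNIV)"
      by (simp add: ennreal_plus)
  qed
  also have "\<dots> = (\<integral>\<^sup>+y. ennreal \<bar>Pk r x y\<bar> \<partial>\<mu>) + ennreal (1 / measure \<mu> UNIV) * emeasure \<mu> UNIV"
    by (subst nn_integral_add) auto
  also have "ennreal (1 / measure \<mu> UNIV) * emeasure \<mu> UNIV = 1"
    using measure_mu_pos by (simp add: mu.emeasure_eq_measure ennreal_mult'[symmetric])
  also have "(\<integral>\<^sup>+y. ennreal \<bar>Pk r x y\<bar> \<partial>\<mu>) + 1 \<le> 1 + 1"
    by (intro add_right_mono Pk_L1_nn assms)
  finally show ?thesis by (simp add: one_add_one)
qed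

text \<open>From t/(1+t) <= 1 - e^(-t) and (1+t)/D <= e^(t/D) follows t/D <= e^(t/D) (1 - e^(-t)),
  and raising this to the power -D gives the claim. The factor e^(-t) is what makes a pure power of
  t valid for large t as well.\<close>

lemma exp_powr_bound:
  assumes D: "1 \<le> D" and t: "0 < (t :: real)"
  shows "exp (- t) * (1 - exp (- t)) powr - D \<le> (t / D) powr - D"
proof -
  have e: "1 + t \<le> exp t" by (rule exp_ge_add_one_self)
  have q: "0 < 1 - exp (- t)" using t by simp
  have 1: "t / (1 + t) \<le> 1 - exp (- t)"
  proof -
    have "exp (- t) \<le> 1 / (1 + t)" using e t by (simp add: exp_minus field_simps)
    moreover have "t / (1 + t) = 1 - 1 / (1 + t)" using t by (simp add: field_simps)
    ultimately show ?thesis by simp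
  qed
  have "(1 + t) / D \<le> 1 + t / D" using D t by (simp add: field_simps)
  also have "\<dots> \<le> exp (t / D)" by (rule exp_ge_add_one_self)
  finally have 2: "(1 + t) / D \<le> exp (t / D)" .
  have "t / D = (1 + t) / D * (t / (1 + t))" using t by simp
  also have "\<dots> \<le> exp (t / D) * (1 - exp (- t))"
    using 1 2 t D q by (intro mult_mono) auto
  finally have "(exp (t / D) * (1 - exp (- t))) powr - D \<le> (t / D) powr - D"
    using t D by (intro powr_mono2') auto
  also have "(exp (t / D) * (1 - exp (- t))) powr - D = exp (t / D) powr - D * (1 - exp (- t)) powr - D"
    using q by (subst powr_mult) auto
  also have "exp (t / D) powr - D = exp (- t)"
    using D by (simp add: powr_def)
  finally show ?thesis .
qed

definition \<Lambda> :: real where "\<Lambda> = CZ * (2 * (2 * k + 1)) powr (2 * k + 1)"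

text \<open>With q = e^(-t/2), every s^n with n >= 1 is at most q q^n: one factor q is kept for the
  decay, the power q^n sums the binomial series. Using \<open>exp_powr_bound\<close> at t/2 produces
  the constant (2(2k+1))^(2k+1) in \<Lambda>.\<close>

lemma Wk_sup:
  assumes t: "0 < t" and s: "0 \<le> s" "s \<le> exp (- t)"
  shows "\<bar>Wk s x y\<bar> \<le> \<Lambda> * t powr - (2 * k + 1)"
proof -
  define q where "q = exp (- (t / 2))"
  let ?D = "2 * k + 1"
  have q: "0 < q" "q < 1" using t by (auto simp: q_def)
  have qq: "q * q = exp (- t)" by (simp add: q_def exp_add[symmetric])
  have s1: "s < 1" using s t by (smt (verit) exp_less_one_iff)
  have sm: "summable (\<lambda>n. s ^ n * Zk n x y)"
    using Pk_summable[OF s(1) s1, of x y] by (rule summable_rabs_cancel)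
  have sq: "summable (\<lambda>n. CZ * (q ^ Suc n * \<beta> (Suc n)))"
    by (rule summable_Suc_iff[THEN iffD2, OF summable_beta]) (use q in auto)
  have "Wk s x y = (\<Sum>n. s ^ Suc n * Zk (Suc n) x y)"
    unfolding Wk_def Pk_def suminf_split_head[OF sm] by simp
  also have "\<bar>\<dots>\<bar> \<le> (\<Sum>n. \<bar>s ^ Suc n * Zk (Suc n) x y\<bar>)"
    using Pk_summable[OF s(1) s1, of x y]
    by (intro summable_rabs) (rule summable_Suc_iff[THEN iffD2])
  also have "\<dots> \<le> (\<Sum>n. q * (CZ * (q ^ Suc n * \<beta> (Suc n))))"
  proof (rule suminf_le)
    fix n
    have "s ^ Suc n \<le> (q * q) ^ Suc n" unfolding qq using s by (intro power_mono) auto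
    also have "\<dots> = q ^ Suc n * q ^ Suc n" by (rule power_mult_distrib)
    also have "\<dots> \<le> q * q ^ Suc n"
      using q by (intro mult_right_mono) (auto simp: mult_left_le power_le_one)
    finally have 1: "s ^ Suc n \<le> q * q ^ Suc n" .
    have "\<bar>s ^ Suc n * Zk (Suc n) x y\<bar> \<le> CZ * (s ^ Suc n * \<beta> (Suc n))" by (rule Pk_term_bound[OF s(1)])
    also have "\<dots> \<le> CZ * ((q * q ^ Suc n) * \<beta> (Suc n))"
      using 1 CZ_pos \<beta>_pos[of "Suc n"] by (intro mult_left_mono mult_right_mono) auto
    finally show "\<bar>s ^ Suc n * Zk (Suc n) x y\<bar> \<le> q * (CZ * (q ^ Suc n * \<beta> (Suc n)))"
      by (simp only: mult_ac)
  next
    show "summable (\<lambda>n. \<bar>s ^ Suc n * Zk (Suc n) x y\<bar>)"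
      using Pk_summable[OF s(1) s1, of x y] by (rule summable_Suc_iff[THEN iffD2])
    show "summable (\<lambda>n. q * (CZ * (q ^ Suc n * \<beta> (Suc n))))"
      by (rule summable_mult[OF sq])
  qed
  also have "\<dots> = q * (\<Sum>n. CZ * (q ^ Suc n * \<beta> (Suc n)))"
    by (rule suminf_mult[OF sq])
  also have "(\<Sum>n. CZ * (q ^ Suc n * \<beta> (Suc n))) = (\<Sum>n. CZ * (q ^ n * \<beta> n)) - CZ * (q ^ 0 * \<beta> 0)"
    by (rule suminf_split_head[OF summable_beta]) (use q in auto)
  also have "(\<Sum>n. CZ * (q ^ n * \<beta> n)) = CZ * (1 - q) powr - ?D"
    using \<beta>_sums[of q] q by (subst suminf_mult) (auto simp: sums_iff)
  also have "q * (CZ * (1 - q) powr - ?D - CZ * (q ^ 0 * \<beta> 0)) \<le> q * (CZ * (1 - q) powr - ?D)"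
    using q CZ_pos \<beta>_pos[of 0] by (intro mult_left_mono) auto
  also have "\<dots> = CZ * (exp (- (t / 2)) * (1 - exp (- (t / 2))) powr - ?D)"
    by (simp add: q_def mult_ac)
  also have "\<dots> \<le> CZ * (t / 2 / ?D) powr - ?D"
    using CZ_pos t k_pos by (intro mult_left_mono exp_powr_bound) auto
  also have "(t / 2 / ?D) powr - ?D = (2 * ?D) powr ?D * t powr - ?D"
  proof -
    have "(t / 2 / ?D) powr - ?D = (t / (2 * ?D)) powr - ?D" by simp
    also have "\<dots> = t powr - ?D / (2 * ?D) powr - ?D"
      using t k_pos by (subst powr_divide) auto
    also have "\<dots> = (2 * ?D) powr ?D * t powr - ?D"
      by (simp only: powr_minus divide_inverse inverse_inverse_eq mult.commute)
    finally show ?thesis .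
  qed
  finally show ?thesis by (simp add: \<Lambda>_def mult.assoc)
qed

section \<open>Pairings with bounded test functions\<close>

definition cp :: "nat \<Rightarrow> (real \<Rightarrow> complex) \<Rightarrow> (real \<Rightarrow> complex) \<Rightarrow> complex" where
  "cp n u h = (\<integral>x. Zop n u x * h x \<partial>\<mu>)"

lemma integrable_mult_bounded:
  fixes u h :: "real \<Rightarrow> complex"
  assumes u: "integrable \<mu> u" and [measurable]: "h \<in> borel_measurable borel" and B: "\<And>x. norm (h x) \<le> B"
  shows "integrable \<mu> (\<lambda>x. u x * h x)"
proof (rule Bochner_Integration.integrable_bound)
  have [measurable]: "u \<in> borel_measurable \<mu>" using u by simp
  show "integrable \<mu> (\<lambda>x. B * norm (u x))" using u by simp
  show "(\<lambda>x. u x * h x) \<in> borel_measurable \<mu>" by measurable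
  have "0 \<le> B" using order_trans[OF norm_ge_zero B] .
  then show "AE x in \<mu>. norm (u x * h x) \<le> norm (B * norm (u x))"
    using B by (auto simp: norm_mult abs_mult mult.commute intro!: mult_right_mono)
qed

lemma integral_mult_bounded_le:
  fixes u h :: "real \<Rightarrow> complex"
  assumes u: "integrable \<mu> u" and "h \<in> borel_measurable borel" and B: "\<And>x. norm (h x) \<le> B"
  shows "norm (\<integral>x. u x * h x \<partial>\<mu>) \<le> B * (\<integral>x. norm (u x) \<partial>\<mu>)"
proof -
  have "norm (\<integral>x. u x * h x \<partial>\<mu>) \<le> (\<integral>x. norm (u x * h x) \<partial>\<mu>)" by (rule integral_norm_bound)
  also have "\<dots> \<le> (\<integral>x. B * norm (u x) \<partial>\<mu>)"
  proof (rule integral_mono)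
    show "integrable \<mu> (\<lambda>x. norm (u x * h x))" by (intro integrable_norm integrable_mult_bounded[OF assms])
    show "integrable \<mu> (\<lambda>x. B * norm (u x))" using u by simp
    show "norm (u x * h x) \<le> B * norm (u x)" for x
      using mult_right_mono[OF B[of x], of "norm (u x)"] by (simp add: norm_mult mult.commute)
  qed
  finally show ?thesis by simp
qed

lemma cp_bound:
  assumes u: "integrable \<mu> u" and h: "h \<in> borel_measurable borel" "\<And>x. norm (h x) \<le> B"
  shows "norm (cp n u h) \<le> CZ * \<beta> n * (L1 u * B * measure \<mu> UNIV)"
proof -
  have B: "0 \<le> B" using order_trans[OF norm_ge_zero h(2)] .
  have "norm (cp n u h) \<le> B * (\<integral>x. norm (Zop n u x) \<partial>\<mu>)"
    unfolding cp_def by (intro integral_mult_bounded_le Zop_integrable u h)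
  also have "\<dots> \<le> B * (\<integral>x. CZ * \<beta> n * L1 u \<partial>\<mu>)"
    using Zop_integrable[OF u, of n] B by (intro mult_left_mono integral_mono integrable_norm Zop_bound u) auto
  finally show ?thesis by (simp add: mult_ac)
qed

lemma cp_summable:
  assumes u: "integrable \<mu> u" and h: "h \<in> borel_measurable borel" "\<And>x. norm (h x) \<le> B"
    and r: "0 \<le> r" "r < 1"
  shows "summable (\<lambda>n. r ^ n * norm (cp n u h))"
proof (rule summable_comparison_test'[of "\<lambda>n. CZ * (r ^ n * \<beta> n) * (L1 u * B * measure \<mu> UNIV)" 0])
  show "summable (\<lambda>n. CZ * (r ^ n * \<beta> n) * (L1 u * B * measure \<mu> UNIV))"
    by (intro summable_mult2 summable_beta r)
  show "norm (r ^ n * norm (cp n u h)) \<le> CZ * (r ^ n * \<beta> n) * (L1 u * B * measure \<mu> UNIV)" for n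
    using mult_left_mono[OF cp_bound[OF u h, of n], of "r ^ n"] r by (simp add: abs_mult mult_ac)
qed

lemma pairing_sums:
  assumes u: "integrable \<mu> u" and h: "h \<in> borel_measurable borel" "\<And>x. norm (h x) \<le> B"
    and r: "0 \<le> r" "r < 1"
  shows "(\<lambda>n. of_real (r ^ n) * cp n u h) sums (\<integral>x. Pop r u x * h x \<partial>\<mu>)"
    and "integrable \<mu> (\<lambda>x. Pop r u x * h x)"
proof -
  let ?f = "\<lambda>n x. of_real (r ^ n) * (Zop n u x * h x)"
  have i: "integrable \<mu> (?f n)" for n
    by (intro integrable_mult_right integrable_mult_bounded[OF _ h] Zop_integrable u)
  let ?I = "\<integral>y. norm (u y) \<partial>\<mu>"
  have nf: "norm (?f n x) \<le> CZ * (r ^ n * \<beta> n) * (?I * norm (h x))" for n x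
  proof -
    have "norm (?f n x) = r ^ n * (norm (Zop n u x) * norm (h x))" using r by (simp add: norm_mult norm_power)
    also have "\<dots> \<le> r ^ n * ((CZ * \<beta> n * ?I) * norm (h x))"
      using r by (intro mult_left_mono mult_right_mono Zop_bound u) auto
    finally show ?thesis by (simp add: mult_ac)
  qed
  have s1: "summable (\<lambda>n. norm (?f n x))" for x
    by (rule summable_comparison_test'[of "\<lambda>n. CZ * (r ^ n * \<beta> n) * (?I * norm (h x))" 0])
      (use nf in \<open>auto intro!: summable_mult2 summable_beta r\<close>)
  have ih: "integrable \<mu> (\<lambda>x. norm (h x))"
    using h by (intro integrable_norm integrable_mu_bounded) auto
  have s2: "summable (\<lambda>n. \<integral>x. norm (?f n x) \<partial>\<mu>)"
  proof (rule summable_comparison_test'[of "\<lambda>n. CZ * (r ^ n * \<beta> n) * (?I * (\<integral>x. norm (h x) \<partial>\<mu>))" 0])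
    show "summable (\<lambda>n. CZ * (r ^ n * \<beta> n) * (?I * (\<integral>x. norm (h x) \<partial>\<mu>)))"
      by (intro summable_mult2 summable_beta r)
    fix n :: nat
    have "norm (\<integral>x. norm (?f n x) \<partial>\<mu>) = (\<integral>x. norm (?f n x) \<partial>\<mu>)"
      by (simp only: real_norm_def abs_of_nonneg integral_nonneg_AE norm_ge_zero AE_I2)
    also have "\<dots> \<le> (\<integral>x. CZ * (r ^ n * \<beta> n) * (?I * norm (h x)) \<partial>\<mu>)"
      by (intro integral_mono nf integrable_norm i) (use ih in auto)
    finally show "norm (\<integral>x. norm (?f n x) \<partial>\<mu>) \<le> CZ * (r ^ n * \<beta> n) * (?I * (\<integral>x. norm (h x) \<partial>\<mu>))"
      by simp
  qed
  have eq: "(\<Sum>n. ?f n x) = Pop r u x * h x" for x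
  proof -
    have "(\<lambda>n. r ^ n *\<^sub>R Zop n u x * h x) sums (Pop r u x * h x)"
      using Pk_integral(1)[OF r u, of x] unfolding Zop_def by (rule sums_mult2)
    then show ?thesis by (simp add: sums_iff scaleR_conv_of_real mult.assoc)
  qed
  show "integrable \<mu> (\<lambda>x. Pop r u x * h x)"
    by (rule integrable_suminf[OF i AE_I2[OF s1] s2, unfolded eq])
  have "(\<lambda>n. \<integral>x. ?f n x \<partial>\<mu>) sums (\<integral>x. Pop r u x * h x \<partial>\<mu>)"
    by (rule sums_integral[OF i AE_I2[OF s1] s2, unfolded eq])
  then show "(\<lambda>n. of_real (r ^ n) * cp n u h) sums (\<integral>x. Pop r u x * h x \<partial>\<mu>)"
    by (simp only: integral_mult_right_zero cp_def)
qed

lemma kernel_pairing_bound: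
  fixes K :: "real \<Rightarrow> real \<Rightarrow> real" and u h :: "real \<Rightarrow> complex"
  assumes [measurable]: "(\<lambda>(x, y). K x y) \<in> borel_measurable (borel \<Otimes>\<^sub>M borel)"
      "u \<in> borel_measurable borel" "h \<in> borel_measurable borel"
    and i: "\<And>x. integrable \<mu> (\<lambda>y. K x y *\<^sub>R u y)" "integrable \<mu> (\<lambda>x. (\<integral>y. K x y *\<^sub>R u y \<partial>\<mu>) * h x)"
  shows "ennreal (norm (\<integral>x. (\<integral>y. K x y *\<^sub>R u y \<partial>\<mu>) * h x \<partial>\<mu>))
    \<le> (\<integral>\<^sup>+x. \<integral>\<^sup>+y. ennreal (\<bar>K x y\<bar> * norm (h x) * norm (u y)) \<partial>\<mu> \<partial>\<mu>)"
proof -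
  have "ennreal (norm (\<integral>x. (\<integral>y. K x y *\<^sub>R u y \<partial>\<mu>) * h x \<partial>\<mu>))
    \<le> (\<integral>\<^sup>+x. ennreal (norm ((\<integral>y. K x y *\<^sub>R u y \<partial>\<mu>) * h x)) \<partial>\<mu>)"
    by (rule integral_norm_bound_ennreal[OF i(2)])
  also have "\<dots> \<le> (\<integral>\<^sup>+x. \<integral>\<^sup>+y. ennreal (\<bar>K x y\<bar> * norm (h x) * norm (u y)) \<partial>\<mu> \<partial>\<mu>)"
  proof (rule nn_integral_mono)
    fix x
    have "ennreal (norm ((\<integral>y. K x y *\<^sub>R u y \<partial>\<mu>) * h x))
       = ennreal (norm (h x)) * ennreal (norm (\<integral>y. K x y *\<^sub>R u y \<partial>\<mu>))"
      by (simp add: norm_mult ennreal_mult mult.commute)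
    also have "\<dots> \<le> ennreal (norm (h x)) * (\<integral>\<^sup>+y. ennreal (norm (K x y *\<^sub>R u y)) \<partial>\<mu>)"
      by (intro mult_left_mono integral_norm_bound_ennreal i) auto
    also have "\<dots> = (\<integral>\<^sup>+y. ennreal (norm (h x)) * ennreal (norm (K x y *\<^sub>R u y)) \<partial>\<mu>)"
      by (rule nn_integral_cmult[symmetric]) measurable
    also have "\<dots> = (\<integral>\<^sup>+y. ennreal (\<bar>K x y\<bar> * norm (h x) * norm (u y)) \<partial>\<mu>)"
      by (intro nn_integral_cong) (simp add: ennreal_mult[symmetric] mult_ac)
    finally show "ennreal (norm ((\<integral>y. K x y *\<^sub>R u y \<partial>\<mu>) * h x))
      \<le> (\<integral>\<^sup>+y. ennreal (\<bar>K x y\<bar> * norm (h x) * norm (u y)) \<partial>\<mu>)" .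
  qed
  finally show ?thesis .
qed

sublocale mumu: pair_sigma_finite \<mu> \<mu>
  by (intro pair_sigma_finite.intro mu.sigma_finite_measure_axioms)

text \<open>By symmetry of the kernel the bound on its integrals in one variable holds in the other,
  so the Poisson operator contracts L^1; pairing with h costs the factor B.\<close>

lemma pairing_contraction:
  fixes u h :: "real \<Rightarrow> complex"
  assumes u: "integrable \<mu> u" and h [measurable]: "h \<in> borel_measurable borel" and B: "\<And>x. norm (h x) \<le> B"
    and r: "0 < r" "r < 1"
  shows "norm (\<integral>x. Pop r u x * h x \<partial>\<mu>) \<le> B * L1 u"
proof -
  have r': "0 \<le> r" using r by simp
  have B0: "0 \<le> B" using order_trans[OF norm_ge_zero B] .
  have um [measurable]: "u \<in> borel_measurable borel" using borel_measurable_integrable[OF u] by simp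
  have "ennreal (norm (\<integral>x. Pop r u x * h x \<partial>\<mu>))
      \<le> (\<integral>\<^sup>+x. \<integral>\<^sup>+y. ennreal (\<bar>Pk r x y\<bar> * norm (h x) * norm (u y)) \<partial>\<mu> \<partial>\<mu>)"
    by (intro kernel_pairing_bound Pk_integral(2) pairing_sums(2)[OF u h B] r r' u Pk_measurable h um)
  also have "\<dots> \<le> (\<integral>\<^sup>+x. \<integral>\<^sup>+y. ennreal (B * norm (u y)) * ennreal \<bar>Pk r x y\<bar> \<partial>\<mu> \<partial>\<mu>)"
  proof (intro nn_integral_mono)
    fix x y
    have "\<bar>Pk r x y\<bar> * norm (h x) * norm (u y) \<le> \<bar>Pk r x y\<bar> * B * norm (u y)"
      using B by (intro mult_right_mono mult_left_mono) auto
    then have "ennreal (\<bar>Pk r x y\<bar> * norm (h x) * norm (u y)) \<le> ennreal ((B * norm (u y)) * \<bar>Pk r x y\<bar>)"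
      by (intro ennreal_leI) (simp add: mult_ac)
    then show "ennreal (\<bar>Pk r x y\<bar> * norm (h x) * norm (u y)) \<le> ennreal (B * norm (u y)) * ennreal \<bar>Pk r x y\<bar>"
      using B0 by (simp add: ennreal_mult)
  qed
  also have "\<dots> = (\<integral>\<^sup>+y. \<integral>\<^sup>+x. ennreal (B * norm (u y)) * ennreal \<bar>Pk r x y\<bar> \<partial>\<mu> \<partial>\<mu>)"
    by (rule mumu.Fubini'[symmetric]) measurable
  also have "\<dots> = (\<integral>\<^sup>+y. ennreal (B * norm (u y)) * (\<integral>\<^sup>+x. ennreal \<bar>Pk r y x\<bar> \<partial>\<mu>) \<partial>\<mu>)"
    by (subst Pk_sym) (intro nn_integral_cong nn_integral_cmult, measurable)
  also have "\<dots> \<le> (\<integral>\<^sup>+y. ennreal (B * norm (u y)) * 1 \<partial>\<mu>)"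
    by (intro nn_integral_mono mult_left_mono Pk_L1_nn r) auto
  also have "\<dots> = ennreal (B * L1 u)"
    using u B0 by (simp add: nn_integral_eq_integral)
  finally show ?thesis using B0 by (simp add: ennreal_le_iff)
qed

text \<open>Dropping the term n = 0 from the series amounts to replacing the Poisson kernel by
  \<open>Wk\<close>.\<close>

lemma pairing_tail:
  assumes u: "integrable \<mu> u" and h [measurable]: "h \<in> borel_measurable borel" and B: "\<And>x. norm (h x) \<le> B"
    and r: "0 \<le> r" "r < 1"
  shows "ennreal (norm (\<Sum>n. of_real (r ^ Suc n) * cp (Suc n) u h))
    \<le> (\<integral>\<^sup>+x. \<integral>\<^sup>+y. ennreal (\<bar>Wk r x y\<bar> * norm (h x) * norm (u y)) \<partial>\<mu> \<partial>\<mu>)"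
proof -
  have um: "u \<in> borel_measurable borel" using borel_measurable_integrable[OF u] by simp
  have W: "(\<integral>y. Wk r x y *\<^sub>R u y \<partial>\<mu>) = Pop r u x - Zop 0 u x" for x
    unfolding Wk_def scaleR_diff_left Zop_def
    by (intro Bochner_Integration.integral_diff Pk_integral(2) Zk_integrable u r)
  have iW: "integrable \<mu> (\<lambda>y. Wk r x y *\<^sub>R u y)" for x
    unfolding Wk_def scaleR_diff_left
    by (intro Bochner_Integration.integrable_diff Pk_integral(2) Zk_integrable u r)
  have iZ: "integrable \<mu> (\<lambda>x. Zop 0 u x * h x)"
    by (intro integrable_mult_bounded[OF _ h B] Zop_integrable u)
  note P = pairing_sums[OF u h B r]
  have "(\<lambda>n. of_real (r ^ Suc n) * cp (Suc n) u h) sums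
      ((\<integral>x. Pop r u x * h x \<partial>\<mu>) - of_real (r ^ 0) * cp 0 u h)"
    using P(1) by (subst sums_Suc_iff) simp
  then have "(\<Sum>n. of_real (r ^ Suc n) * cp (Suc n) u h)
      = (\<integral>x. Pop r u x * h x \<partial>\<mu>) - cp 0 u h"
    by (simp add: sums_iff)
  also have "\<dots> = (\<integral>x. (\<integral>y. Wk r x y *\<^sub>R u y \<partial>\<mu>) * h x \<partial>\<mu>)"
    unfolding W cp_def left_diff_distrib by (rule Bochner_Integration.integral_diff[symmetric, OF P(2) iZ])
  finally have eq: "(\<Sum>n. of_real (r ^ Suc n) * cp (Suc n) u h) = (\<integral>x. (\<integral>y. Wk r x y *\<^sub>R u y \<partial>\<mu>) * h x \<partial>\<mu>)" .
  show ?thesis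
    unfolding eq
  proof (intro kernel_pairing_bound iW Wk_measurable um h)
    show "integrable \<mu> (\<lambda>x. (\<integral>y. Wk r x y *\<^sub>R u y \<partial>\<mu>) * h x)"
      unfolding W left_diff_distrib by (intro Bochner_Integration.integrable_diff P(2) iZ)
  qed
qed

section \<open>Uniform estimate of the damped multiplier series\<close>

definition hls_const :: "real \<Rightarrow> real \<Rightarrow> real \<Rightarrow> real" where
  "hls_const a p v = 2 * (1 / a + 1 / ((2 * k + 1) * (1 / p) - a)) + \<Lambda> / (2 * k + 1 - a)
        + (2 * (1 / a + 1 / ((2 * k + 1) * (1 / v) - a)) + \<Lambda> / (2 * k + 1 - a))"

lemma nn_integral_normalized_le:
  fixes f :: "real \<Rightarrow> complex"
  assumes "integrable \<mu> (\<lambda>x. norm (f x) powr p)" "(\<integral>x. norm (f x) powr p \<partial>\<mu>) \<le> X powr p" "0 < X"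
  shows "(\<integral>\<^sup>+x. ennreal ((norm (f x) / X) powr p) \<partial>\<mu>) \<le> 1"
proof -
  have "(\<integral>\<^sup>+x. ennreal ((norm (f x) / X) powr p) \<partial>\<mu>) = (\<integral>\<^sup>+x. ennreal (norm (f x) powr p / X powr p) \<partial>\<mu>)"
    using assms(3) by (intro nn_integral_cong) (simp add: powr_divide)
  also have "\<dots> = ennreal (\<integral>x. norm (f x) powr p / X powr p \<partial>\<mu>)"
    using assms(1) by (intro nn_integral_eq_integral) auto
  also have "\<dots> \<le> ennreal 1"
    using assms by (intro ennreal_leI) (simp add: divide_le_eq)
  finally show ?thesis by simp
qed

text \<open>X and Y are arbitrary positive majorants of the norms of f and h, so dividing by them is
  safe even when a norm is zero. The Poisson radius rho e^(-t) stays below e^(-t), which makes the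
  bound independent of rho.\<close>

lemma fractional_pairing_bound:
  assumes f: "integrable \<mu> f" and h [measurable]: "h \<in> borel_measurable borel" and B: "\<And>x. norm (h x) \<le> B"
    and fp: "integrable \<mu> (\<lambda>x. norm (f x) powr p)" "(\<integral>x. norm (f x) powr p \<partial>\<mu>) \<le> X powr p" "0 < X"
    and hv: "(\<integral>x. norm (h x) powr v \<partial>\<mu>) \<le> Y powr v" "0 < Y"
    and a: "0 < a" "a < 2 * k + 1" and pv: "1 < p" "1 < v" and rel: "1 / p + 1 / v = 1 + a / (2 * k + 1)"
    and \<rho>: "0 < \<rho>" "\<rho> < 1"
  shows "norm (\<Sum>n. of_real (\<rho> ^ Suc n * real (Suc n) powr - a) * cp (Suc n) f h)
    \<le> hls_const a p v / Gamma a * X * Y"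
proof -
  let ?G = "\<Sum>n. of_real (\<rho> ^ Suc n * real (Suc n) powr - a) * cp (Suc n) f h"
  let ?w = "\<lambda>t x y. if 0 < t then \<bar>Wk (\<rho> * exp (- t)) y x\<bar> else 0"
  have fm [measurable]: "f \<in> borel_measurable borel" using borel_measurable_integrable[OF f] by simp
  have hv': "integrable \<mu> (\<lambda>x. norm (h x) powr v)"
  proof (rule integrable_mu_bounded)
    show "norm (norm (h x) powr v) \<le> B powr v" for x
      using B[of x] pv by (simp add: powr_mono2)
  qed measurable
  let ?T = "\<lambda>t. \<Sum>n. of_real ((\<rho> * exp (- t)) ^ Suc n) * cp (Suc n) f h"
  have r: "0 < \<rho> * exp (- t)" "\<rho> * exp (- t) < 1" "\<rho> * exp (- t) \<le> exp (- t)" if "0 < t" for t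
  proof -
    have "exp (- t) < 1" using that by simp
    then have "\<rho> * exp (- t) < 1 * 1" using \<rho> by (intro mult_strict_mono) auto
    then show "0 < \<rho> * exp (- t)" "\<rho> * exp (- t) < 1" "\<rho> * exp (- t) \<le> exp (- t)"
      using \<rho> by (auto simp: mult_le_cancel_right1)
  qed
  have XY: "0 < X * Y" using fp hv by simp
  have main: "(\<integral>\<^sup>+t. tweight a t * ennreal (norm (?T t) / (X * Y)) \<partial>lborel)
    \<le> ennreal (hls_const a p v)"
    unfolding hls_const_def
  \<comment> \<open>Here h plays F and f plays H, so p and v are exchanged. With the arguments of
    the kernel swapped, the order of integration agrees with that of
    \<open>pairing_tail\<close>.\<close>
  proof (rule mu.hls_bilinear[where F = "\<lambda>x. norm (h x) / Y" and H = "\<lambda>y. norm (f y) / X" and p = v and v = p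
        and w = ?w])
    show "(\<lambda>(x, y). ?w t x y) \<in> borel_measurable (\<mu> \<Otimes>\<^sub>M \<mu>)" for t
      by measurable
    show "(\<integral>\<^sup>+x. ennreal (?w t x y) \<partial>\<mu>) \<le> 2" if "0 < t" for t y
      using that Wk_L1_nn[OF r(1,2)[OF that], of y] by simp
    show "(\<integral>\<^sup>+y. ennreal (?w t x y) \<partial>\<mu>) \<le> 2" if "0 < t" for t x
      using that Wk_L1_nn[OF r(1,2)[OF that], of x] by (simp add: Wk_sym[of _ _ x])
    show "?w t x y \<le> \<Lambda> * t powr - (2 * k + 1)" if "0 < t" for t x y
      using that Wk_sup[OF that _ r(3)[OF that], of y x] r(1)[OF that] by simp
    show "ennreal (norm (?T t) / (X * Y))
      \<le> (\<integral>\<^sup>+y. \<integral>\<^sup>+x. ennreal (?w t x y * (norm (h y) / Y) * (norm (f x) / X)) \<partial>\<mu> \<partial>\<mu>)"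
      if t: "0 < t" for t
    proof -
      have "ennreal (norm (?T t) / (X * Y)) = ennreal (1 / (X * Y)) * ennreal (norm (?T t))"
        using XY by (subst ennreal_mult[symmetric]) auto
      also have "\<dots> \<le> ennreal (1 / (X * Y)) * (\<integral>\<^sup>+x. \<integral>\<^sup>+y. ennreal (\<bar>Wk (\<rho> * exp (- t)) x y\<bar> * norm (h x) * norm (f y)) \<partial>\<mu> \<partial>\<mu>)"
        using r[OF t] by (intro mult_left_mono pairing_tail[OF f h B]) auto
      also have "\<dots> = (\<integral>\<^sup>+x. \<integral>\<^sup>+y. ennreal (1 / (X * Y)) * ennreal (\<bar>Wk (\<rho> * exp (- t)) x y\<bar> * norm (h x) * norm (f y)) \<partial>\<mu> \<partial>\<mu>)"
        by (simp add: nn_integral_cmult)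
      also have "\<dots> = (\<integral>\<^sup>+y. \<integral>\<^sup>+x. ennreal (?w t x y * (norm (h y) / Y) * (norm (f x) / X)) \<partial>\<mu> \<partial>\<mu>)"
        using t XY by (intro nn_integral_cong) (simp add: ennreal_mult'[symmetric] mult_ac)
      finally show ?thesis by simp
    qed
    show "(\<integral>\<^sup>+y. ennreal ((norm (h y) / Y) powr v) \<partial>\<mu>) \<le> 1" by (rule nn_integral_normalized_le[OF hv' hv])
    show "(\<integral>\<^sup>+y. ennreal ((norm (f y) / X) powr p) \<partial>\<mu>) \<le> 1" by (rule nn_integral_normalized_le[OF fp])
    show "1 / v + 1 / p = 1 + a / (2 * k + 1)" using rel by simp
    show "0 \<le> \<Lambda>" using CZ_pos by (simp add: \<Lambda>_def)
  qed (use fp hv a pv in auto)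
  have "ennreal (Gamma a * norm ?G)
      \<le> (\<integral>\<^sup>+t. tweight a t * ennreal (norm (?T t)) \<partial>lborel)"
    using \<rho> by (intro norm_Gamma_sum_le a cp_summable[OF f h B]) auto
  also have "\<dots> = (\<integral>\<^sup>+t. ennreal (X * Y) * (tweight a t * ennreal (norm (?T t) / (X * Y))) \<partial>lborel)"
  proof (intro nn_integral_cong)
    fix t
    have "ennreal (norm (?T t)) = ennreal (X * Y) * ennreal (norm (?T t) / (X * Y))"
      using XY by (subst ennreal_mult[symmetric]) auto
    then show "tweight a t * ennreal (norm (?T t))
      = ennreal (X * Y) * (tweight a t * ennreal (norm (?T t) / (X * Y)))"
      by (simp only: mult_ac)
  qed
  also have "\<dots> = ennreal (X * Y) * (\<integral>\<^sup>+t. tweight a t * ennreal (norm (?T t) / (X * Y)) \<partial>lborel)"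
    by (rule nn_integral_cmult) measurable
  also have "\<dots> \<le> ennreal (X * Y) * ennreal (hls_const a p v)"
    by (intro mult_left_mono main) auto
  also have "\<dots> = ennreal (X * Y * hls_const a p v)"
    using XY by (simp add: ennreal_mult')
  finally have "ennreal (Gamma a * norm ?G)
      \<le> ennreal (X * Y * hls_const a p v)" .
  moreover have "0 \<le> hls_const a p v"
  proof -
    have "1 / v < 1" "1 / p < 1" using pv by auto
    then have "a / (2 * k + 1) < 1 / p" "a / (2 * k + 1) < 1 / v" using rel by linarith+
    then have "a < (2 * k + 1) * (1 / p)" "a < (2 * k + 1) * (1 / v)" using k_pos by (simp_all add: field_simps)
    moreover have "0 \<le> \<Lambda>" using CZ_pos by (simp add: \<Lambda>_def)
    ultimately show ?thesis unfolding hls_const_def using a by (intro add_nonneg_nonneg mult_nonneg_nonneg) auto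
  qed
  ultimately have "Gamma a * norm ?G \<le> X * Y * hls_const a p v"
    using XY by (subst (asm) ennreal_le_iff) auto
  then show ?thesis using Gamma_real_pos[OF a(1)] by (simp add: field_simps)
qed

text \<open>Projections are continuous in L^1, so g has the components of the multiplier series and
  its Poisson integral, paired with h, is the damped series bounded by K. To remove rho, g is
  compared with a partial sum s_N: the Poisson operator does not increase the L^1 distance, and on
  the finite sum s_N the damping factors simply tend to 1. Letting N grow then removes the
  error.\<close>

lemma pairing_limit:
  fixes a :: "nat \<Rightarrow> real"
  assumes f: "integrable \<mu> f" and g: "integrable \<mu> g"
    and h: "h \<in> borel_measurable borel" and B: "\<And>x. norm (h x) \<le> B"
    and lim: "(\<lambda>N. \<integral>x. norm (g x - (\<Sum>j<N. a j *\<^sub>R Zop (Suc j) f x)) \<partial>\<mu>) \<longlonglongrightarrow> 0"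
    and K: "\<And>\<rho>. 0 < \<rho> \<Longrightarrow> \<rho> < 1 \<Longrightarrow>
      norm (\<Sum>n. of_real (\<rho> ^ Suc n * a n) * cp (Suc n) f h) \<le> K"
  shows "norm (\<integral>x. g x * h x \<partial>\<mu>) \<le> K"
proof -
  let ?gh = "\<integral>x. g x * h x \<partial>\<mu>"
  define s where "s N x = (\<Sum>j<N. a j *\<^sub>R Zop (Suc j) f x)" for N x
  define e where "e N = (\<integral>x. norm (g x - s N x) \<partial>\<mu>)" for N
  have e: "e \<longlonglongrightarrow> 0" using lim unfolding e_def s_def .
  have si: "integrable \<mu> (s N)" for N
    unfolding s_def by (intro Bochner_Integration.integrable_sum integrable_scaleR_right Zop_integrable f)
  have gs: "integrable \<mu> (\<lambda>x. g x - s N x)" for N using g si by simp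
  have Zs: "Zop n (s N) x = (\<Sum>j<N. a j *\<^sub>R (if n = Suc j then Zop (Suc j) f x else 0))" for n N x
    unfolding s_def Zop_sum[OF Zop_integrable[OF f]] Zop_Zop[OF f] ..
  have Zs0: "Zop 0 (s N) x = 0" for N x unfolding Zs by simp
  have ZsS: "Zop (Suc m) (s N) x = (if m < N then a m *\<^sub>R Zop (Suc m) f x else 0)" for m N x
    unfolding Zs by (simp add: if_distrib[of "scaleR _"] cong: if_cong)
  have Zlim: "(\<lambda>N. Zop n (s N) x) \<longlonglongrightarrow> Zop n g x" for n x
  proof -
    have "(\<lambda>N. CZ * \<beta> n * e N) \<longlonglongrightarrow> CZ * \<beta> n * 0" by (intro tendsto_intros e)
    then have l: "(\<lambda>N. CZ * \<beta> n * e N) \<longlonglongrightarrow> 0" by simp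
    have b: "norm (Zop n g x - Zop n (s N) x) \<le> CZ * \<beta> n * e N" for N
      using Zop_bound[OF gs[of N], of n x] unfolding Zop_diff[OF g si] e_def .
    have "(\<lambda>N. Zop n g x - Zop n (s N) x) \<longlonglongrightarrow> 0"
      by (rule Lim_null_comparison[OF always_eventually l]) (use b in blast)
    then have "(\<lambda>N. Zop n g x - (Zop n g x - Zop n (s N) x)) \<longlonglongrightarrow> Zop n g x - 0"
      by (intro tendsto_intros)
    then show ?thesis by simp
  qed
  have Zg0: "Zop 0 g x = 0" for x
    using LIMSEQ_unique[OF Zlim[of 0 x, unfolded Zs0] tendsto_const] .
  have ZgS: "Zop (Suc m) g x = a m *\<^sub>R Zop (Suc m) f x" for m x
  proof -
    have "(\<lambda>N. Zop (Suc m) (s N) x) \<longlonglongrightarrow> a m *\<^sub>R Zop (Suc m) f x"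
      by (rule tendsto_eventually) (auto simp: ZsS eventually_sequentially intro!: exI[of _ "Suc m"])
    then show ?thesis using LIMSEQ_unique[OF Zlim] by blast
  qed
  have cg0: "cp 0 g h = 0" by (simp add: cp_def Zg0)
  have cgS: "cp (Suc m) g h = of_real (a m) * cp (Suc m) f h" for m
    by (simp add: cp_def ZgS scaleR_conv_of_real mult.assoc)
  have cs0: "cp 0 (s N) h = 0" for N by (simp add: cp_def Zs0)
  have csS: "cp (Suc m) (s N) h = (if m < N then of_real (a m) * cp (Suc m) f h else 0)" for m N
    by (simp add: cp_def ZsS scaleR_conv_of_real mult.assoc)
  have int_s: "(\<integral>x. s N x * h x \<partial>\<mu>) = (\<Sum>m<N. of_real (a m) * cp (Suc m) f h)" for N
  proof -
    have "(\<integral>x. s N x * h x \<partial>\<mu>) = (\<integral>x. (\<Sum>m<N. of_real (a m) * (Zop (Suc m) f x * h x)) \<partial>\<mu>)"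
      unfolding s_def by (simp add: sum_distrib_right scaleR_conv_of_real mult.assoc)
    also have "\<dots> = (\<Sum>m<N. \<integral>x. of_real (a m) * (Zop (Suc m) f x * h x) \<partial>\<mu>)"
      by (intro Bochner_Integration.integral_sum integrable_mult_right
          integrable_mult_bounded[OF Zop_integrable[OF f] h B])
    finally show ?thesis by (simp add: cp_def)
  qed
  define P where "P \<rho> u = (\<integral>x. (\<integral>y. Pk \<rho> x y *\<^sub>R u y \<partial>\<mu>) * h x \<partial>\<mu>)" for \<rho> and u :: "real \<Rightarrow> complex"
  have Psum: "(\<lambda>n. of_real (\<rho> ^ n) * cp n u h) sums P \<rho> u" if "0 < \<rho>" "\<rho> < 1" "integrable \<mu> u" for \<rho> u
    unfolding P_def using that by (intro pairing_sums(1)[OF _ h B]) auto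
  have Pg: "norm (P \<rho> g) \<le> K" if \<rho>: "0 < \<rho>" "\<rho> < 1" for \<rho>
  proof -
    have "(\<lambda>n. of_real (\<rho> ^ Suc n) * cp (Suc n) g h) sums (P \<rho> g - of_real (\<rho> ^ 0) * cp 0 g h)"
      using Psum[OF \<rho> g] by (subst sums_Suc_iff) simp
    then have "P \<rho> g = (\<Sum>n. of_real (\<rho> ^ Suc n) * cp (Suc n) g h)"
      by (simp add: cg0 sums_iff)
    also have "\<dots> = (\<Sum>n. of_real (\<rho> ^ Suc n * a n) * cp (Suc n) f h)"
      by (simp add: cgS mult.assoc)
    finally show ?thesis using K[OF \<rho>] by simp
  qed
  have Ps: "P \<rho> (s N) = (\<Sum>m<N. of_real (\<rho> ^ Suc m) * (of_real (a m) * cp (Suc m) f h))"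
    if \<rho>: "0 < \<rho>" "\<rho> < 1" for \<rho> N
  proof -
    have "(\<lambda>n. of_real (\<rho> ^ Suc n) * cp (Suc n) (s N) h) sums (P \<rho> (s N) - of_real (\<rho> ^ 0) * cp 0 (s N) h)"
      using Psum[OF \<rho> si] by (subst sums_Suc_iff) simp
    then have "P \<rho> (s N) = (\<Sum>n. of_real (\<rho> ^ Suc n) * cp (Suc n) (s N) h)"
      by (simp add: cs0 sums_iff)
    also have "\<dots> = (\<Sum>m<N. of_real (\<rho> ^ Suc m) * cp (Suc m) (s N) h)"
      by (rule suminf_finite) (auto simp: csS)
    also have "\<dots> = (\<Sum>m<N. of_real (\<rho> ^ Suc m) * (of_real (a m) * cp (Suc m) f h))"
      by (intro sum.cong refl) (simp add: csS)
    finally show ?thesis .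
  qed
  have Pdiff: "norm (P \<rho> g - P \<rho> (s N)) \<le> B * e N" if \<rho>: "0 < \<rho>" "\<rho> < 1" for \<rho> N
  proof -
    have c: "cp n g h - cp n (s N) h = cp n (\<lambda>x. g x - s N x) h" for n
      unfolding cp_def Zop_diff[OF g si] left_diff_distrib
      by (rule Bochner_Integration.integral_diff[symmetric];
          intro integrable_mult_bounded[OF Zop_integrable h B] g si)
    have "(\<lambda>n. of_real (\<rho> ^ n) * cp n g h - of_real (\<rho> ^ n) * cp n (s N) h) sums (P \<rho> g - P \<rho> (s N))"
      by (intro sums_diff Psum \<rho> g si)
    then have "(\<lambda>n. of_real (\<rho> ^ n) * cp n (\<lambda>x. g x - s N x) h) sums (P \<rho> g - P \<rho> (s N))"
      by (simp only: right_diff_distrib[symmetric] c)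
    then have "P \<rho> g - P \<rho> (s N) = P \<rho> (\<lambda>x. g x - s N x)"
      using Psum[OF \<rho> gs] sums_unique2 by blast
    then show ?thesis
      unfolding e_def using pairing_contraction[OF gs h B \<rho>] by (simp add: P_def)
  qed
  have "norm ?gh \<le> K + 2 * (B * e N)" for N
  proof -
    \<comment> \<open>Any sequence in (0, 1) with limit 1 serves; the shift by 2 keeps its first
      term positive.\<close>
    define \<rho> where "\<rho> i = 1 - 1 / (real i + 2)" for i :: nat
    have \<rho>: "0 < \<rho> i" "\<rho> i < 1" for i by (auto simp: \<rho>_def)
    have \<rho>1: "\<rho> \<longlonglongrightarrow> 1"
    proof -
      have "(\<lambda>i. 1 - 1 / (real (i + 2))) \<longlonglongrightarrow> 1 - 0"
        by (intro tendsto_intros LIMSEQ_ignore_initial_segment[OF lim_const_over_n])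
      then show ?thesis by (simp add: \<rho>_def[abs_def] add.commute)
    qed
    have "(\<lambda>i. P (\<rho> i) (s N)) \<longlonglongrightarrow> (\<Sum>m<N. of_real (1 ^ Suc m) * (of_real (a m) * cp (Suc m) f h))"
      unfolding Ps[OF \<rho>] by (intro tendsto_intros \<rho>1)
    then have "(\<lambda>i. norm ((\<integral>x. s N x * h x \<partial>\<mu>) - P (\<rho> i) (s N))) \<longlonglongrightarrow> norm ((\<integral>x. s N x * h x \<partial>\<mu>) - (\<integral>x. s N x * h x \<partial>\<mu>))"
      unfolding int_s by (intro tendsto_intros) simp
    then have "(\<lambda>i. B * e N + norm ((\<integral>x. s N x * h x \<partial>\<mu>) - P (\<rho> i) (s N)) + B * e N + K)
        \<longlonglongrightarrow> B * e N + 0 + B * e N + K"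
      by (intro tendsto_intros) simp
    moreover have "norm ?gh \<le> B * e N + norm ((\<integral>x. s N x * h x \<partial>\<mu>) - P (\<rho> i) (s N)) + B * e N + K" for i
    proof -
      have "norm (?gh - (\<integral>x. s N x * h x \<partial>\<mu>)) \<le> B * e N"
      proof -
        have "?gh - (\<integral>x. s N x * h x \<partial>\<mu>) = (\<integral>x. (g x - s N x) * h x \<partial>\<mu>)"
          unfolding left_diff_distrib
          by (rule Bochner_Integration.integral_diff[symmetric]; intro integrable_mult_bounded[OF _ h B] g si)
        then show ?thesis unfolding e_def using integral_mult_bounded_le[OF gs h B] by simp
      qed
      moreover have "norm (P (\<rho> i) g - P (\<rho> i) (s N)) \<le> B * e N" by (rule Pdiff[OF \<rho>])
      moreover have "norm (P (\<rho> i) g) \<le> K" by (rule Pg[OF \<rho>])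
      moreover have "norm ?gh \<le> norm (?gh - (\<integral>x. s N x * h x \<partial>\<mu>))
          + norm ((\<integral>x. s N x * h x \<partial>\<mu>) - P (\<rho> i) (s N)) + norm (P (\<rho> i) g - P (\<rho> i) (s N)) + norm (P (\<rho> i) g)"
        by norm
      ultimately show ?thesis by linarith
    qed
    ultimately have "norm ?gh \<le> B * e N + 0 + B * e N + K"
      by (intro LIMSEQ_le_const) auto
    then show ?thesis by simp
  qed
  moreover have "(\<lambda>N. K + 2 * (B * e N)) \<longlonglongrightarrow> K + 2 * (B * 0)" by (intro tendsto_intros e)
  ultimately show ?thesis by (intro LIMSEQ_le_const) auto
qed

text \<open>The pointwise inequality y <= e + y^2 / e splits the L^1 norm into e times the finite
  total mass, arbitrarily small, and a multiple of the squared L^2 norm.\<close>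

lemma L2_imp_L1_tendsto:
  fixes u :: "nat \<Rightarrow> real \<Rightarrow> complex"
  assumes [measurable]: "\<And>N. u N \<in> borel_measurable borel"
    and sq: "\<And>N. integrable \<mu> (\<lambda>x. norm (u N x) powr 2)"
    and lim: "(\<lambda>N. \<integral>x. norm (u N x) powr 2 \<partial>\<mu>) \<longlonglongrightarrow> 0"
  shows "(\<lambda>N. \<integral>x. norm (u N x) \<partial>\<mu>) \<longlonglongrightarrow> 0"
proof (rule LIMSEQ_I)
  fix r :: real assume r: "0 < r"
  define m where "m = measure \<mu> UNIV"
  define e where "e = r / (m + 1)"
  have m: "0 \<le> m" by (simp add: m_def)
  have e: "0 < e" "e * m < r" using r m by (auto simp: e_def field_simps)
  have bound: "norm (u N x) \<le> e + norm (u N x) powr 2 / e" for N x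
  proof (cases "norm (u N x) \<le> e")
    case True
    then show ?thesis using e by (simp add: add_increasing2)
  next
    case False
    then have "norm (u N x) * e \<le> norm (u N x) * norm (u N x)" by (intro mult_left_mono) auto
    then have "norm (u N x) \<le> norm (u N x) powr 2 / e" using e by (simp add: field_simps power2_eq_square)
    then show ?thesis using e by simp
  qed
  have ib: "integrable \<mu> (\<lambda>x. e + norm (u N x) powr 2 / e)" for N using sq by simp
  have ui: "integrable \<mu> (\<lambda>x. norm (u N x))" for N
    by (rule Bochner_Integration.integrable_bound[OF ib]) (use bound in \<open>auto intro: order_trans[OF _ abs_ge_self]\<close>)
  have le: "(\<integral>x. norm (u N x) \<partial>\<mu>) \<le> e * m + (\<integral>x. norm (u N x) powr 2 \<partial>\<mu>) / e" for N
  proof -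
    have "(\<integral>x. norm (u N x) \<partial>\<mu>) \<le> (\<integral>x. e + norm (u N x) powr 2 / e \<partial>\<mu>)"
      by (intro integral_mono ui ib bound)
    also have "\<dots> = e * m + (\<integral>x. norm (u N x) powr 2 \<partial>\<mu>) / e"
      using sq by (subst Bochner_Integration.integral_add) (auto simp: m_def)
    finally show ?thesis .
  qed
  have "(\<lambda>N. e * m + (\<integral>x. norm (u N x) powr 2 \<partial>\<mu>) / e) \<longlonglongrightarrow> e * m + 0 / e"
    using e by (intro tendsto_intros lim) auto
  then have "eventually (\<lambda>N. e * m + (\<integral>x. norm (u N x) powr 2 \<partial>\<mu>) / e < r) sequentially"
    using e by (intro order_tendstoD) auto
  then have "eventually (\<lambda>N. norm ((\<integral>x. norm (u N x) \<partial>\<mu>) - 0) < r) sequentially"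
    by eventually_elim (use le in \<open>auto intro: le_less_trans\<close>)
  then show "\<exists>no. \<forall>n\<ge>no. norm ((\<integral>x. norm (u n x) \<partial>\<mu>) - 0) < r"
    by (simp only: eventually_sequentially)
qed

text \<open>The test function is the extremal one in Hoelder's inequality, cut off where |g| > n.
  The cut-off makes it bounded and I_n finite, so I_n <= C I_n^(1/v) may be divided to give
  I_n^(1/q) <= C. Monotone convergence then removes the cut-off.\<close>

lemma Lp_dual_bound:
  fixes g :: "real \<Rightarrow> complex"
  assumes [measurable]: "g \<in> borel_measurable borel"
    and q: "1 < q" and v: "v = q / (q - 1)" and C: "0 \<le> C"
    and dual: "\<And>h B Y. h \<in> borel_measurable borel \<Longrightarrow> (\<And>x. norm (h x) \<le> B) \<Longrightarrow> 0 < Y \<Longrightarrow>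
      (\<integral>x. norm (h x) powr v \<partial>\<mu>) \<le> Y powr v \<Longrightarrow> norm (\<integral>x. g x * h x \<partial>\<mu>) \<le> C * Y"
  shows "integrable \<mu> (\<lambda>x. norm (g x) powr q) \<and> (\<integral>x. norm (g x) powr q \<partial>\<mu>) \<le> C powr q"
proof -
  have v0: "0 < v" using q by (simp add: v)
  have qv: "1 - 1 / v = 1 / q" using q by (simp add: v field_simps)
  define G where "G n x = (if norm (g x) \<le> real n then norm (g x) powr q else 0)" for n x
  define h where "h n x = (if norm (g x) \<le> real n \<and> g x \<noteq> 0 then cnj (g x) * of_real (norm (g x) powr (q - 2)) else 0)" for n x
  have [measurable]: "(\<lambda>x. cnj (g x)) \<in> borel_measurable borel"
    by (rule measurable_compose[of g borel borel cnj])
      (auto intro!: borel_measurable_continuous_onI continuous_intros)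
  have [measurable]: "G n \<in> borel_measurable borel" "h n \<in> borel_measurable borel" for n
    unfolding G_def h_def by measurable
  have nh: "norm (h n x) = (if norm (g x) \<le> real n \<and> g x \<noteq> 0 then norm (g x) powr (q - 1) else 0)" for n x
  proof -
    have "norm (g x) * norm (g x) powr (q - 2) = norm (g x) powr (q - 1)" if "g x \<noteq> 0"
      using that by (simp add: powr_mult_base)
    then show ?thesis by (simp add: h_def norm_mult)
  qed
  have hv: "norm (h n x) powr v = G n x" for n x
  proof -
    have "(q - 1) * v = q" using q by (simp add: v)
    then show ?thesis unfolding nh G_def using v0 q by (auto simp: powr_powr)
  qed
  have gh: "g x * h n x = of_real (G n x)" for n x
  proof (cases "norm (g x) \<le> real n \<and> g x \<noteq> 0")
    case True
    have "g x * h n x = of_real ((norm (g x))\<^sup>2) * of_real (norm (g x) powr (q - 2))"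
      using True by (simp add: h_def complex_norm_square mult.assoc del: of_real_power)
    also have "\<dots> = of_real (norm (g x) powr 2 * norm (g x) powr (q - 2))"
      using True by simp
    also have "norm (g x) powr 2 * norm (g x) powr (q - 2) = norm (g x) powr q"
      unfolding powr_add[symmetric] by simp
    finally show ?thesis using True by (simp add: G_def)
  qed (auto simp: h_def G_def)
  have Gb: "0 \<le> G n x" "G n x \<le> real n powr q" for n x
    using q by (auto simp: G_def intro!: powr_mono2)
  have Gi: "integrable \<mu> (G n)" for n
    by (rule integrable_mu_bounded[of _ "real n powr q"]) (use Gb in auto)
  define I where "I n = (\<integral>x. G n x \<partial>\<mu>)" for n
  have I0: "0 \<le> I n" for n unfolding I_def using Gb by (intro integral_nonneg_AE) auto
  have hb: "norm (h n x) \<le> real n powr (q - 1)" for n x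
    unfolding nh using q by (auto intro!: powr_mono2)
  have I: "I n \<le> C powr q" for n
  proof (cases "I n = 0")
    case False
    then have Ip: "0 < I n" using I0[of n] by simp
    define Y where "Y = I n powr (1 / v)"
    have Y: "0 < Y" "Y powr v = I n" using Ip v0 by (auto simp: Y_def powr_powr)
    have "norm (\<integral>x. g x * h n x \<partial>\<mu>) \<le> C * Y"
      by (rule dual[OF _ hb Y(1)]) (auto simp: hv Y(2) I_def)
    then have "I n \<le> C * Y" using I0[of n] by (simp add: gh I_def)
    then have "I n powr 1 / I n powr (1 / v) \<le> C" using Y(1) Ip by (simp add: Y_def divide_le_eq)
    then have "I n powr (1 / q) \<le> C" unfolding powr_diff[symmetric] qv .
    then have "(I n powr (1 / q)) powr q \<le> C powr q" using q by (intro powr_mono2) auto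
    then show ?thesis using q Ip by (simp add: powr_powr)
  qed simp
  have mono: "incseq (\<lambda>n x. ennreal (G n x))"
    by (auto simp: incseq_def le_fun_def G_def intro!: ennreal_leI)
  have sup: "(SUP n. ennreal (G n x)) = ennreal (norm (g x) powr q)" for x
  proof (rule antisym)
    show "(SUP n. ennreal (G n x)) \<le> ennreal (norm (g x) powr q)"
      by (intro SUP_least ennreal_leI) (auto simp: G_def)
    obtain n where "norm (g x) \<le> real n" using real_arch_simple by blast
    then show "ennreal (norm (g x) powr q) \<le> (SUP n. ennreal (G n x))"
      by (intro SUP_upper2[of n]) (auto simp: G_def)
  qed
  have "(\<integral>\<^sup>+x. ennreal (norm (g x) powr q) \<partial>\<mu>) = (SUP n. \<integral>\<^sup>+x. ennreal (G n x) \<partial>\<mu>)"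
    unfolding sup[symmetric] by (rule nn_integral_monotone_convergence_SUP[OF mono]) measurable
  also have "\<dots> \<le> ennreal (C powr q)"
  proof (rule SUP_least)
    fix n
    have "(\<integral>\<^sup>+x. ennreal (G n x) \<partial>\<mu>) = ennreal (I n)"
      unfolding I_def using Gi Gb by (intro nn_integral_eq_integral) auto
    then show "(\<integral>\<^sup>+x. ennreal (G n x) \<partial>\<mu>) \<le> ennreal (C powr q)" using I by (simp add: ennreal_leI)
  qed
  finally have fin: "(\<integral>\<^sup>+x. ennreal (norm (g x) powr q) \<partial>\<mu>) \<le> ennreal (C powr q)" .
  have i: "integrable \<mu> (\<lambda>x. norm (g x) powr q)"
    by (rule integrableI_bounded) (use fin in \<open>auto intro: le_less_trans\<close>)
  then have "ennreal (\<integral>x. norm (g x) powr q \<partial>\<mu>) \<le> ennreal (C powr q)"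
    using fin by (subst nn_integral_eq_integral[symmetric]) auto
  then show ?thesis using i by (simp add: ennreal_le_iff)
qed

section \<open>The norm inequality for the fractional integral\<close>

lemma Lp_mem_measurable: "Lp_mem k p f \<Longrightarrow> f \<in> borel_measurable borel"
proof -
  assume "Lp_mem k p f"
  then have "f \<in> borel_measurable \<mu>" by (simp add: Lp_mem_def)
  then show ?thesis by simp
qed

lemma Lp_mem_2_integrable:
  assumes "Lp_mem k 2 f"
  shows "integrable \<mu> f"
proof (rule Bochner_Integration.integrable_bound)
  have i: "integrable \<mu> (\<lambda>x. norm (f x) powr 2)" using assms by (simp add: Lp_mem_def)
  then show "integrable \<mu> (\<lambda>x. 1 + norm (f x) powr 2)" by simp
  show "f \<in> borel_measurable \<mu>" using assms by (simp add: Lp_mem_def)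
  have "y \<le> 1 + y powr 2" if "0 \<le> y" for y :: real
  proof -
    have "0 \<le> (y - 1)\<^sup>2" by simp
    then show ?thesis using that by (simp add: power2_eq_square algebra_simps)
  qed
  then show "AE x in \<mu>. norm (f x) \<le> norm (1 + norm (f x) powr 2)" by (auto simp: abs_of_nonneg)
qed

theorem fractional_integral_bound:
  assumes a: "0 < \<alpha>" and p: "1 < p" "p < (2 * k + 1) / \<alpha>"
    and f: "Lp_mem k 2 f" "Lp_mem k p f" and g: "Lp_mem k 2 g"
    and lim: "(\<lambda>N. Lp_norm k 2 (\<lambda>x. g x - fracI_partial k \<alpha> f N x)) \<longlonglongrightarrow> 0"
    and q: "q = 1 / (1 / p - \<alpha> / (2 * k + 1))" and v: "v = q / (q - 1)"
  shows "Lp_mem k q g \<and> Lp_norm k q g \<le> hls_const \<alpha> p v / Gamma \<alpha> * Lp_norm k p f"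
proof -
  let ?D = "2 * k + 1" and ?K = "hls_const \<alpha> p v / Gamma \<alpha>"
  have D: "1 < ?D" using k_pos by simp
  have ap: "\<alpha> / ?D < 1 / p"
  proof -
    have "p * \<alpha> < ?D" using p a by (simp add: field_simps)
    then show ?thesis using p D by (simp add: field_simps)
  qed
  have iq: "1 / q = 1 / p - \<alpha> / ?D" by (simp add: q)
  have aD: "0 < \<alpha> / ?D" using a D by simp
  have p1: "1 / p < 1" using p by simp
  have q1: "1 < q"
  proof -
    have "0 < 1 / q" "1 / q < 1" using ap aD p1 iq by linarith+
    then show ?thesis by (simp add: field_simps)
  qed
  have iv: "1 / v = 1 - 1 / q" using q1 by (simp add: v field_simps)
  have v1: "1 < v" using q1 by (simp add: v field_simps)
  have rel: "1 / p + 1 / v = 1 + \<alpha> / ?D" using iv iq by simp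
  have aD2: "\<alpha> < ?D"
  proof -
    have "\<alpha> / ?D < 1" using ap p1 by linarith
    then show ?thesis using D by simp
  qed
  have fi: "integrable \<mu> f" and gi: "integrable \<mu> g" using f g by (auto intro: Lp_mem_2_integrable)
  have [measurable]: "f \<in> borel_measurable borel" "g \<in> borel_measurable borel"
    using f(1) g by (auto intro: Lp_mem_measurable)
  define s where "s N x = (\<Sum>j<N. (real (Suc j) powr - \<alpha>) *\<^sub>R Zop (Suc j) f x)" for N x
  have s: "fracI_partial k \<alpha> f N x = s N x" for N x
    unfolding s_def by (rule fracI_partial_eq[OF fi])
  have sc: "continuous_on UNIV (s N)" for N
    unfolding s_def[abs_def] by (intro continuous_intros Zop_continuous fi)
  have [measurable]: "s N \<in> borel_measurable borel" for N
    by (rule borel_measurable_continuous_onI[OF sc])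
  have sq: "integrable \<mu> (\<lambda>x. norm (g x - s N x) powr 2)" for N
  proof (rule Bochner_Integration.integrable_bound)
    have "integrable \<mu> (\<lambda>x. (norm (s N x))\<^sup>2)"
      by (intro integrable_mu_cont continuous_intros sc)
    moreover have "integrable \<mu> (\<lambda>x. norm (g x) powr 2)" using g by (simp add: Lp_mem_def)
    ultimately show "integrable \<mu> (\<lambda>x. 2 * (norm (g x))\<^sup>2 + 2 * (norm (s N x))\<^sup>2)" by simp
    have "(norm (z - w))\<^sup>2 \<le> 2 * (norm z)\<^sup>2 + 2 * (norm w)\<^sup>2" for z w :: complex
    proof -
      have "(norm (z - w))\<^sup>2 \<le> (norm z + norm w)\<^sup>2"
        by (intro power_mono norm_triangle_ineq4) auto
      also have "\<dots> \<le> 2 * (norm z)\<^sup>2 + 2 * (norm w)\<^sup>2"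
        using zero_le_power2[of "norm z - norm w"] by (simp add: power2_eq_square algebra_simps)
      finally show ?thesis .
    qed
    then show "AE x in \<mu>. norm (norm (g x - s N x) powr 2) \<le> norm (2 * (norm (g x))\<^sup>2 + 2 * (norm (s N x))\<^sup>2)"
      by (auto simp: abs_of_nonneg)
  qed measurable
  have "(\<lambda>N. (Lp_norm k 2 (\<lambda>x. g x - s N x))\<^sup>2) \<longlonglongrightarrow> 0\<^sup>2"
    using lim unfolding s by (intro tendsto_intros)
  moreover have "(Lp_norm k 2 (\<lambda>x. g x - s N x))\<^sup>2 = (\<integral>x. norm (g x - s N x) powr 2 \<partial>\<mu>)" for N
  proof -
    have "0 \<le> (\<integral>x. norm (g x - s N x) powr 2 \<partial>\<mu>)" by (intro integral_nonneg_AE) auto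
    then show ?thesis unfolding Lp_norm_def by (simp add: powr_half_sqrt)
  qed
  ultimately have "(\<lambda>N. \<integral>x. norm (g x - s N x) powr 2 \<partial>\<mu>) \<longlonglongrightarrow> 0" by simp
  then have lim1: "(\<lambda>N. \<integral>x. norm (g x - s N x) \<partial>\<mu>) \<longlonglongrightarrow> 0"
    by (intro L2_imp_L1_tendsto sq) measurable
  have fp: "integrable \<mu> (\<lambda>x. norm (f x) powr p)" using f by (simp add: Lp_mem_def)
  define J where "J = (\<integral>x. norm (f x) powr p \<partial>\<mu>)"
  have J0: "0 \<le> J" unfolding J_def by (intro integral_nonneg_AE) auto
  \<comment> \<open>X replaces the norm of f, which may be zero; later it is taken as that norm plus
    an arbitrary e > 0.\<close>
  have dual: "norm (\<integral>x. g x * h x \<partial>\<mu>) \<le> ?K * X * Y"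
    if h: "h \<in> borel_measurable borel" and B: "\<And>x. norm (h x) \<le> B" and Y: "0 < Y"
      "(\<integral>x. norm (h x) powr v \<partial>\<mu>) \<le> Y powr v" and X: "0 < X" "J \<le> X powr p" for h B X Y
  proof (rule pairing_limit[OF fi gi h B])
    show "(\<lambda>N. \<integral>x. norm (g x - (\<Sum>j<N. (real (Suc j) powr - \<alpha>) *\<^sub>R Zop (Suc j) f x)) \<partial>\<mu>) \<longlonglongrightarrow> 0"
      using lim1 unfolding s_def .
    show "norm (\<Sum>n. of_real (\<rho> ^ Suc n * real (Suc n) powr - \<alpha>) * cp (Suc n) f h) \<le> ?K * X * Y"
      if "0 < \<rho>" "\<rho> < 1" for \<rho>
      using that X Y unfolding J_def
      by (intro fractional_pairing_bound[OF fi h B fp _ _ _ _ a aD2 p(1) v1 rel]) auto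
  qed
  have Xb: "integrable \<mu> (\<lambda>x. norm (g x) powr q) \<and> (\<integral>x. norm (g x) powr q \<partial>\<mu>) \<le> (?K * X) powr q"
    if X: "0 < X" "J \<le> X powr p" for X
  proof (rule Lp_dual_bound[OF _ q1 v])
    have "0 \<le> ?K * X * 1"
      using dual[of "\<lambda>_. 0" 0 1 X] X by simp
    then show "0 \<le> ?K * X" by simp
    show "norm (\<integral>x. g x * h x \<partial>\<mu>) \<le> ?K * X * Y"
      if "h \<in> borel_measurable borel" "\<And>x. norm (h x) \<le> B" "0 < Y"
        "(\<integral>x. norm (h x) powr v \<partial>\<mu>) \<le> Y powr v" for h B Y
      by (rule dual[OF that X])
  qed measurable
  define L where "L = Lp_norm k p f"
  have L0: "0 \<le> L" by (simp add: L_def Lp_norm_def)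
  have LJ: "L powr p = J" using J0 p by (simp add: L_def Lp_norm_def J_def[symmetric] powr_powr)
  have XL: "0 < L + e" "J \<le> (L + e) powr p" if "0 < e" for e
    using that L0 p unfolding LJ[symmetric] by (auto intro!: powr_mono2)
  have i: "integrable \<mu> (\<lambda>x. norm (g x) powr q)" using Xb[OF XL[OF zero_less_one]] by simp
  \<comment> \<open>The sign of the constant is read off from the dual bound with h = 0.\<close>
  have K0: "0 \<le> ?K"
  proof -
    have "norm (\<integral>x. g x * 0 \<partial>\<mu>) \<le> ?K * (L + 1) * 1"
      using XL[OF zero_less_one] by (intro dual[of "\<lambda>_. 0" 0]) auto
    then have "0 \<le> ?K * (L + 1)" by (simp only: mult_zero_right integral_zero norm_zero mult_1_right)
    then show ?thesis using L0 by (simp only: zero_le_mult_iff) linarith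
  qed
  have "Lp_norm k q g \<le> ?K * (L + e)" if e: "0 < e" for e
  proof -
    have "Lp_norm k q g \<le> ((?K * (L + e)) powr q) powr (1 / q)"
      unfolding Lp_norm_def using Xb[OF XL[OF e]] q1
      by (intro powr_mono2 integral_nonneg_AE) auto
    also have "\<dots> = ?K * (L + e)"
    proof -
      have "(z powr q) powr (1 / q) = z" if "0 \<le> z" for z :: real using that q1 by (simp add: powr_powr)
      then show ?thesis using K0 less_imp_le[OF XL(1)[OF e]] by (blast intro: mult_nonneg_nonneg)
    qed
    finally show ?thesis .
  qed
  then have "Lp_norm k q g \<le> ?K * L + e" if "0 < e" for e
  proof -
    have "Lp_norm k q g \<le> ?K * (L + e / (?K + 1))"
      using that K0 by (intro \<open>\<And>e. 0 < e \<Longrightarrow> Lp_norm k q g \<le> ?K * (L + e)\<close>) simp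
    also have "\<dots> \<le> ?K * L + e"
    proof -
      have "z * (e / (z + 1)) \<le> e" if "0 \<le> z" for z :: real
        using that \<open>0 < e\<close> by (simp add: field_simps)
      from this[OF K0] show ?thesis by (simp only: distrib_left add_le_cancel_left)
    qed
    finally show ?thesis .
  qed
  then have "Lp_norm k q g \<le> ?K * L" by (rule field_le_epsilon)
  moreover have "Lp_mem k q g" unfolding Lp_mem_def using i by simp
  ultimately show ?thesis by (simp add: L_def)
qed

end

text \<open>The series for the fractional integral is rendered by its L^2 limit g along the partial
  sums over |n| <= N. The constant is uniform in f and g because \<open>hls_const\<close> and the
  Gamma factor depend only on k, \<alpha> and p, which determine q and its conjugate v.\<close>

theorem mainTheorem11:
  fixes k \<alpha> p :: real
  assumes "k > 0" and "\<alpha> > 0" and "1 < p" and "p < (2 * k + 1) / \<alpha>"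
  shows "\<exists>C. \<forall>f g. Lp_mem k 2 f \<and> Lp_mem k p f \<and> Lp_mem k 2 g \<and>
            (\<lambda>N. Lp_norm k 2 (\<lambda>x. g x - fracI_partial k \<alpha> f N x)) \<longlonglongrightarrow> 0 \<longrightarrow>
            Lp_mem k (1 / (1 / p - \<alpha> / (2 * k + 1))) g \<and>
            Lp_norm k (1 / (1 / p - \<alpha> / (2 * k + 1))) g \<le> C * Lp_norm k p f"
proof -
  interpret cherednik k by standard (rule assms)
  show ?thesis
    using fractional_integral_bound[OF assms(2-4) _ _ _ _ refl refl] by blast
qed

end
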